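(* (I) The intersection non-emptiness problem for ABA is PSPACE-hard, and the intersection non-emptiness problem for $\mu\mathrm{TL}$ (linear $\mu$-calculus) is PSPACE-hard. (II) The model-checking problems $\mathrm{MC}(\mathrm{ABA},\mathcal{CFS})$ and $\mathrm{MC}(\mu\mathrm{TL},\mathcal{CFS})$ over flat counter systems are PSPACE-hard.
   Context: Counter systems. Let $\mathrm{AT}$ be a countably infinite set of propositional variables and $\mathtt{C}_n=\{x_1,\dots,x_n\}$ a set of counters (variables over $\mathbb{N}$). An atomic guard is a constraint $\sum_{i=1}^n a_i x_i\sim b$ with $a_i\in\mathbb{Z}$, $b\in\mathbb{N}$, $\sim\,\in\{=,\le,\ge,<,>\}$; $\mathtt{G}(\mathtt{C}_n)$ is the set of guards, i.e. Boolean combinations of atomic guards; $\mathbf v\in\mathbb{N}^n$ satisfies a guard $g$ ($\mathbf v\models g$) if $g$ holds when $x_i$ is replaced by $\mathbf v[i]$. Integers are encoded in binary. A counter system of dimension $n$ is $S=\langle Q,\mathtt{C}_n,\Delta,\mathbf{l}\rangle$ with $Q$ a finite set of control states, $\mathbf{l}:Q\to 2^{\mathrm{AT}}$ a labeling, and $\Delta\subseteq Q\times\mathtt{G}(\mathtt{C}_n)\times\mathbb{Z}^n\times Q$ a finite set of transitions. Configurations are elements of $Q\times\mathbb{N}^n$; there is a step $\langle q,\mathbf v\rangle\to\langle q',\mathbf v'\rangle$ iff there is $\langle q,g,\mathbf u,q'\rangle\in\Delta$ with $\mathbf v\models g$ and $\mathbf v'=\mathbf v+\mathbf u\in\mathbb{N}^n$.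 A run from a configuration $c_0$ is an infinite path $c_0\to c_1\to\cdots$. $S$ is flat if every node of its underlying graph belongs to at most one simple cycle (a cycle with no repeated edge); $\mathcal{CFS}$ is the class of flat counter systems. Constrained alphabets. A constrained alphabet is a triple $\langle at,ag_n,\Sigma\rangle$ with $at\subseteq\mathrm{AT}$ finite, $ag_n$ a finite set of atomic guards over $\mathtt{C}_n$, and $\Sigma\subseteq 2^{at\cup ag_n}$. A run $\rho=\langle q_0,\mathbf v_0\rangle\to\langle q_1,\mathbf v_1\rangle\to\cdots$ satisfies $w=a_0a_1\cdots\in\Sigma^\omega$, written $\rho\models w$, if for all $i\ge 0$: for every $p\in at$, $p\in a_i$ iff $p\in\mathbf l(q_i)$; and for every $g\in ag_n$, $g\in a_i$ iff $\mathbf v_i\models g$. A specification $A$ over $\langle at,ag_n,\Sigma\rangle$ defines a language $\mathrm{L}(A)\subseteq\Sigma^\omega$; $\rho\models A$ means $\rho\models w$ for some $w\in\mathrm{L}(A)$. Model-checking problem $\mathrm{MC}(\mathcal L,\mathcal{CFS})$. Input: a flat counter system $S$, a configuration $c$ and a specification $A\in\mathcal L$. Question: is there a run $\rho$ of $S$ starting at $c$ with $\rho\models A$? Specification languages. $\mathbb{B}(X)$ (resp. $\mathbb{B}^+(X)$) denotes the Boolean (resp. positive Boolean) combinations over $X$. ABA: a specification is $A=\langle Q,E,q_0,F\rangle$ with $Q$ finite, $q_0\in Q$, $F\subseteq Q$, $E$ a finite subset of $Q\times\mathbb{B}(at\cup ag_n)\times\mathbb{B}^+(Q)$. It represents the alternating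 Büchi automaton with transition function $\delta(q,a)=\bigvee_{\langle q,\psi,\psi'\rangle\in E,\ a\models\psi}\psi'$ for $a\subseteq at\cup ag_n$ (a letter $a$ is read as the propositional valuation making exactly the atoms in $a$ true), initial state $q_0$ and accepting states $F$; $\mathrm{L}(A)$ is its language under the usual acceptance condition. $A$ is over $\langle at,ag_n,\Sigma\rangle$ if each $\psi$ occurring in $E$ is satisfied at most by letters of $\Sigma$. $\mu\mathrm{TL}$ (linear $\mu$-calculus): $\phi::=p\mid g\mid z\mid\neg\phi\mid\phi\wedge\phi\mid\mathsf X\phi\mid\mathsf X^{-1}\phi\mid\mu z.\phi$ with $p\in at$, $g\in ag_n$, $z$ occurring only positively in $\phi$ in $\mu z.\phi$ (least fixed point over sets of positions; $\mathsf X$ next, $\mathsf X^{-1}$ previous). A specification is a closed formula $\phi$, over $\langle at,ag_n,2^{at\cup ag_n}\rangle$; an atom $p$ or $g$ holds at position $i$ of an $\omega$-word $w$ over $2^{at\cup ag_n}$ iff it belongs to $w(i)$, and $\mathrm{L}(\phi)$ is the set of $\omega$-words satisfying $\phi$ at position $0$. The size of a formula is its number of (distinct) subformulae. Constrained path schemas. A constrained path schema $\mathtt{cps}$ over $\langle at,ag_n,\Sigma\rangle$ is a pair $\langle p_1(l_1)^*\cdots p_{k-1}(l_{k-1})^*p_k(l_k)^\omega,\ \phi(x_1,\dots,x_{k-1})\rangle$ with $p_i,l_i\in\Sigma^*$, $l_k$ nonempty, and $\phi\in\mathtt{G}(\mathtt{C}_{k-1})$. Its language is $\mathrm{L}(\mathtt{cps})=\{p_1(l_1)^{n_1}\cdots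 p_{k-1}(l_{k-1})^{n_{k-1}}p_k(l_k)^\omega:\ \phi(n_1,\dots,n_{k-1})\text{ holds}\}$, and its size is $2k+\mathrm{len}(p_1l_1\cdots p_kl_k)+\mathrm{size}(\phi)$. Intersection non-emptiness problem for $\mathcal L$. Input: a constrained path schema $\mathtt{cps}$ and $A\in\mathcal L$. Question: is $\mathrm{L}(\mathtt{cps})\cap\mathrm{L}(A)\ne\emptyset$? *)

theory Defs
  imports "HOL-Library.Omega_Words_Fun"
begin

section \<open>Deterministic multi-tape Turing machines, PSPACE and hardness\<close>

datatype move = MoveLeft | Stay | MoveRight

fun shift :: "move \<Rightarrow> int" where
  "shift MoveLeft = -1"
| "shift Stay = 0"
| "shift MoveRight = 1"

text \<open>
  States and tape symbols are initial segments of the natural numbers. The tapes are infinite in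
  both directions. Symbol 0 is the blank, 1 and 2 stand for the bits False and True, further symbols
  are work symbols. A transition maps the state and the list of scanned symbols (one per tape) to
  the next state and, for every tape, the symbol written and the head move.
\<close>

record tm =
  ntapes :: nat
  nstates :: nat
  nsyms :: nat
  start :: nat
  accept :: nat
  reject :: nat
  delta :: "nat \<Rightarrow> nat list \<Rightarrow> nat \<times> (nat \<times> move) list"

definition wf_tm :: "tm \<Rightarrow> bool" where
  "wf_tm M \<longleftrightarrow>
     1 \<le> ntapes M \<and> 3 \<le> nsyms M \<and>
     start M < nstates M \<and> accept M < nstates M \<and> reject M < nstates M \<and> accept M \<noteq> reject M \<and>
     (\<forall>q ss. q < nstates M \<and> length ss = ntapes M \<and> set ss \<subseteq> {..<nsyms M} \<longrightarrow>
        (case delta M q ss of (q', acts) \<Rightarrow>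
           q' < nstates M \<and> length acts = ntapes M \<and> fst ` set acts \<subseteq> {..<nsyms M}))"

type_synonym tape = "(int \<Rightarrow> nat) \<times> int"  \<comment> \<open>contents and head position\<close>
type_synonym tm_config = "nat \<times> tape list"

fun halted :: "tm \<Rightarrow> tm_config \<Rightarrow> bool" where
  "halted M (q, ts) \<longleftrightarrow> q = accept M \<or> q = reject M"

fun tape_act :: "tape \<Rightarrow> nat \<times> move \<Rightarrow> tape" where
  "tape_act (f, h) (s, m) = (f(h := s), h + shift m)"

fun tm_step :: "tm \<Rightarrow> tm_config \<Rightarrow> tm_config" where
  "tm_step M (q, ts) =
     (if halted M (q, ts) then (q, ts)
      else (case delta M q (map (\<lambda>(f, h). f h) ts) of
              (q', acts) \<Rightarrow> (q', map2 tape_act ts acts)))"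

definition bit_sym :: "bool \<Rightarrow> nat" where
  "bit_sym b = (if b then 2 else 1)"

definition word_tape :: "bool list \<Rightarrow> int \<Rightarrow> nat" where
  "word_tape x i = (if 0 \<le> i \<and> i < int (length x) then bit_sym (x ! nat i) else 0)"

definition tm_init :: "tm \<Rightarrow> bool list \<Rightarrow> tm_config" where
  "tm_init M x = (start M, (word_tape x, 0) # replicate (ntapes M - 1) (\<lambda>_. 0, 0))"

definition tm_conf :: "tm \<Rightarrow> bool list \<Rightarrow> nat \<Rightarrow> tm_config" where
  "tm_conf M x t = (tm_step M ^^ t) (tm_init M x)"

definition poly_bounded :: "(nat \<Rightarrow> nat) \<Rightarrow> bool" where
  "poly_bounded p \<longleftrightarrow> (\<exists>c d. \<forall>n. p n \<le> c * n ^ d + c)"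

text \<open>
  The space bound is on the head positions: since heads start in cell 0 and move by at most one
  cell, it limits every tape to at most 2s + 1 visited cells.
\<close>

definition tm_decides_in_space :: "tm \<Rightarrow> bool list set \<Rightarrow> (nat \<Rightarrow> nat) \<Rightarrow> bool" where
  "tm_decides_in_space M L s \<longleftrightarrow>
     (\<forall>x. (\<exists>t. fst (tm_conf M x t) = (if x \<in> L then accept M else reject M)) \<and>
          (\<forall>t. \<forall>tp \<in> set (snd (tm_conf M x t)). \<bar>snd tp\<bar> \<le> int (s (length x))))"

definition PSPACE :: "bool list set set" where
  "PSPACE = {L. \<exists>M s. wf_tm M \<and> poly_bounded s \<and> tm_decides_in_space M L s}"

text \<open>The output is read off the last tape, from cell 0 up to the first blank.\<close>

definition outputs :: "tm_config \<Rightarrow> bool list \<Rightarrow> bool" where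
  "outputs c y \<longleftrightarrow>
     (let f = fst (last (snd c)) in
        (\<forall>i < length y. f (int i) = bit_sym (y ! i)) \<and> f (int (length y)) = 0)"

definition tm_computes_in_time :: "tm \<Rightarrow> (bool list \<Rightarrow> bool list) \<Rightarrow> (nat \<Rightarrow> nat) \<Rightarrow> bool" where
  "tm_computes_in_time M f T \<longleftrightarrow>
     (\<forall>x. \<exists>t \<le> T (length x).
        fst (tm_conf M x t) = accept M \<and> outputs (tm_conf M x t) (f x))"

definition poly_time_computable :: "(bool list \<Rightarrow> bool list) \<Rightarrow> bool" where
  "poly_time_computable f \<longleftrightarrow> (\<exists>M T. wf_tm M \<and> poly_bounded T \<and> tm_computes_in_time M f T)"

definition poly_reducible :: "bool list set \<Rightarrow> bool list set \<Rightarrow> bool" where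
  "poly_reducible K L \<longleftrightarrow> (\<exists>f. poly_time_computable f \<and> (\<forall>x. x \<in> K \<longleftrightarrow> f x \<in> L))"

definition PSPACE_hard :: "bool list set \<Rightarrow> bool" where
  "PSPACE_hard L \<longleftrightarrow> (\<forall>K \<in> PSPACE. poly_reducible K L)"


section \<open>Boolean combinations and guards\<close>

text \<open>
  Boolean combinations are built without constants for true and false, so the instances below are
  also instances under the reading in which the constants are available.
\<close>

datatype 'a bexp = BAtom 'a | BNot "'a bexp" | BAnd "'a bexp" "'a bexp" | BOr "'a bexp" "'a bexp"

datatype 'a pbexp = PAtom 'a | PAnd "'a pbexp" "'a pbexp" | POr "'a pbexp" "'a pbexp"

primrec beval :: "('a \<Rightarrow> bool) \<Rightarrow> 'a bexp \<Rightarrow> bool" where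
  "beval I (BAtom x) = I x"
| "beval I (BNot b) = (\<not> beval I b)"
| "beval I (BAnd b c) = (beval I b \<and> beval I c)"
| "beval I (BOr b c) = (beval I b \<or> beval I c)"

primrec peval :: "('a \<Rightarrow> bool) \<Rightarrow> 'a pbexp \<Rightarrow> bool" where
  "peval I (PAtom x) = I x"
| "peval I (PAnd b c) = (peval I b \<and> peval I c)"
| "peval I (POr b c) = (peval I b \<or> peval I c)"

datatype cmp = Eq | Le | Ge | Lt | Gt

fun cmp_holds :: "cmp \<Rightarrow> int \<Rightarrow> int \<Rightarrow> bool" where
  "cmp_holds Eq a b \<longleftrightarrow> a = b"
| "cmp_holds Le a b \<longleftrightarrow> a \<le> b"
| "cmp_holds Ge a b \<longleftrightarrow> a \<ge> b"
| "cmp_holds Lt a b \<longleftrightarrow> a < b"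
| "cmp_holds Gt a b \<longleftrightarrow> a > b"

text \<open>
  Counter valuations are lists of naturals; an atomic guard over n counters has n coefficients.
\<close>

datatype aguard = AGuard (coeffs: "int list") (cmp_of: cmp) (bound: nat)

type_synonym guard = "aguard bexp"

definition sat_aguard :: "nat list \<Rightarrow> aguard \<Rightarrow> bool" where
  "sat_aguard v g \<longleftrightarrow>
     cmp_holds (cmp_of g) (\<Sum>i < length (coeffs g). coeffs g ! i * int (v ! i)) (int (bound g))"

definition sat_guard :: "nat list \<Rightarrow> guard \<Rightarrow> bool" where
  "sat_guard v = beval (sat_aguard v)"

definition aguards :: "nat \<Rightarrow> aguard set" where
  "aguards n = {g. length (coeffs g) = n}"

definition guards :: "nat \<Rightarrow> guard set" where
  "guards n = {g. set_bexp g \<subseteq> aguards n}"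


section \<open>Flat counter systems\<close>

text \<open>
  Finite sets that are part of an input are presented by lists; their order and repetitions are
  irrelevant. Propositional variables and control states are named by natural numbers. The
  field \<open>ctrl\<close> lists the control states together with their labels.
\<close>

type_synonym transition = "nat \<times> guard \<times> int list \<times> nat"

record counter_system =
  dim :: nat
  ctrl :: "(nat \<times> nat list) list"
  transitions :: "transition list"

definition states :: "counter_system \<Rightarrow> nat set" where
  "states S = fst ` set (ctrl S)"

definition label :: "counter_system \<Rightarrow> nat \<Rightarrow> nat set" where
  "label S q = \<Union> {set ps | ps. (q, ps) \<in> set (ctrl S)}"

definition src :: "transition \<Rightarrow> nat" where "src e = fst e"
definition tgt :: "transition \<Rightarrow> nat" where "tgt e = snd (snd (snd e))"

definition wf_cs :: "counter_system \<Rightarrow> bool" where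
  "wf_cs S \<longleftrightarrow> distinct (map fst (ctrl S)) \<and>
     (\<forall>(q, g, u, q') \<in> set (transitions S).
        q \<in> states S \<and> g \<in> guards (dim S) \<and> length u = dim S \<and> q' \<in> states S)"

text \<open>
  The underlying graph is a multigraph: its edges are the transitions, so that two transitions
  between the same control states are different edges. Cycles are identified up to rotation.
\<close>

definition simple_cycle :: "counter_system \<Rightarrow> transition list \<Rightarrow> bool" where
  "simple_cycle S es \<longleftrightarrow> es \<noteq> [] \<and> set es \<subseteq> set (transitions S) \<and> distinct es \<and>
     (\<forall>i < length es. tgt (es ! i) = src (es ! (Suc i mod length es)))"

definition flat :: "counter_system \<Rightarrow> bool" where
  "flat S \<longleftrightarrow> (\<forall>q \<in> states S. \<forall>es es'.
     simple_cycle S es \<and> q \<in> src ` set es \<and> simple_cycle S es' \<and> q \<in> src ` set es'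
     \<longrightarrow> (\<exists>n. es' = rotate n es))"

type_synonym config = "nat \<times> nat list"

definition configs :: "counter_system \<Rightarrow> config set" where
  "configs S = {(q, v). q \<in> states S \<and> length v = dim S}"

definition cs_step :: "counter_system \<Rightarrow> config \<Rightarrow> config \<Rightarrow> bool" where
  "cs_step S c c' \<longleftrightarrow> c \<in> configs S \<and> c' \<in> configs S \<and>
     (\<exists>(q, g, u, q') \<in> set (transitions S). q = fst c \<and> q' = fst c' \<and> sat_guard (snd c) g \<and>
        (\<forall>i < dim S. int (snd c' ! i) = int (snd c ! i) + u ! i))"

definition is_run :: "counter_system \<Rightarrow> config \<Rightarrow> config word \<Rightarrow> bool" where
  "is_run S c \<rho> \<longleftrightarrow> \<rho> 0 = c \<and> (\<forall>i. cs_step S (\<rho> i) (\<rho> (Suc i)))"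


section \<open>Constrained alphabets and constrained path schemas\<close>

datatype sym = Prop nat | Grd aguard

type_synonym letter = "sym set"

definition syms :: "nat list \<Rightarrow> aguard list \<Rightarrow> sym set" where
  "syms ats ags = Prop ` set ats \<union> Grd ` set ags"

definition letters :: "sym list list \<Rightarrow> letter set" where
  "letters \<Sigma> = set ` set \<Sigma>"

definition run_sat :: "counter_system \<Rightarrow> nat list \<Rightarrow> aguard list \<Rightarrow> config word \<Rightarrow> letter word \<Rightarrow> bool" where
  "run_sat S ats ags \<rho> w \<longleftrightarrow> (\<forall>i.
     (\<forall>p \<in> set ats. Prop p \<in> w i \<longleftrightarrow> p \<in> label S (fst (\<rho> i))) \<and>
     (\<forall>g \<in> set ags. Grd g \<in> w i \<longleftrightarrow> sat_aguard (snd (\<rho> i)) g))"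

text \<open>
  A path schema lists the pairs of \<open>p\<^sub>i\<close> and \<open>l\<^sub>i\<close> for \<open>i < k\<close>, followed by \<open>p\<^sub>k\<close>, \<open>l\<^sub>k\<close> and the
  guard on the \<open>k - 1\<close> loop counters.
\<close>

record cps =
  segs :: "(sym list list \<times> sym list list) list"
  final_path :: "sym list list"
  final_loop :: "sym list list"
  constr :: guard

definition wf_cps :: "letter set \<Rightarrow> cps \<Rightarrow> bool" where
  "wf_cps \<Sigma> C \<longleftrightarrow>
     (\<forall>(p, l) \<in> set (segs C). letters p \<subseteq> \<Sigma> \<and> letters l \<subseteq> \<Sigma>) \<and>
     letters (final_path C) \<subseteq> \<Sigma> \<and> letters (final_loop C) \<subseteq> \<Sigma> \<and> final_loop C \<noteq> [] \<and>
     constr C \<in> guards (length (segs C))"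

definition unfold_segs :: "(sym list list \<times> sym list list) list \<Rightarrow> nat list \<Rightarrow> letter list" where
  "unfold_segs ss ns =
     concat (map2 (\<lambda>(p, l) n. map set p @ concat (replicate n (map set l))) ss ns)"

definition cps_lang :: "cps \<Rightarrow> letter word set" where
  "cps_lang C = {(unfold_segs (segs C) ns @ map set (final_path C)) \<frown> (map set (final_loop C))\<^sup>\<omega> | ns.
     length ns = length (segs C) \<and> sat_guard ns (constr C)}"


section \<open>Alternating Buechi automata\<close>

record aba =
  aba_states :: "nat list"
  aba_edges :: "(nat \<times> sym bexp \<times> nat pbexp) list"
  aba_init :: nat
  aba_final :: "nat list"

definition wf_aba :: "letter set \<Rightarrow> sym set \<Rightarrow> aba \<Rightarrow> bool" where
  "wf_aba \<Sigma> X A \<longleftrightarrow>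
     aba_init A \<in> set (aba_states A) \<and> set (aba_final A) \<subseteq> set (aba_states A) \<and>
     (\<forall>(q, \<psi>, \<psi>') \<in> set (aba_edges A).
        q \<in> set (aba_states A) \<and> set_bexp \<psi> \<subseteq> X \<and> set_pbexp \<psi>' \<subseteq> set (aba_states A) \<and>
        (\<forall>a \<subseteq> X. beval (\<lambda>x. x \<in> a) \<psi> \<longrightarrow> a \<in> \<Sigma>))"

text \<open>
  \<open>aba_delta_sat A q a P\<close>: the set \<open>P\<close> of states satisfies the positive formula \<open>\<delta>(q,a)\<close>, which is
  the (possibly empty) disjunction of the \<open>\<psi>'\<close> over the enabled edges.
\<close>

definition aba_delta_sat :: "aba \<Rightarrow> nat \<Rightarrow> letter \<Rightarrow> nat set \<Rightarrow> bool" where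
  "aba_delta_sat A q a P \<longleftrightarrow>
     (\<exists>\<psi> \<psi>'. (q, \<psi>, \<psi>') \<in> set (aba_edges A) \<and> beval (\<lambda>x. x \<in> a) \<psi> \<and> peval (\<lambda>p. p \<in> P) \<psi>')"

text \<open>
  Run trees: \<open>T\<close> is a prefix-closed set of addresses and \<open>r\<close> labels its nodes with states. A node at
  depth \<open>d\<close> reads the letter at position \<open>d\<close>.
\<close>

definition aba_run :: "aba \<Rightarrow> letter word \<Rightarrow> nat list set \<Rightarrow> (nat list \<Rightarrow> nat) \<Rightarrow> bool" where
  "aba_run A w T r \<longleftrightarrow>
     [] \<in> T \<and> (\<forall>x c. x @ [c] \<in> T \<longrightarrow> x \<in> T) \<and> r ` T \<subseteq> set (aba_states A) \<and> r [] = aba_init A \<and>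
     (\<forall>x \<in> T. aba_delta_sat A (r x) (w (length x)) {r (x @ [c]) | c. x @ [c] \<in> T})"

definition aba_accepting :: "aba \<Rightarrow> nat list set \<Rightarrow> (nat list \<Rightarrow> nat) \<Rightarrow> bool" where
  "aba_accepting A T r \<longleftrightarrow>
     (\<forall>\<pi> :: nat word. (\<forall>n. prefix n \<pi> \<in> T) \<longrightarrow> (\<exists>\<^sub>\<infinity>n. r (prefix n \<pi>) \<in> set (aba_final A)))"

definition aba_lang :: "letter set \<Rightarrow> aba \<Rightarrow> letter word set" where
  "aba_lang \<Sigma> A = {w. range w \<subseteq> \<Sigma> \<and> (\<exists>T r. aba_run A w T r \<and> aba_accepting A T r)}"


section \<open>Linear mu-calculus with past\<close>

datatype mu =
  MSym sym | MVar nat | MNot mu | MAnd mu mu | MNext mu | MPrev mu | MLfp nat mu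

text \<open>\<open>MPrev\<close> is the strong previous operator: it is false at position 0.\<close>

primrec mu_sem :: "letter word \<Rightarrow> (nat \<Rightarrow> nat set) \<Rightarrow> mu \<Rightarrow> nat set" where
  "mu_sem w V (MSym s) = {i. s \<in> w i}"
| "mu_sem w V (MVar z) = V z"
| "mu_sem w V (MNot \<phi>) = - mu_sem w V \<phi>"
| "mu_sem w V (MAnd \<phi> \<psi>) = mu_sem w V \<phi> \<inter> mu_sem w V \<psi>"
| "mu_sem w V (MNext \<phi>) = {i. Suc i \<in> mu_sem w V \<phi>}"
| "mu_sem w V (MPrev \<phi>) = {Suc i | i. i \<in> mu_sem w V \<phi>}"
| "mu_sem w V (MLfp z \<phi>) = lfp (\<lambda>U. mu_sem w (V(z := U)) \<phi>)"

primrec mu_free :: "mu \<Rightarrow> nat set" where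
  "mu_free (MSym s) = {}"
| "mu_free (MVar z) = {z}"
| "mu_free (MNot \<phi>) = mu_free \<phi>"
| "mu_free (MAnd \<phi> \<psi>) = mu_free \<phi> \<union> mu_free \<psi>"
| "mu_free (MNext \<phi>) = mu_free \<phi>"
| "mu_free (MPrev \<phi>) = mu_free \<phi>"
| "mu_free (MLfp z \<phi>) = mu_free \<phi> - {z}"

text \<open>\<open>mu_occ b z \<phi>\<close>: \<open>z\<close> has a free occurrence in \<open>\<phi>\<close> that is positive (\<open>b\<close>) or negative (\<open>\<not> b\<close>).\<close>

fun mu_occ :: "bool \<Rightarrow> nat \<Rightarrow> mu \<Rightarrow> bool" where
  "mu_occ b z (MSym s) \<longleftrightarrow> False"
| "mu_occ b z (MVar y) \<longleftrightarrow> b \<and> y = z"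
| "mu_occ b z (MNot \<phi>) \<longleftrightarrow> mu_occ (\<not> b) z \<phi>"
| "mu_occ b z (MAnd \<phi> \<psi>) \<longleftrightarrow> mu_occ b z \<phi> \<or> mu_occ b z \<psi>"
| "mu_occ b z (MNext \<phi>) \<longleftrightarrow> mu_occ b z \<phi>"
| "mu_occ b z (MPrev \<phi>) \<longleftrightarrow> mu_occ b z \<phi>"
| "mu_occ b z (MLfp y \<phi>) \<longleftrightarrow> y \<noteq> z \<and> mu_occ b z \<phi>"

primrec mu_subs :: "mu \<Rightarrow> mu set" where
  "mu_subs (MSym s) = {MSym s}"
| "mu_subs (MVar z) = {MVar z}"
| "mu_subs (MNot \<phi>) = insert (MNot \<phi>) (mu_subs \<phi>)"
| "mu_subs (MAnd \<phi> \<psi>) = insert (MAnd \<phi> \<psi>) (mu_subs \<phi> \<union> mu_subs \<psi>)"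
| "mu_subs (MNext \<phi>) = insert (MNext \<phi>) (mu_subs \<phi>)"
| "mu_subs (MPrev \<phi>) = insert (MPrev \<phi>) (mu_subs \<phi>)"
| "mu_subs (MLfp z \<phi>) = insert (MLfp z \<phi>) (mu_subs \<phi>)"

definition wf_mu :: "sym set \<Rightarrow> mu \<Rightarrow> bool" where
  "wf_mu X \<phi> \<longleftrightarrow> mu_free \<phi> = {} \<and>
     (\<forall>s. MSym s \<in> mu_subs \<phi> \<longrightarrow> s \<in> X) \<and>
     (\<forall>z \<psi>. MLfp z \<psi> \<in> mu_subs \<phi> \<longrightarrow> \<not> mu_occ False z \<psi>)"

definition mu_lang :: "sym set \<Rightarrow> mu \<Rightarrow> letter word set" where
  "mu_lang X \<phi> = {w. range w \<subseteq> Pow X \<and> 0 \<in> mu_sem w (\<lambda>_. {}) \<phi>}"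

text \<open>
  The size of a formula is its number of distinct subformulae, hence formulae are input as shared
  (DAG) terms: a list of named nodes whose operands refer to the names of earlier nodes; the last
  node is the root. Redundant nodes are permitted, but by \<open>dag_formula_ex\<close> every formula has a
  representation with exactly as many nodes as it has subformulae, and by \<open>card_mu_subs_le\<close> none has
  fewer.
\<close>

datatype mu_node =
  NSym sym | NVar nat | NNot nat | NAnd nat nat | NNext nat | NPrev nat | NLfp nat nat

fun node_formula :: "(nat \<rightharpoonup> mu) \<Rightarrow> mu_node \<Rightarrow> mu option" where
  "node_formula m (NSym s) = Some (MSym s)"
| "node_formula m (NVar z) = Some (MVar z)"
| "node_formula m (NNot i) = map_option MNot (m i)"
| "node_formula m (NAnd i j) =
     (case (m i, m j) of (Some \<phi>, Some \<psi>) \<Rightarrow> Some (MAnd \<phi> \<psi>) | _ \<Rightarrow> None)"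
| "node_formula m (NNext i) = map_option MNext (m i)"
| "node_formula m (NPrev i) = map_option MPrev (m i)"
| "node_formula m (NLfp z i) = map_option (MLfp z) (m i)"

fun dag_resolve :: "(nat \<rightharpoonup> mu) \<Rightarrow> (nat \<times> mu_node) list \<Rightarrow> mu option" where
  "dag_resolve m [] = None"
| "dag_resolve m [(k, n)] = node_formula m n"
| "dag_resolve m ((k, n) # ns) =
     (case node_formula m n of None \<Rightarrow> None | Some \<phi> \<Rightarrow> dag_resolve (m(k \<mapsto> \<phi>)) ns)"

definition dag_formula :: "(nat \<times> mu_node) list \<Rightarrow> mu option" where
  "dag_formula = dag_resolve Map.empty"

lemma finite_mu_subs [simp]: "finite (mu_subs \<phi>)"
  by (induction \<phi>) auto

lemma mu_subs_refl [simp]: "\<phi> \<in> mu_subs \<phi>"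
  by (cases \<phi>) auto

lemma node_formula_subs:
  assumes "node_formula m n = Some \<phi>" "\<And>k \<psi>. m k = Some \<psi> \<Longrightarrow> mu_subs \<psi> \<subseteq> R"
  shows "mu_subs \<phi> \<subseteq> insert \<phi> R"
proof (cases n)
  case (NAnd i j)
  with assms(1) obtain \<alpha> \<beta> where "m i = Some \<alpha>" "m j = Some \<beta>" "\<phi> = MAnd \<alpha> \<beta>"
    by (auto split: option.splits)
  then show ?thesis using assms(2)[of i \<alpha>] assms(2)[of j \<beta>] by auto
qed (use assms in \<open>auto simp: subset_iff\<close>)

lemma dag_resolve_card:
  assumes "dag_resolve m ns = Some \<phi>" "finite R" "\<And>k \<psi>. m k = Some \<psi> \<Longrightarrow> mu_subs \<psi> \<subseteq> R"
  shows "card (mu_subs \<phi>) \<le> card R + length ns"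
  using assms
proof (induction m ns arbitrary: R rule: dag_resolve.induct)
  case (2 m k n)
  then have "mu_subs \<phi> \<subseteq> insert \<phi> R" using node_formula_subs[of m n \<phi> R] by auto
  then have "card (mu_subs \<phi>) \<le> card (insert \<phi> R)" using 2 by (intro card_mono) auto
  also have "\<dots> \<le> card R + 1" using card_insert_le_m1[of "card R + 1" R \<phi>] by simp
  finally show ?case by simp
next
  case (3 m k n x xs)
  from 3(2) obtain \<psi> where \<psi>: "node_formula m n = Some \<psi>"
    and r: "dag_resolve (m(k \<mapsto> \<psi>)) (x # xs) = Some \<phi>"
    by (auto split: option.splits)
  have sub: "mu_subs \<psi> \<subseteq> insert \<psi> R" using node_formula_subs[OF \<psi>] 3(4) by blast
  have "card (mu_subs \<phi>) \<le> card (insert \<psi> R) + length (x # xs)"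
  proof (rule 3(1)[OF \<psi> r])
    show "finite (insert \<psi> R)" using 3(3) by simp
    fix k' \<chi> assume "(m(k \<mapsto> \<psi>)) k' = Some \<chi>"
    then show "mu_subs \<chi> \<subseteq> insert \<psi> R" using sub 3(4)[of k' \<chi>] by (auto split: if_splits)
  qed
  also have "card (insert \<psi> R) \<le> card R + 1" using card_insert_le_m1[of "card R + 1" R \<psi>] by simp
  finally show ?case by simp
qed simp

lemma card_mu_subs_le:
  assumes "dag_formula ns = Some \<phi>"
  shows "card (mu_subs \<phi>) \<le> length ns"
  using dag_resolve_card[of Map.empty ns \<phi> "{}"] assms by (simp add: dag_formula_def)

primrec mu_args :: "mu \<Rightarrow> mu set" where
  "mu_args (MSym s) = {}"
| "mu_args (MVar z) = {}"
| "mu_args (MNot \<phi>) = {\<phi>}"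
| "mu_args (MAnd \<phi> \<psi>) = {\<phi>, \<psi>}"
| "mu_args (MNext \<phi>) = {\<phi>}"
| "mu_args (MPrev \<phi>) = {\<phi>}"
| "mu_args (MLfp z \<phi>) = {\<phi>}"

primrec mu_to_node :: "(mu \<Rightarrow> nat) \<Rightarrow> mu \<Rightarrow> mu_node" where
  "mu_to_node f (MSym s) = NSym s"
| "mu_to_node f (MVar z) = NVar z"
| "mu_to_node f (MNot \<phi>) = NNot (f \<phi>)"
| "mu_to_node f (MAnd \<phi> \<psi>) = NAnd (f \<phi>) (f \<psi>)"
| "mu_to_node f (MNext \<phi>) = NNext (f \<phi>)"
| "mu_to_node f (MPrev \<phi>) = NPrev (f \<phi>)"
| "mu_to_node f (MLfp z \<phi>) = NLfp z (f \<phi>)"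

lemma dag_resolve_to_node:
  assumes "xs \<noteq> []" "\<And>ys \<psi> zs. xs = ys @ \<psi> # zs \<Longrightarrow> mu_args \<psi> \<subseteq> D \<union> set ys"
    "inj_on f (D \<union> set xs)" "\<And>\<psi>. \<psi> \<in> D \<Longrightarrow> m (f \<psi>) = Some \<psi>"
  shows "dag_resolve m (map (\<lambda>\<psi>. (f \<psi>, mu_to_node f \<psi>)) xs) = Some (last xs)"
  using assms
proof (induction xs arbitrary: D m)
  case (Cons \<psi> xs)
  have "mu_args \<psi> \<subseteq> D" using Cons(3)[of "[]"] by auto
  then have n: "node_formula m (mu_to_node f \<psi>) = Some \<psi>"
    using Cons(5) by (cases \<psi>) auto
  show ?case
  proof (cases "xs = []")
    case False
    then obtain y ys where xs: "xs = y # ys" by (cases xs) auto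
    have "dag_resolve (m(f \<psi> \<mapsto> \<psi>)) (map (\<lambda>\<psi>. (f \<psi>, mu_to_node f \<psi>)) xs) = Some (last xs)"
    proof (rule Cons(1)[of "insert \<psi> D"])
      fix ys \<chi> zs assume "xs = ys @ \<chi> # zs"
      then show "mu_args \<chi> \<subseteq> insert \<psi> D \<union> set ys" using Cons(3)[of "\<psi> # ys" \<chi> zs] by auto
    next
      fix \<chi> assume "\<chi> \<in> insert \<psi> D"
      then show "(m(f \<psi> \<mapsto> \<psi>)) (f \<chi>) = Some \<chi>"
        using Cons(4,5) by (auto simp: inj_on_def)
    qed (use Cons(4) False in auto)
    then show ?thesis using n xs by simp
  qed (use n in simp)
qed simp

lemma mu_subs_size: "\<psi> \<in> mu_subs \<phi> \<Longrightarrow> \<psi> = \<phi> \<or> size \<psi> < size \<phi>"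
  by (induction \<phi>) auto

lemma mu_args_size: "\<chi> \<in> mu_args \<psi> \<Longrightarrow> size \<chi> < size \<psi>"
  by (cases \<psi>) auto

lemma mu_args_subs: "\<psi> \<in> mu_subs \<phi> \<Longrightarrow> mu_args \<psi> \<subseteq> mu_subs \<phi>"
  by (induction \<phi>) auto

lemma dag_formula_ex:
  "\<exists>ns. dag_formula ns = Some \<phi> \<and> length ns = card (mu_subs \<phi>)"
proof -
  obtain fs0 where fs0: "set fs0 = mu_subs \<phi> - {\<phi>}" "distinct fs0"
    using finite_distinct_list[of "mu_subs \<phi> - {\<phi>}"] by auto
  define fs where "fs = sort_key size fs0"
  have fs: "set fs = mu_subs \<phi> - {\<phi>}" "distinct fs" "sorted (map size fs)"
    using fs0 by (auto simp: fs_def)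
  obtain f :: "mu \<Rightarrow> nat" where f: "inj_on f (mu_subs \<phi>)"
    using finite_imp_inj_to_nat_seg[OF finite_mu_subs[of \<phi>]] by blast
  have ins: "insert \<phi> (mu_subs \<phi>) = mu_subs \<phi>" by auto
  have "dag_resolve Map.empty (map (\<lambda>\<psi>. (f \<psi>, mu_to_node f \<psi>)) (fs @ [\<phi>])) = Some (last (fs @ [\<phi>]))"
  proof (rule dag_resolve_to_node[where D = "{}"])
    fix ys \<psi> zs assume eq: "fs @ [\<phi>] = ys @ \<psi> # zs"
    show "mu_args \<psi> \<subseteq> {} \<union> set ys"
    proof
      fix \<chi> assume \<chi>: "\<chi> \<in> mu_args \<psi>"
      have "\<psi> \<in> set (fs @ [\<phi>])" unfolding eq by simp
      then have "\<psi> \<in> set fs \<or> \<psi> = \<phi>" by auto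
      then have \<psi>: "\<psi> \<in> mu_subs \<phi>" using fs(1) mu_subs_refl by blast
      have "\<chi> \<noteq> \<phi>" "\<chi> \<in> mu_subs \<phi>"
        using mu_args_size[OF \<chi>] mu_subs_size[OF \<psi>] mu_args_subs[OF \<psi>] \<chi> by auto
      then have in_fs: "\<chi> \<in> set fs" using fs(1) by blast
      show "\<chi> \<in> {} \<union> set ys"
      proof (cases "zs = []")
        case True
        then show ?thesis using eq in_fs by simp
      next
        case False
        then have "fs = ys @ \<psi> # butlast zs"
          using eq by (metis append_butlast_last_id butlast.simps(2) butlast_append butlast_snoc list.distinct(1))
        then have "\<chi> \<notin> set (\<psi> # butlast zs)" "set fs = set ys \<union> set (\<psi> # butlast zs)"
          using fs(3) mu_args_size[OF \<chi>] by (auto simp: sorted_append)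
        then show ?thesis using in_fs by auto
      qed
    qed
  qed (use fs f ins in auto)
  moreover have "length (fs @ [\<phi>]) = card (mu_subs \<phi>)"
    using distinct_card[OF fs(2)] fs(1) card_Suc_Diff1[OF finite_mu_subs mu_subs_refl, of \<phi>] by simp
  ultimately show ?thesis
    by (intro exI[of _ "map (\<lambda>\<psi>. (f \<psi>, mu_to_node f \<psi>)) (fs @ [\<phi>])"]) (simp add: dag_formula_def)
qed


section \<open>Encoding of inputs as bit strings\<close>

text \<open>
  Inputs are turned into finitely branching trees with integer leaves, and these into bit strings,
  with integers in binary (sign and magnitude, least significant bit first). Both steps are
  injective (\<open>inj_serialize\<close> and the lemmas on the encoders).
\<close>

datatype sexp = Num int | Node "sexp list"

datatype token = Open | Close | Zero | One | Minus | Stop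

fun token_bits :: "token \<Rightarrow> bool list" where
  "token_bits Open = [False, False, False]"
| "token_bits Close = [False, False, True]"
| "token_bits Zero = [False, True, False]"
| "token_bits One = [False, True, True]"
| "token_bits Minus = [True, False, False]"
| "token_bits Stop = [True, False, True]"

fun digits :: "nat \<Rightarrow> token list" where
  "digits n = (if n = 0 then [] else (if odd n then One else Zero) # digits (n div 2))"

declare digits.simps [simp del]

fun tokens :: "sexp \<Rightarrow> token list" where
  "tokens (Num i) = (if i < 0 then [Minus] else []) @ digits (nat \<bar>i\<bar>) @ [Stop]"
| "tokens (Node ts) = Open # concat (map tokens ts) @ [Close]"

definition serialize :: "sexp \<Rightarrow> bool list" where
  "serialize t = concat (map token_bits (tokens t))"

definition enc_nat :: "nat \<Rightarrow> sexp" where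
  "enc_nat n = Num (int n)"

definition enc_list :: "('a \<Rightarrow> sexp) \<Rightarrow> 'a list \<Rightarrow> sexp" where
  "enc_list f xs = Node (map f xs)"

primrec enc_bexp :: "('a \<Rightarrow> sexp) \<Rightarrow> 'a bexp \<Rightarrow> sexp" where
  "enc_bexp f (BAtom x) = Node [Num 0, f x]"
| "enc_bexp f (BNot b) = Node [Num 1, enc_bexp f b]"
| "enc_bexp f (BAnd b c) = Node [Num 2, enc_bexp f b, enc_bexp f c]"
| "enc_bexp f (BOr b c) = Node [Num 3, enc_bexp f b, enc_bexp f c]"

primrec enc_pbexp :: "('a \<Rightarrow> sexp) \<Rightarrow> 'a pbexp \<Rightarrow> sexp" where
  "enc_pbexp f (PAtom x) = Node [Num 0, f x]"
| "enc_pbexp f (PAnd b c) = Node [Num 1, enc_pbexp f b, enc_pbexp f c]"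
| "enc_pbexp f (POr b c) = Node [Num 2, enc_pbexp f b, enc_pbexp f c]"

fun enc_cmp :: "cmp \<Rightarrow> sexp" where
  "enc_cmp Eq = Num 0"
| "enc_cmp Le = Num 1"
| "enc_cmp Ge = Num 2"
| "enc_cmp Lt = Num 3"
| "enc_cmp Gt = Num 4"

fun enc_aguard :: "aguard \<Rightarrow> sexp" where
  "enc_aguard (AGuard as r b) = Node [enc_list Num as, enc_cmp r, enc_nat b]"

abbreviation enc_guard :: "guard \<Rightarrow> sexp" where
  "enc_guard \<equiv> enc_bexp enc_aguard"

fun enc_sym :: "sym \<Rightarrow> sexp" where
  "enc_sym (Prop p) = Node [Num 0, enc_nat p]"
| "enc_sym (Grd g) = Node [Num 1, enc_aguard g]"

abbreviation enc_word :: "sym list list \<Rightarrow> sexp" where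
  "enc_word \<equiv> enc_list (enc_list enc_sym)"

fun enc_ctrl :: "nat \<times> nat list \<Rightarrow> sexp" where
  "enc_ctrl (q, ps) = Node [enc_nat q, enc_list enc_nat ps]"

fun enc_transition :: "transition \<Rightarrow> sexp" where
  "enc_transition (q, g, u, q') = Node [enc_nat q, enc_guard g, enc_list Num u, enc_nat q']"

definition enc_cs :: "counter_system \<Rightarrow> sexp" where
  "enc_cs S = Node [enc_nat (dim S), enc_list enc_ctrl (ctrl S), enc_list enc_transition (transitions S)]"

fun enc_config :: "config \<Rightarrow> sexp" where
  "enc_config (q, v) = Node [enc_nat q, enc_list enc_nat v]"

fun enc_seg :: "sym list list \<times> sym list list \<Rightarrow> sexp" where
  "enc_seg (p, l) = Node [enc_word p, enc_word l]"

definition enc_cps :: "cps \<Rightarrow> sexp" where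
  "enc_cps C = Node [enc_list enc_seg (segs C), enc_word (final_path C), enc_word (final_loop C),
     enc_guard (constr C)]"

fun enc_aba_edge :: "nat \<times> sym bexp \<times> nat pbexp \<Rightarrow> sexp" where
  "enc_aba_edge (q, \<psi>, \<psi>') = Node [enc_nat q, enc_bexp enc_sym \<psi>, enc_pbexp enc_nat \<psi>']"

definition enc_aba :: "aba \<Rightarrow> sexp" where
  "enc_aba A = Node [enc_list enc_nat (aba_states A), enc_list enc_aba_edge (aba_edges A),
     enc_nat (aba_init A), enc_list enc_nat (aba_final A)]"

fun enc_mu_node :: "nat \<times> mu_node \<Rightarrow> sexp" where
  "enc_mu_node (k, NSym s) = Node [enc_nat k, Num 0, enc_sym s]"
| "enc_mu_node (k, NVar z) = Node [enc_nat k, Num 1, enc_nat z]"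
| "enc_mu_node (k, NNot i) = Node [enc_nat k, Num 2, enc_nat i]"
| "enc_mu_node (k, NAnd i j) = Node [enc_nat k, Num 3, enc_nat i, enc_nat j]"
| "enc_mu_node (k, NNext i) = Node [enc_nat k, Num 4, enc_nat i]"
| "enc_mu_node (k, NPrev i) = Node [enc_nat k, Num 5, enc_nat i]"
| "enc_mu_node (k, NLfp z i) = Node [enc_nat k, Num 6, enc_nat z, enc_nat i]"

lemma digits_inj:
  "digits m @ Stop # xs = digits n @ Stop # ys \<Longrightarrow> m = n \<and> xs = ys"
proof (induction m arbitrary: n rule: less_induct)
  case (less m)
  show ?case
  proof (cases "m = 0 \<or> n = 0")
    case True
    then show ?thesis
      using less.prems digits.simps[of m] digits.simps[of n] by (auto split: if_splits)
  next
    case False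
    then have "odd m = odd n" "digits (m div 2) @ Stop # xs = digits (n div 2) @ Stop # ys"
      using less.prems digits.simps[of m] digits.simps[of n] by (auto split: if_splits)
    moreover from this have "m div 2 = n div 2 \<and> xs = ys"
      using less.IH[of "m div 2" "n div 2"] False by auto
    ultimately show ?thesis by (metis odd_two_times_div_two_succ even_two_times_div_two)
  qed
qed

lemma digits_neq_Minus [simp]:
  "digits n @ Stop # ys \<noteq> Minus # xs" "Minus # xs \<noteq> digits n @ Stop # ys"
  using digits.simps[of n] by auto

lemma hd_tokens: "\<exists>t ts. tokens s = t # ts \<and> t \<noteq> Close"
proof (cases s)
  case (Num i)
  then show ?thesis using digits.simps[of "nat \<bar>i\<bar>"] by auto
qed simp

lemma tokens_prefix_inj: "tokens s @ xs = tokens s' @ ys \<Longrightarrow> s = s' \<and> xs = ys"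
proof (induction s arbitrary: s' xs ys)
  case (Num i)
  have "\<exists>j. s' = Num j"
    using Num digits.simps[of "nat \<bar>i\<bar>"] by (cases s') (auto split: if_splits)
  then obtain j where "s' = Num j" ..
  moreover from this Num have eq: "(i < 0) = (j < 0)"
    "digits (nat \<bar>i\<bar>) @ Stop # xs = digits (nat \<bar>j\<bar>) @ Stop # ys"
    by (auto split: if_splits)
  moreover have "nat \<bar>i\<bar> = nat \<bar>j\<bar> \<and> xs = ys" by (rule digits_inj[OF eq(2)])
  ultimately show ?case by auto
next
  case (Node ss)
  have "\<exists>ts. s' = Node ts"
  proof (cases s')
    case (Num j)
    with Node.prems show ?thesis
      using digits.simps[of "nat \<bar>j\<bar>"] by (auto split: if_splits)
  qed simp
  then obtain ts where s': "s' = Node ts" ..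
  have "concat (map tokens ss) @ Close # xs = concat (map tokens ts) @ Close # ys"
    using Node.prems s' by simp
  with Node.IH have "ss = ts \<and> xs = ys"
  proof (induction ss arbitrary: ts)
    case Nil
    then show ?case using hd_tokens[of "hd ts"] by (cases ts) auto
  next
    case (Cons s ss)
    obtain t ts' where ts: "ts = t # ts'"
      using Cons.prems(2) hd_tokens[of s] by (cases ts) auto
    have "s = t \<and> concat (map tokens ss) @ Close # xs = concat (map tokens ts') @ Close # ys"
      using Cons.prems(1)[of s "concat (map tokens ss) @ Close # xs" t
        "concat (map tokens ts') @ Close # ys"] Cons.prems(2) ts by simp
    moreover from this have "ss = ts' \<and> xs = ys" using Cons.IH[of ts'] Cons.prems(1) by auto
    ultimately show ?case using ts by simp
  qed
  with s' show ?case by simp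
qed

lemma token_bits_inj: "concat (map token_bits us) = concat (map token_bits vs) \<Longrightarrow> us = vs"
proof (induction us arbitrary: vs)
  case Nil
  then show ?case
  proof (cases vs)
    case (Cons v vs')
    with Nil show ?thesis by (cases v) auto
  qed simp
next
  case (Cons u us)
  then obtain v vs' where vs: "vs = v # vs'" by (cases vs; cases u) auto
  have "u = v" "concat (map token_bits us) = concat (map token_bits vs')"
    using Cons.prems vs by (cases u; cases v; simp)+
  then show ?case using Cons.IH vs by simp
qed

lemma inj_serialize: "inj serialize"
  using tokens_prefix_inj[where xs = "[]" and ys = "[]"] token_bits_inj
  by (auto simp: inj_def serialize_def)

lemma enc_nat_inj [simp]: "enc_nat m = enc_nat n \<longleftrightarrow> m = n"
  by (simp add: enc_nat_def)

lemma enc_list_inj [simp]: "inj f \<Longrightarrow> enc_list f xs = enc_list f ys \<longleftrightarrow> xs = ys"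
  by (simp add: enc_list_def inj_map_eq_map)

lemma inj_enc_nat [simp]: "inj enc_nat" and inj_Num [simp]: "inj Num"
  by (auto simp: inj_def)

lemma inj_enc_list [simp]: "inj f \<Longrightarrow> inj (enc_list f)"
  by (simp add: inj_on_def[of "enc_list f"])

lemma inj_enc_bexp [simp]: "inj f \<Longrightarrow> inj (enc_bexp f)"
proof (rule injI)
  fix b c assume "inj f" "enc_bexp f b = enc_bexp f c"
  then show "b = c"
  proof (induction b arbitrary: c)
    case (BAtom x) then show ?case by (cases c) (auto dest: injD)
  next
    case (BNot b) then show ?case by (cases c) auto
  next
    case (BAnd b1 b2) then show ?case by (cases c) auto
  next
    case (BOr b1 b2) then show ?case by (cases c) auto
  qed
qed

lemma inj_enc_pbexp [simp]: "inj f \<Longrightarrow> inj (enc_pbexp f)"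
proof (rule injI)
  fix b c assume "inj f" "enc_pbexp f b = enc_pbexp f c"
  then show "b = c"
  proof (induction b arbitrary: c)
    case (PAtom x) then show ?case by (cases c) (auto dest: injD)
  next
    case (PAnd b1 b2) then show ?case by (cases c) auto
  next
    case (POr b1 b2) then show ?case by (cases c) auto
  qed
qed

lemma enc_cmp_inj [simp]: "enc_cmp r = enc_cmp r' \<longleftrightarrow> r = r'"
  by (cases r; cases r') auto

lemma inj_enc_aguard [simp]: "inj enc_aguard"
proof (rule injI)
  fix g h assume "enc_aguard g = enc_aguard h" then show "g = h" by (cases g; cases h) auto
qed

lemma inj_enc_sym [simp]: "inj enc_sym"
proof (rule injI)
  fix s t assume "enc_sym s = enc_sym t"
  then show "s = t" by (cases s; cases t) (simp_all add: inj_eq[OF inj_enc_aguard])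
qed

lemma inj_enc_ctrl [simp]: "inj enc_ctrl"
  by (rule injI) auto

lemma inj_enc_transition [simp]: "inj enc_transition"
  by (rule injI) (auto simp: inj_eq)

lemma inj_enc_cs: "inj enc_cs"
  by (rule injI) (simp add: enc_cs_def)

lemma inj_enc_config: "inj enc_config"
  by (rule injI) auto

lemma inj_enc_seg [simp]: "inj enc_seg"
  by (rule injI) auto

lemma inj_enc_cps: "inj enc_cps"
  by (rule injI) (simp add: enc_cps_def inj_eq)

lemma inj_enc_aba_edge [simp]: "inj enc_aba_edge"
  by (rule injI) (auto simp: inj_eq)

lemma inj_enc_aba: "inj enc_aba"
  by (rule injI) (simp add: enc_aba_def)

lemma inj_enc_mu_node: "inj enc_mu_node"
proof (rule injI)
  fix x y assume *: "enc_mu_node x = enc_mu_node y"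
  obtain k m l n where "x = (k, m)" "y = (l, n)" by (cases x, cases y)
  with * show "x = y" by (cases m; cases n) (simp_all add: inj_eq[OF inj_enc_sym])
qed


section \<open>The decision problems\<close>

text \<open>
  An ABA comes with its constrained alphabet, whose set of letters is listed explicitly. For the
  mu-calculus the letters are all sets of symbols, so only the symbols are part of the input.
\<close>

definition wf_calph :: "nat \<Rightarrow> aguard list \<Rightarrow> bool" where
  "wf_calph n ags \<longleftrightarrow> set ags \<subseteq> aguards n"

definition INTERSECT_ABA :: "bool list set" where
  "INTERSECT_ABA =
     {serialize (Node [enc_nat n, enc_list enc_nat ats, enc_list enc_aguard ags, enc_word \<Sigma>,
        enc_cps C, enc_aba A]) | n ats ags \<Sigma> C A.
      wf_calph n ags \<and> letters \<Sigma> \<subseteq> Pow (syms ats ags) \<and>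
      wf_cps (letters \<Sigma>) C \<and> wf_aba (letters \<Sigma>) (syms ats ags) A \<and>
      cps_lang C \<inter> aba_lang (letters \<Sigma>) A \<noteq> {}}"

definition INTERSECT_MUTL :: "bool list set" where
  "INTERSECT_MUTL =
     {serialize (Node [enc_nat n, enc_list enc_nat ats, enc_list enc_aguard ags,
        enc_cps C, enc_list enc_mu_node ns]) | n ats ags C ns.
      wf_calph n ags \<and> wf_cps (Pow (syms ats ags)) C \<and>
      (\<exists>\<phi>. dag_formula ns = Some \<phi> \<and> wf_mu (syms ats ags) \<phi> \<and>
           cps_lang C \<inter> mu_lang (syms ats ags) \<phi> \<noteq> {})}"

definition mc_holds ::
  "counter_system \<Rightarrow> config \<Rightarrow> nat list \<Rightarrow> aguard list \<Rightarrow> letter word set \<Rightarrow> bool" where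
  "mc_holds S c ats ags W \<longleftrightarrow> (\<exists>\<rho>. is_run S c \<rho> \<and> (\<exists>w \<in> W. run_sat S ats ags \<rho> w))"

definition MC_ABA_CFS :: "bool list set" where
  "MC_ABA_CFS =
     {serialize (Node [enc_cs S, enc_config c, enc_list enc_nat ats, enc_list enc_aguard ags,
        enc_word \<Sigma>, enc_aba A]) | S c ats ags \<Sigma> A.
      wf_cs S \<and> flat S \<and> c \<in> configs S \<and> wf_calph (dim S) ags \<and>
      letters \<Sigma> \<subseteq> Pow (syms ats ags) \<and> wf_aba (letters \<Sigma>) (syms ats ags) A \<and>
      mc_holds S c ats ags (aba_lang (letters \<Sigma>) A)}"

definition MC_MUTL_CFS :: "bool list set" where
  "MC_MUTL_CFS =
     {serialize (Node [enc_cs S, enc_config c, enc_list enc_nat ats, enc_list enc_aguard ags,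
        enc_list enc_mu_node ns]) | S c ats ags ns.
      wf_cs S \<and> flat S \<and> c \<in> configs S \<and> wf_calph (dim S) ags \<and>
      (\<exists>\<phi>. dag_formula ns = Some \<phi> \<and> wf_mu (syms ats ags) \<phi> \<and>
           mc_holds S c ats ags (mu_lang (syms ats ags) \<phi>))}"

end

theory Submission
  imports Defs
begin

text \<open>
  Let a deterministic machine decide \<open>L\<close> in polynomial space. Its configurations are described by
  polynomially many propositional variables, one for each control state and one for each tape, symbol
  and cell position relative to the head. That a variable holds after \<open>j + 1\<close> steps is equivalent to a
  disjunction of conjunctions of variables after \<open>j\<close> steps, without negation. So \<open>x \<in> L\<close> iff the
  variable of the accepting state is derivable at some stage of a monotone rule system, and it remains
  to express such derivations. An alternating automaton runs them backwards on \<open>{}\<^sup>t {p}\<^sup>\<omega>\<close>: the path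
  schema, or the flat system with two self-loops, guesses \<open>t\<close>. A mu-calculus formula with past needs
  just one word: a fixed point variable is a set of positions, and position \<open>j * N + v\<close> stands for
  variable \<open>v\<close> after \<open>j\<close> steps.

  The reductions are computed by actual Turing machines. These are obtained from structured programs
  whose continuation stacks serve as control states. State names of the form \<open>2\<^sup>n - 1\<close>, whose binary
  representation is unary, and formulae whose nodes are rebound under constantly many names make
  nested counting loops sufficient to print the instances.
\<close>

section \<open>Structured tape programs\<close>

text \<open>A run in polynomial space may be exponentially long, so its length is never written into
  the instance: it becomes a number of loop iterations, or a distance in the word. Only the number
  of variables is polynomial. Negation can be avoided because the machine is deterministic: that a
  cell does not hold a symbol is witnessed by the variable of the symbol that it does hold, and
  rules for all conceivable contexts can coexist since only the premises of the actual context are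
  true. Stages are exact step numbers; a halted machine idles, so that acceptance is visible at all
  later stages. For the printer, the input is first padded to a length \<open>R\<close> beyond twice
  the space bound. Then the index of every variable is \<open>a + b * R + c * i\<close>, with
  constants fixed by the machine and \<open>i\<close> the index of a single loop over the padded
  word, and it can be printed in unary. Apart from the padding, which builds one power in unary, no
  arithmetic is left to the machine that computes the reduction.\<close>

datatype cmd = Act nat "nat option" move | Seq cmd cmd | While nat cmd | Case nat "nat \<Rightarrow> cmd"

abbreviation stay :: "nat list \<Rightarrow> (nat \<times> move) list" where
  "stay \<equiv> map (\<lambda>s. (s, Stay))"

text \<open>The list is a stack of pending commands. Every control decision costs one step with all
  heads at rest, so a change of the stack is itself a transition of the machine.\<close>

fun cmd_next :: "cmd list \<Rightarrow> nat list \<Rightarrow> cmd list \<times> (nat \<times> move) list" where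
  "cmd_next [] ss = ([], stay ss)"
| "cmd_next (Act k so m # K) ss =
     (K, (stay ss)[k := (case so of None \<Rightarrow> ss ! k | Some s \<Rightarrow> s, m)])"
| "cmd_next (Seq a b # K) ss = (a # b # K, stay ss)"
| "cmd_next (While k c # K) ss = (if ss ! k = 0 then K else c # While k c # K, stay ss)"
| "cmd_next (Case k f # K) ss = (f (ss ! k) # K, stay ss)"

abbreviation scanned :: "tape list \<Rightarrow> nat list" where
  "scanned \<equiv> map (\<lambda>(f, h). f h)"

fun cmd_step :: "cmd list \<times> tape list \<Rightarrow> cmd list \<times> tape list" where
  "cmd_step (K, ts) = (case cmd_next K (scanned ts) of (K', acts) \<Rightarrow> (K', map2 tape_act ts acts))"

section \<open>Command stacks as control states of a Turing machine\<close>

primrec wf_cmd :: "nat \<Rightarrow> cmd \<Rightarrow> bool" where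
  "wf_cmd n (Act k so m) \<longleftrightarrow> k < n \<and> (\<forall>s \<in> set_option so. s < 4)"
| "wf_cmd n (Seq a b) \<longleftrightarrow> wf_cmd n a \<and> wf_cmd n b"
| "wf_cmd n (While k c) \<longleftrightarrow> k < n \<and> wf_cmd n c"
| "wf_cmd n (Case k f) \<longleftrightarrow> k < n \<and> (\<forall>s. wf_cmd n (f s))"

text \<open>Covers all stacks that can occur while \<open>c\<close> runs above \<open>K\<close>. The
  set is finite because a loop body returns to the same stack \<open>While k c # K\<close> instead
  of a deeper one, and because \<open>Case\<close> only branches over the four tape symbols.\<close>

primrec conts :: "cmd \<Rightarrow> cmd list \<Rightarrow> cmd list set" where
  "conts (Act k so m) K = {Act k so m # K}"
| "conts (Seq a b) K = insert (Seq a b # K) (conts a (b # K) \<union> conts b K)"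
| "conts (While k c) K = insert (While k c # K) (conts c (While k c # K))"
| "conts (Case k f) K = insert (Case k f # K) (\<Union>s \<in> {..<4}. conts (f s) K)"

lemma finite_conts: "finite (conts c K)"
  by (induction c arbitrary: K) auto

lemma conts_refl: "c # K \<in> conts c K"
  by (cases c) auto

lemma conts_closed:
  assumes "wf_cmd n c" "L \<in> conts c K" "length ss = n" "set ss \<subseteq> {..<4}"
  shows "fst (cmd_next L ss) \<in> insert K (conts c K)"
  using assms
proof (induction c arbitrary: K)
  case (Seq a b)
  then show ?case using conts_refl[of a "b # K"] conts_refl[of b K] by (fastforce split: prod.splits)
next
  case (While k c)
  from While.prems(2) consider "L = While k c # K" | "L \<in> conts c (While k c # K)" by auto
  then show ?case
  proof cases
    case 1
    then show ?thesis using conts_refl[of c "While k c # K"] by simp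
  next
    case 2
    then show ?thesis using While.IH[of "While k c # K"] While.prems by simp
  qed
next
  case (Case k f)
  have "ss ! k < 4" using Case.prems by (auto simp: subset_iff)
  then show ?case using Case.prems Case.IH conts_refl[of "f (ss ! k)" K] by fastforce
qed auto

lemma conts_wf:
  assumes "wf_cmd n c" "L \<in> conts c K" "length ss = n" "set ss \<subseteq> {..<4}"
  shows "length (snd (cmd_next L ss)) = n \<and> fst ` set (snd (cmd_next L ss)) \<subseteq> {..<4}"
  using assms
proof (induction c arbitrary: K)
  case (Act k so m)
  then have "ss ! k < 4" by (auto simp: subset_iff)
  moreover have "set ((stay ss)[k := x]) \<subseteq> insert x (set (stay ss))" for x
    by (rule set_update_subset_insert)
  ultimately show ?case using Act by (fastforce split: option.splits)
qed (auto split: if_splits)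

lemma tape_act_id: "tape_act tp (fst tp (snd tp), Stay) = tp"
  by (cases tp) simp

lemma tape_act_stay: "map2 tape_act ts (stay (scanned ts)) = ts"
  by (rule nth_equalityI) (auto simp: case_prod_beta tape_act_id)

lemma cmd_step_Nil: "cmd_step ([], ts) = ([], ts)"
  by (simp only: cmd_step.simps cmd_next.simps case_prod_conv tape_act_stay)

lemma tm_step_not_halted:
  "q \<noteq> accept M \<Longrightarrow> q \<noteq> reject M \<Longrightarrow>
   tm_step M (q, ts) = (case delta M q (scanned ts) of (q', acts) \<Rightarrow> (q', map2 tape_act ts acts))"
  by simp

lemma tape_act_syms:
  assumes "\<forall>tp \<in> set ts. \<forall>i. fst tp i < 4" "fst ` set acts \<subseteq> {..<4}"
  shows "\<forall>tp \<in> set (map2 tape_act ts acts). \<forall>i. fst tp i < 4"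
proof (safe)
  fix f h i assume "(f, h) \<in> set (map2 tape_act ts acts)"
  then obtain g h' s m where "((g, h'), (s, m)) \<in> set (zip ts acts)" "(f, h) = tape_act (g, h') (s, m)"
    by auto
  moreover from this have "(g, h') \<in> set ts" "(s, m) \<in> set acts"
    by (auto dest: set_zip_leftD set_zip_rightD)
  ultimately show "fst (f, h) i < 4" using assms by fastforce
qed

lemma cmd_to_tm:
  assumes wf: "wf_cmd n c" and n: "1 \<le> n"
  shows "\<exists>M. wf_tm M \<and> ntapes M = n \<and>
     (\<forall>x t ts. (cmd_step ^^ t) ([c], snd (tm_init M x)) = ([], ts) \<longrightarrow> tm_conf M x t = (accept M, ts))"
proof -
  define S where "S = insert [] (conts c [])"
  have fin: "finite S" by (simp add: S_def finite_conts)
  define N where "N = card S"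
  obtain e where e: "bij_betw e S {..<N}"
    using ex_bij_betw_finite_nat[OF fin] by (auto simp: N_def atLeast0LessThan)
  define dec where "dec = inv_into S e"
  have dec: "dec (e K) = K" if "K \<in> S" for K
    using that e by (simp add: dec_def bij_betw_def inv_into_f_f)
  have dec_in: "dec q \<in> S" if "q < N" for q
    using that e by (metis bij_betw_def dec_def inv_into_into lessThan_iff)
  have eN: "e K < N" if "K \<in> S" for K using that e by (auto simp: bij_betw_def)
  \<comment> \<open>The four symbols are the blank, the two bits and a padding symbol. State
    \<open>N\<close> only serves as a rejecting state different from the accepting one; stacks are
    numbered below \<open>N\<close>, so it is never entered.\<close>
  define M where "M = \<lparr>ntapes = n, nstates = Suc N, nsyms = 4, start = e [c], accept = e [], reject = N,
     delta = (\<lambda>q ss. if q < N then (case cmd_next (dec q) ss of (K, acts) \<Rightarrow> (e K, acts)) else (q, stay ss))\<rparr>"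
  have closed: "fst (cmd_next K ss) \<in> S \<and> length (snd (cmd_next K ss)) = n
      \<and> fst ` set (snd (cmd_next K ss)) \<subseteq> {..<4}"
    if "K \<in> S" "length ss = n" "set ss \<subseteq> {..<4}" for K ss
  proof (cases "K = []")
    case False
    then have "K \<in> conts c []" using that by (simp add: S_def)
    then show ?thesis
      using conts_closed[OF wf, of K "[]" ss] conts_wf[OF wf, of K "[]" ss] that
      unfolding S_def by blast
  qed (use that in \<open>auto simp: S_def\<close>)
  have [simp]: "[] \<in> S" "[c] \<in> S" by (auto simp: S_def conts_refl)
  have "wf_tm M"
  proof -
    have "case delta M q ss of (q', acts) \<Rightarrow>
        q' < nstates M \<and> length acts = ntapes M \<and> fst ` set acts \<subseteq> {..<nsyms M}"
      if "length ss = ntapes M" "set ss \<subseteq> {..<nsyms M}" "q < nstates M" for q ss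
    proof (cases "q < N")
      case True
      obtain K' acts where nx: "cmd_next (dec q) ss = (K', acts)" by fastforce
      show ?thesis using closed[OF dec_in[OF True], of ss] that nx True eN[of K']
        by (simp add: M_def)
    next
      case False
      then show ?thesis using that by (simp add: M_def image_image)
    qed
    then show ?thesis
      using n eN[OF \<open>[] \<in> S\<close>] eN[OF \<open>[c] \<in> S\<close>] unfolding wf_tm_def
      by (simp add: M_def less_SucI)
  qed
  \<comment> \<open>Step by step simulation. The bound on the tape symbols is part of the invariant
    because \<open>S\<close> is closed under \<open>cmd_next\<close> only for legal symbols.\<close>
  moreover have "tm_conf M x t = (e K, ts) \<and> K \<in> S \<and> length ts = n \<and> (\<forall>tp \<in> set ts. \<forall>i. fst tp i < 4)"
    if "(cmd_step ^^ t) ([c], snd (tm_init M x)) = (K, ts)" for x t K ts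
    using that
  proof (induction t arbitrary: K ts)
    case 0
    then show ?case using \<open>[c] \<in> S\<close> n
      by (auto simp: tm_conf_def tm_init_def M_def word_tape_def bit_sym_def)
  next
    case (Suc t)
    obtain K0 ts0 where 0: "(cmd_step ^^ t) ([c], snd (tm_init M x)) = (K0, ts0)" by fastforce
    note IH = Suc.IH[OF 0]
    have step: "cmd_step (K0, ts0) = (K, ts)" using Suc.prems 0 by simp
    have conf: "tm_conf M x (Suc t) = tm_step M (e K0, ts0)" using IH by (simp add: tm_conf_def)
    show ?case
    proof (cases "K0 = []")
      case True
      then have "K = []" "ts = ts0" using step cmd_step_Nil[of ts0] by auto
      moreover have "tm_step M (e [], ts0) = (e [], ts0)" by (simp add: M_def)
      ultimately show ?thesis using IH conf True by simp
    next
      case False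
      have ne: "e K0 \<noteq> accept M" "e K0 \<noteq> reject M"
        using False IH dec[of K0] dec[OF \<open>[] \<in> S\<close>] eN[of K0] by (auto simp: M_def)
      obtain K' acts where nx: "cmd_next K0 (scanned ts0) = (K', acts)" by fastforce
      have "set (scanned ts0) \<subseteq> {..<4}" using IH by fastforce
      then have cl: "K' \<in> S" "length acts = n" "fst ` set acts \<subseteq> {..<4}"
        using closed[of K0 "scanned ts0"] IH nx by auto
      have K: "K = K'" "ts = map2 tape_act ts0 acts" using step nx by auto
      have "delta M (e K0) (scanned ts0) = (e K', acts)"
        using IH nx eN[of K0] dec[of K0] by (simp add: M_def)
      then have "tm_step M (e K0, ts0) = (e K, ts)"
        unfolding tm_step_not_halted[OF ne] using K by simp
      then show ?thesis using conf cl K IH tape_act_syms[of ts0 acts] by simp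
    qed
  qed
  then have "\<forall>x t ts. (cmd_step ^^ t) ([c], snd (tm_init M x)) = ([], ts) \<longrightarrow> tm_conf M x t = (accept M, ts)"
    by (auto simp: M_def)
  moreover have "ntapes M = n" by (simp add: M_def)
  ultimately show ?thesis by blast
qed

text \<open>The number of steps is chosen before \<open>K\<close>, so the same execution works under
  every continuation; this is what lets executions be composed.\<close>

definition runs :: "cmd \<Rightarrow> tape list \<Rightarrow> nat \<Rightarrow> tape list \<Rightarrow> bool" where
  "runs c ts B ts' \<longleftrightarrow> (\<exists>t \<le> B. \<forall>K. (cmd_step ^^ t) (c # K, ts) = (K, ts'))"

lemma runs_mono: "runs c ts B ts' \<Longrightarrow> B \<le> B' \<Longrightarrow> runs c ts B' ts'"
  unfolding runs_def by (meson le_trans)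

lemma cmd_steps_add:
  "(cmd_step ^^ t) C = C' \<Longrightarrow> (cmd_step ^^ t') C' = C'' \<Longrightarrow> (cmd_step ^^ (t + t')) C = C''"
  by (simp add: add.commute[of t] funpow_add)

lemma cmd_step_stay:
  "cmd_next K (scanned ts) = (K', stay (scanned ts)) \<Longrightarrow> cmd_step (K, ts) = (K', ts)"
  by (simp only: cmd_step.simps case_prod_conv tape_act_stay)

lemma runs_Seq:
  assumes "runs a ts B ts'" "runs b ts' B' ts''"
  shows "runs (Seq a b) ts (Suc (B + B')) ts''"
proof -
  obtain t t' where t: "t \<le> B" "\<And>K. (cmd_step ^^ t) (a # K, ts) = (K, ts')"
    "t' \<le> B'" "\<And>K. (cmd_step ^^ t') (b # K, ts') = (K, ts'')"
    using assms unfolding runs_def by blast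
  have "(cmd_step ^^ (Suc (t + t'))) (Seq a b # K, ts) = (K, ts'')" for K
    using cmd_steps_add[of 1 "(Seq a b # K, ts)" "(a # b # K, ts)" "t + t'"]
      cmd_steps_add[OF t(2) t(4), of K] cmd_step_stay[of "Seq a b # K" ts] by simp
  then show ?thesis using t unfolding runs_def by (metis Suc_le_mono add_mono)
qed

lemma runs_Case:
  assumes "runs (f (fst (ts ! k) (snd (ts ! k)))) ts B ts'" "k < length ts"
  shows "runs (Case k f) ts (Suc B) ts'"
proof -
  obtain t where t: "t \<le> B" "\<And>K. (cmd_step ^^ t) (f (fst (ts ! k) (snd (ts ! k))) # K, ts) = (K, ts')"
    using assms unfolding runs_def by blast
  have "(cmd_step ^^ (Suc t)) (Case k f # K, ts) = (K, ts')" for K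
    using cmd_steps_add[of 1 "(Case k f # K, ts)" "(f (fst (ts ! k) (snd (ts ! k))) # K, ts)" t]
      t(2)[of K] cmd_step_stay[of "Case k f # K" ts] assms(2) by (simp add: case_prod_beta)
  then show ?thesis using t unfolding runs_def by (metis Suc_le_mono)
qed

lemma runs_While_end:
  assumes "fst (ts ! k) (snd (ts ! k)) = 0" "k < length ts"
  shows "runs (While k c) ts 1 ts"
  using assms cmd_step_stay[of "While k c # _" ts] unfolding runs_def
  by (intro exI[of _ 1]) (simp add: case_prod_beta)

lemma runs_While_step:
  assumes "fst (ts ! k) (snd (ts ! k)) \<noteq> 0" "k < length ts"
    and "runs c ts B ts'" "runs (While k c) ts' B' ts''"
  shows "runs (While k c) ts (Suc (B + B')) ts''"
proof -
  obtain t t' where t: "t \<le> B" "\<And>K. (cmd_step ^^ t) (c # K, ts) = (K, ts')"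
    "t' \<le> B'" "\<And>K. (cmd_step ^^ t') (While k c # K, ts') = (K, ts'')"
    using assms unfolding runs_def by blast
  have "(cmd_step ^^ (Suc (t + t'))) (While k c # K, ts) = (K, ts'')" for K
    using cmd_steps_add[of 1 "(While k c # K, ts)" "(c # While k c # K, ts)" "t + t'"]
      cmd_steps_add[OF t(2) t(4), of K] cmd_step_stay[of "While k c # K" ts] assms(1,2)
    by (simp add: case_prod_beta)
  then show ?thesis using t unfolding runs_def by (metis Suc_le_mono add_mono)
qed

lemma runs_Act:
  assumes "k < length ts"
  shows "runs (Act k so m) ts 1
    (ts[k := tape_act (ts ! k) (case so of None \<Rightarrow> fst (ts ! k) (snd (ts ! k)) | Some s \<Rightarrow> s, m)])"
proof -
  have "map2 tape_act ts ((stay (scanned ts))[k := p]) = ts[k := tape_act (ts ! k) p]" for p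
    using assms by (intro nth_equalityI) (auto simp: nth_list_update case_prod_beta tape_act_id)
  then show ?thesis
    unfolding runs_def using assms by (intro exI[of _ 1]) (simp add: case_prod_beta split: option.split)
qed

section \<open>Tapes that hold words, and elementary operations on them\<close>

definition word_cells :: "nat list \<Rightarrow> int \<Rightarrow> nat" where
  "word_cells w i = (if 0 \<le> i \<and> i < int (length w) then w ! nat i else 0)"

definition tapes :: "nat \<Rightarrow> (nat \<Rightarrow> nat list) \<Rightarrow> (nat \<Rightarrow> int) \<Rightarrow> tape list" where
  "tapes n ws hs = map (\<lambda>k. (word_cells (ws k), hs k)) [0..<n]"

lemma length_tapes [simp]: "length (tapes n ws hs) = n"
  by (simp add: tapes_def)

lemma nth_tapes [simp]: "k < n \<Longrightarrow> tapes n ws hs ! k = (word_cells (ws k), hs k)"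
  by (simp add: tapes_def)

lemma tapes_update:
  assumes "k < n"
  shows "(tapes n ws hs)[k := (word_cells w, h)] = tapes n (ws(k := w)) (hs(k := h))"
  using assms by (intro nth_equalityI) (auto simp: nth_list_update)

lemma word_cells_snoc: "(word_cells w)(int (length w) := s) = word_cells (w @ [s])"
  by (rule ext) (auto simp: word_cells_def nth_append)

lemma word_cells_erase: "(word_cells (w @ [s]))(int (length w) := 0) = word_cells w"
  by (rule ext) (auto simp: word_cells_def nth_append)

lemma runs_move:
  assumes "k < n"
  shows "runs (Act k None m) (tapes n ws hs) 1 (tapes n ws (hs(k := hs k + shift m)))"
  using runs_Act[of k "tapes n ws hs" None m] assms
    tapes_update[of k n ws hs "ws k" "hs k + shift m"] by simp

lemma runs_append:
  assumes "k < n" "hs k = int (length (ws k))"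
  shows "runs (Act k (Some s) MoveRight) (tapes n ws hs) 1
    (tapes n (ws(k := ws k @ [s])) (hs(k := int (length (ws k @ [s])))))"
  using runs_Act[of k "tapes n ws hs" "Some s" MoveRight] assms
    tapes_update[of k n ws hs "ws k @ [s]" "int (length (ws k @ [s]))"]
  by (simp add: word_cells_snoc algebra_simps)

lemma runs_erase:
  assumes "k < n" "ws k = w @ [s]" "hs k = int (length w)"
  shows "runs (Act k (Some 0) MoveLeft) (tapes n ws hs) 1
    (tapes n (ws(k := w)) (hs(k := int (length w) - 1)))"
  using runs_Act[of k "tapes n ws hs" "Some 0" MoveLeft] assms
    tapes_update[of k n ws hs "w" "int (length w) - 1"]
  by (simp add: word_cells_erase)

definition words_ok :: "nat \<Rightarrow> (nat \<Rightarrow> nat list) \<Rightarrow> bool" where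
  "words_ok n ws \<longleftrightarrow> (\<forall>k < n. set (ws k) \<subseteq> {1, 2, 3})"

lemma word_cells_nonzero:
  "words_ok n ws \<Longrightarrow> k < n \<Longrightarrow> 0 \<le> h \<Longrightarrow> h < int (length (ws k)) \<Longrightarrow> word_cells (ws k) h \<noteq> 0"
proof -
  assume a: "words_ok n ws" "k < n" "0 \<le> h" "h < int (length (ws k))"
  then have "ws k ! nat h \<in> set (ws k)" by (simp add: nat_less_iff)
  moreover have "0 \<notin> set (ws k)" using a by (fastforce simp: words_ok_def)
  ultimately show ?thesis using a by (metis word_cells_def)
qed

lemma words_ok_upd: "words_ok n ws \<Longrightarrow> set w \<subseteq> {1, 2, 3} \<Longrightarrow> words_ok n (ws(k := w))"
  by (simp add: words_ok_def)

lemma runs_to_end: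
  assumes "k < n" "words_ok n ws" "0 \<le> hs k" "hs k \<le> int (length (ws k))"
  shows "runs (While k (Act k None MoveRight)) (tapes n ws hs) (2 * length (ws k) + 1)
    (tapes n ws (hs(k := int (length (ws k)))))"
proof -
  have "runs (While k (Act k None MoveRight)) (tapes n ws hs) (2 * d + 1)
    (tapes n ws (hs(k := int (length (ws k)))))" if "hs k = int (length (ws k)) - int d" "d \<le> length (ws k)" for d hs
    using that
  proof (induction d arbitrary: hs)
    case 0
    then show ?case
      using runs_While_end[of "tapes n ws hs" k] assms by (simp add: word_cells_def fun_upd_idem)
  next
    case (Suc d)
    have IH: "runs (While k (Act k None MoveRight)) (tapes n ws (hs(k := hs k + 1))) (2 * d + 1)
       (tapes n ws (hs(k := int (length (ws k)))))"
      using Suc.IH[of "hs(k := hs k + 1)"] Suc.prems by (simp del: fun_upd_apply add: fun_upd_same)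
    have mv: "runs (Act k None MoveRight) (tapes n ws hs) 1 (tapes n ws (hs(k := hs k + 1)))"
      using runs_move[OF assms(1), of MoveRight ws hs] by simp
    have "runs (While k (Act k None MoveRight)) (tapes n ws hs) (Suc (1 + (2 * d + 1)))
       (tapes n ws (hs(k := int (length (ws k)))))"
      using assms(1) word_cells_nonzero[OF assms(2,1), of "hs k"] Suc.prems
      by (intro runs_While_step[OF _ _ mv IH]) auto
    then show ?case by (simp del: fun_upd_apply)
  qed
  note * = this[of hs "nat (int (length (ws k)) - hs k)"]
  show ?thesis by (rule runs_mono[OF *]) (use assms(3,4) in auto)
qed

text \<open>The first move to the left is needed since the head may stand on the blank behind the
  word, where the loop would stop at once. The loop ends in cell -1, hence the final move to the
  right.\<close>

definition rewind :: "nat \<Rightarrow> cmd" where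
  "rewind k = Seq (Act k None MoveLeft) (Seq (While k (Act k None MoveLeft)) (Act k None MoveRight))"

lemma runs_rewind:
  assumes "k < n" "words_ok n ws" "0 \<le> hs k" "hs k \<le> int (length (ws k))"
  shows "runs (rewind k) (tapes n ws hs) (2 * length (ws k) + 5) (tapes n ws (hs(k := 0)))"
proof -
  have loop: "runs (While k (Act k None MoveLeft)) (tapes n ws (hs(k := int d - 1))) (2 * d + 1)
    (tapes n ws (hs(k := -1)))" if "d \<le> length (ws k)" for d
    using that
  proof (induction d)
    case 0
    then show ?case
      using runs_While_end[of "tapes n ws (hs(k := -1))" k] assms(1)
      by (simp add: word_cells_def del: fun_upd_apply add: fun_upd_same)
  next
    case (Suc d)
    have mv: "runs (Act k None MoveLeft) (tapes n ws (hs(k := int (Suc d) - 1))) 1 (tapes n ws (hs(k := int d - 1)))"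
      using runs_move[OF assms(1), of MoveLeft ws "hs(k := int (Suc d) - 1)"] by simp
    have IH: "runs (While k (Act k None MoveLeft)) (tapes n ws (hs(k := int d - 1))) (2 * d + 1)
       (tapes n ws (hs(k := -1)))"
      using Suc by (simp del: fun_upd_apply)
    have "runs (While k (Act k None MoveLeft)) (tapes n ws (hs(k := int (Suc d) - 1)))
       (Suc (1 + (2 * d + 1))) (tapes n ws (hs(k := -1)))"
      using word_cells_nonzero[OF assms(2,1), of "int d"] assms(1) Suc.prems
      by (intro runs_While_step[OF _ _ mv IH]) auto
    then show ?case by (simp del: fun_upd_apply)
  qed
  let ?d = "nat (hs k)"
  have 1: "runs (Act k None MoveLeft) (tapes n ws hs) 1 (tapes n ws (hs(k := int ?d - 1)))"
    using runs_move[OF assms(1), of MoveLeft ws hs] assms(3) by simp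
  have 3: "runs (Act k None MoveRight) (tapes n ws (hs(k := -1))) 1 (tapes n ws (hs(k := 0)))"
    using runs_move[OF assms(1), of MoveRight ws "hs(k := -1)"] by simp
  have "runs (rewind k) (tapes n ws hs) (Suc (1 + Suc (2 * ?d + 1 + 1))) (tapes n ws (hs(k := 0)))"
    unfolding rewind_def using assms(3,4) by (intro runs_Seq[OF 1] runs_Seq[OF loop 3]) simp
  then show ?thesis using assms(3,4) by (auto intro: runs_mono)
qed

definition append_one :: "nat \<Rightarrow> cmd" where
  "append_one k = Seq (While k (Act k None MoveRight)) (Seq (Act k (Some 1) MoveRight) (rewind k))"

lemma runs_append_one:
  assumes "k < n" "words_ok n ws" "hs k = 0"
  shows "runs (append_one k) (tapes n ws hs) (4 * length (ws k) + 11) (tapes n (ws(k := ws k @ [1])) hs)"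
proof -
  let ?l = "int (length (ws k))"
  have 2: "runs (Act k (Some 1) MoveRight) (tapes n ws (hs(k := ?l))) 1
     (tapes n (ws(k := ws k @ [1])) (hs(k := ?l + 1)))"
    using runs_append[of k n "hs(k := ?l)" ws 1] assms(1) by (simp add: add.commute)
  have ok: "words_ok n (ws(k := ws k @ [1]))"
    using assms(1,2) by (auto simp: words_ok_def)
  have 3: "runs (rewind k) (tapes n (ws(k := ws k @ [1])) (hs(k := ?l + 1))) (2 * (length (ws k) + 1) + 5)
     (tapes n (ws(k := ws k @ [1])) hs)"
    using runs_rewind[OF assms(1) ok, of "hs(k := ?l + 1)"] assms(3) by (simp add: fun_upd_idem)
  have "runs (append_one k) (tapes n ws hs)
      (Suc (2 * length (ws k) + 1 + Suc (1 + (2 * (length (ws k) + 1) + 5)))) (tapes n (ws(k := ws k @ [1])) hs)"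
    unfolding append_one_def using assms by (intro runs_Seq[OF runs_to_end] runs_Seq[OF 2 3]) auto
  then show ?thesis by (rule runs_mono) simp
qed

text \<open>Erasing from right to left keeps the rest a word that starts in cell 0, so the blank in
  cell -1 can end the loop.\<close>

definition clear :: "nat \<Rightarrow> cmd" where
  "clear k = Seq (While k (Act k None MoveRight)) (Seq (Act k None MoveLeft)
     (Seq (While k (Act k (Some 0) MoveLeft)) (Act k None MoveRight)))"

lemma runs_clear:
  assumes "k < n" "words_ok n ws" "hs k = 0"
  shows "runs (clear k) (tapes n ws hs) (4 * length (ws k) + 7) (tapes n (ws(k := [])) hs)"
proof -
  have loop: "runs (While k (Act k (Some 0) MoveLeft)) (tapes n (ws(k := w)) (hs(k := int (length w) - 1)))
     (2 * length w + 1) (tapes n (ws(k := [])) (hs(k := -1)))" if "set w \<subseteq> {1, 2, 3}" for w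
    using that
  proof (induction w rule: rev_induct)
    case Nil
    then show ?case
      using runs_While_end[of "tapes n (ws(k := [])) (hs(k := -1))" k] assms(1)
      by (simp add: word_cells_def del: fun_upd_apply add: fun_upd_same)
  next
    case (snoc s w)
    have er: "runs (Act k (Some 0) MoveLeft) (tapes n (ws(k := w @ [s])) (hs(k := int (length (w @ [s])) - 1))) 1
       (tapes n (ws(k := w)) (hs(k := int (length w) - 1)))"
      using runs_erase[OF assms(1), of "ws(k := w @ [s])" w s "hs(k := int (length w))"] by simp
    have IH: "runs (While k (Act k (Some 0) MoveLeft)) (tapes n (ws(k := w)) (hs(k := int (length w) - 1)))
     (2 * length w + 1) (tapes n (ws(k := [])) (hs(k := -1)))" using snoc(1) snoc.prems by (simp del: fun_upd_apply)
    have "runs (While k (Act k (Some 0) MoveLeft))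
       (tapes n (ws(k := w @ [s])) (hs(k := int (length (w @ [s])) - 1)))
       (Suc (1 + (2 * length w + 1))) (tapes n (ws(k := [])) (hs(k := -1)))"
      using assms(1) snoc.prems
      by (intro runs_While_step[OF _ _ er IH]) (auto simp: word_cells_def nth_append)
    then show ?case by (simp del: fun_upd_apply)
  qed
  let ?w = "ws k" and ?l = "int (length (ws k))"
  have w: "set ?w \<subseteq> {1, 2, 3}" using assms by (simp add: words_ok_def)
  have 1: "runs (Act k None MoveLeft) (tapes n ws (hs(k := ?l))) 1 (tapes n (ws(k := ?w)) (hs(k := ?l - 1)))"
    using runs_move[OF assms(1), of MoveLeft ws "hs(k := ?l)"] by simp
  have 3: "runs (Act k None MoveRight) (tapes n (ws(k := [])) (hs(k := -1))) 1 (tapes n (ws(k := [])) hs)"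
    using runs_move[OF assms(1), of MoveRight "ws(k := [])" "hs(k := -1)"] assms(3) by (simp add: fun_upd_idem)
  have "runs (clear k) (tapes n ws hs)
      (Suc (2 * length ?w + 1 + Suc (1 + Suc (2 * length ?w + 1 + 1)))) (tapes n (ws(k := [])) hs)"
    unfolding clear_def using assms w
    by (intro runs_Seq[OF runs_to_end] runs_Seq[OF 1] runs_Seq[OF loop 3]) auto
  then show ?thesis by (rule runs_mono) simp
qed

section \<open>A language for printing with nested loops\<close>

datatype prog = Emit "nat list" | Then prog prog | For nat nat "nat \<Rightarrow> prog"

primrec out :: "prog \<Rightarrow> (nat \<Rightarrow> nat list) \<Rightarrow> nat list" where
  "out (Emit w) ws = w"
| "out (Then p q) ws = out p ws @ out q ws"
| "out (For i r f) ws =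
     concat (map (\<lambda>j. out (f (ws r ! j)) (ws(i := replicate j 1))) [0..<length (ws r)])"

primrec loop_vars :: "prog \<Rightarrow> nat set" where
  "loop_vars (Emit w) = {}"
| "loop_vars (Then p q) = loop_vars p \<union> loop_vars q"
| "loop_vars (For i r f) = insert i (\<Union>s. loop_vars (f s))"

primrec used_tapes :: "prog \<Rightarrow> nat set" where
  "used_tapes (Emit w) = {}"
| "used_tapes (Then p q) = used_tapes p \<union> used_tapes q"
| "used_tapes (For i r f) = insert i (insert r (\<Union>s. used_tapes (f s)))"

text \<open>The head on tape \<open>r\<close> records the progress of the loop, so the body must not
  touch that tape; the body may read the counter tape \<open>i\<close>, but must not use it as a
  loop variable, since an inner loop would clear it.\<close>

primrec wf_prog :: "prog \<Rightarrow> bool" where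
  "wf_prog (Emit w) \<longleftrightarrow> set w \<subseteq> {1, 2, 3}"
| "wf_prog (Then p q) \<longleftrightarrow> wf_prog p \<and> wf_prog q"
| "wf_prog (For i r f) \<longleftrightarrow> i \<noteq> r \<and> (\<forall>s. wf_prog (f s) \<and> r \<notin> used_tapes (f s) \<and> i \<notin> loop_vars (f s))"

primrec compile :: "nat \<Rightarrow> prog \<Rightarrow> cmd" where
  "compile t (Emit w) = foldr (\<lambda>s. Seq (Act t (Some s) MoveRight)) w (Act t None Stay)"
| "compile t (Then p q) = Seq (compile t p) (compile t q)"
| "compile t (For i r f) =
     Seq (While r (Seq (Case r (\<lambda>s. compile t (f s))) (Seq (append_one i) (Act r None MoveRight))))
       (Seq (rewind r) (clear i))"

text \<open>\<open>V\<close> bounds the length of every tape that is read, hence also every loop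
  counter. The sum over the four symbols dominates the body selected by any one of them, which keeps
  the bound independent of the contents.\<close>

primrec time_bound :: "prog \<Rightarrow> nat \<Rightarrow> nat" where
  "time_bound (Emit w) V = 2 * length w + 1"
| "time_bound (Then p q) V = Suc (time_bound p V + time_bound q V)"
| "time_bound (For i r f) V = V * ((\<Sum>s<4. time_bound (f s) V) + 4 * V + 16) + 6 * V + 16"

lemma wf_cmd_foldr: "wf_cmd n (foldr (\<lambda>s. Seq (Act t (Some s) MoveRight)) w c) \<longleftrightarrow>
    (w \<noteq> [] \<longrightarrow> t < n) \<and> (\<forall>s \<in> set w. s < 4) \<and> wf_cmd n c"
  by (induction w) auto

lemma wf_compile:
  "wf_prog p \<Longrightarrow> t < n \<Longrightarrow> used_tapes p \<subseteq> {..<n} \<Longrightarrow> wf_cmd n (compile t p)"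
proof (induction p)
  case (For i r f)
  then have "wf_cmd n (compile t (f s))" for s by (simp add: UN_subset_iff)
  then show ?case using For.prems by (simp add: append_one_def rewind_def clear_def)
qed (auto simp: wf_cmd_foldr)

lemma loop_vars_used: "loop_vars p \<subseteq> used_tapes p"
  by (induction p) auto

lemma out_cong: "(\<And>k. k \<in> used_tapes p \<Longrightarrow> ws k = ws' k) \<Longrightarrow> out p ws = out p ws'"
proof (induction p arbitrary: ws ws')
  case (For i r f)
  have r: "ws r = ws' r" using For.prems by simp
  have "out (f s) (ws(i := v)) = out (f s) (ws'(i := v))" for s v
  proof (rule For.IH[OF rangeI])
    fix k assume "k \<in> used_tapes (f s)"
    then have "k \<in> used_tapes (For i r f)" by auto
    then show "(ws(i := v)) k = (ws'(i := v)) k" using For.prems by (cases "k = i") simp_all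
  qed
  then show ?case by (simp only: out.simps r)
next
  case (Then p q)
  then show ?case by (metis UnCI out.simps(2) used_tapes.simps(2))
qed simp

lemma set_out: "wf_prog p \<Longrightarrow> set (out p ws) \<subseteq> {1, 2, 3}"
proof (induction p arbitrary: ws)
  case (For i r f)
  have "set (out (f s) ws') \<subseteq> {1, 2, 3}" for s ws'
    using For.prems by (intro For.IH) simp_all
  then show ?case by (simp add: UN_subset_iff)
qed simp_all

lemma runs_emit:
  assumes "t < n" "hs t = int (length (ws t))"
  shows "runs (compile t (Emit w)) (tapes n ws hs) (2 * length w + 1)
     (tapes n (ws(t := ws t @ w)) (hs(t := int (length (ws t @ w)))))"
  using assms(2)
proof (induction w arbitrary: ws hs)
  case Nil
  then show ?case using runs_move[OF assms(1), of Stay ws hs] by (simp add: fun_upd_idem)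
next
  case (Cons s w)
  let ?ws = "ws(t := ws t @ [s])" and ?hs = "hs(t := int (length (ws t @ [s])))"
  have 1: "runs (Act t (Some s) MoveRight) (tapes n ws hs) 1 (tapes n ?ws ?hs)"
    using runs_append[OF assms(1)] Cons.prems by simp
  have 2: "runs (compile t (Emit w)) (tapes n ?ws ?hs) (2 * length w + 1)
     (tapes n (?ws(t := ?ws t @ w)) (?hs(t := int (length (?ws t @ w)))))"
    by (rule Cons.IH) simp
  show ?case
    using runs_Seq[OF 1 2] by (simp del: fun_upd_apply add: fun_upd_same)
qed

text \<open>A program changes nothing but its output tape: loops rewind the tape that they scan and
  clear their counter, so the preconditions hold again for the next program.\<close>

lemma runs_compile:
  assumes "wf_prog p" "t < n" "used_tapes p \<subseteq> {..<n} - {t}" "words_ok n ws"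
    "\<forall>k \<in> used_tapes p. hs k = 0 \<and> length (ws k) \<le> V" "\<forall>k \<in> loop_vars p. ws k = []"
    "hs t = int (length (ws t))"
  shows "runs (compile t p) (tapes n ws hs) (time_bound p V)
     (tapes n (ws(t := ws t @ out p ws)) (hs(t := int (length (ws t @ out p ws)))))"
  using assms
proof (induction p arbitrary: ws hs)
  case (Emit w)
  then show ?case using runs_emit[of t n hs ws w] by (simp del: fun_upd_apply)
next
  case (Then p q)
  let ?ws = "ws(t := ws t @ out p ws)" and ?hs = "hs(t := int (length (ws t @ out p ws)))"
  have t: "t \<notin> used_tapes q" "t \<notin> loop_vars q" using Then.prems(3) loop_vars_used[of q] by auto
  have 1: "runs (compile t p) (tapes n ws hs) (time_bound p V) (tapes n ?ws ?hs)"
    using Then.prems by (intro Then.IH(1)) auto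
  have ok: "words_ok n ?ws"
    using Then.prems(1,2,4) set_out[of p ws] by (intro words_ok_upd) (auto simp: words_ok_def)
  have 2: "runs (compile t q) (tapes n ?ws ?hs) (time_bound q V)
     (tapes n (?ws(t := ?ws t @ out q ?ws)) (?hs(t := int (length (?ws t @ out q ?ws)))))"
    using Then.prems t by (intro Then.IH(2)[OF _ _ _ ok]) auto
  have "out q ?ws = out q ws" using t by (intro out_cong) auto
  then have "?ws(t := ?ws t @ out q ?ws) = ws(t := ws t @ out (Then p q) ws)"
    "?ws t @ out q ?ws = ws t @ out (Then p q) ws" by simp_all
  with runs_Seq[OF 1 2] show ?case by (simp only: fun_upd_upd fun_upd_same compile.simps time_bound.simps)
next
  case (For i r f)
  define L where "L = length (ws r)"
  define emitted where "emitted j = concat (map (\<lambda>j. out (f (ws r ! j)) (ws(i := replicate j 1))) [0..<j])" for j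
  \<comment> \<open>\<open>W j\<close> and \<open>H j\<close> are contents and heads after
    \<open>j\<close> iterations: counter \<open>j\<close> in unary, output extended by the first
    \<open>j\<close> bodies, head of tape \<open>r\<close> in cell \<open>j\<close>.\<close>
  define W where "W j = ws(i := replicate j 1, t := ws t @ emitted j)" for j
  define H where "H j = hs(r := int j, t := int (length (ws t @ emitted j)))" for j
  define b where "b = (\<Sum>s<4. time_bound (f s) V)"
  have sub: "insert i (insert r (\<Union>s. used_tapes (f s))) \<subseteq> {..<n} - {t}"
    using For.prems(3) by (simp only: used_tapes.simps)
  have "i \<noteq> r" using For.prems(1) by simp
  moreover have "i \<in> {..<n} - {t}" "r \<in> {..<n} - {t}" using sub by blast+
  ultimately have ne: "i \<noteq> r" "i \<noteq> t" "r \<noteq> t" "i < n" "r < n" by simp_all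
  have f: "wf_prog (f s)" "r \<notin> used_tapes (f s)" "i \<notin> loop_vars (f s)" "t \<notin> used_tapes (f s)"
    "t \<notin> loop_vars (f s)" "used_tapes (f s) \<subseteq> {..<n} - {t}" for s
  proof -
    show *: "used_tapes (f s) \<subseteq> {..<n} - {t}" using sub by blast
    then show "t \<notin> used_tapes (f s)" "t \<notin> loop_vars (f s)" using loop_vars_used[of "f s"] by blast+
  qed (use For.prems(1) in simp_all)
  have LV: "L \<le> V" using For.prems(5) by (simp add: L_def)
  have hs: "hs i = 0" "hs r = 0" and wsi: "ws i = []" using For.prems(5,6) by simp_all
  have wt: "set (ws t @ emitted j) \<subseteq> {1, 2, 3}" for j
  proof -
    have "set (ws t) \<subseteq> {1, 2, 3}" using For.prems(2,4) by (simp add: words_ok_def)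
    moreover have "set (emitted j) \<subseteq> {1, 2, 3}"
      using set_out[OF f(1)] unfolding emitted_def by fastforce
    ultimately show ?thesis by simp
  qed
  have ok: "words_ok n (W j)" for j
    unfolding W_def by (intro words_ok_upd For.prems(4) wt) (simp add: set_replicate_conv_if)
  let ?body = "Seq (Case r (\<lambda>s. compile t (f s))) (Seq (append_one i) (Act r None MoveRight))"
  have body: "runs ?body (tapes n (W j) (H j)) (b + 4 * V + 15) (tapes n (W (Suc j)) (H (Suc j)))"
    if "j < L" for j
  proof -
    let ?s = "ws r ! j"
    \<comment> \<open>The body does not use the output tape, so the text written so far does not
      influence what it prints.\<close>
    have e: "out (f ?s) (W j) = out (f ?s) (ws(i := replicate j 1))"
      using f by (intro out_cong) (auto simp: W_def)
    have emS: "emitted (Suc j) = emitted j @ out (f ?s) (W j)"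
      by (simp add: e emitted_def)
    let ?W = "(W j)(t := ws t @ emitted (Suc j))"
    let ?H = "(H j)(t := int (length (ws t @ emitted (Suc j))))"
    have "runs (compile t (f ?s)) (tapes n (W j) (H j)) (time_bound (f ?s) V)
      (tapes n ((W j)(t := W j t @ out (f ?s) (W j))) ((H j)(t := int (length (W j t @ out (f ?s) (W j))))))"
    proof (rule For.IH[OF rangeI f(1) For.prems(2) f(6) ok])
      show "\<forall>k\<in>used_tapes (f ?s). H j k = 0 \<and> length (W j k) \<le> V"
      proof
        fix k assume k: "k \<in> used_tapes (f ?s)"
        then have "k \<noteq> t" "k \<noteq> r" using f by auto
        then show "H j k = 0 \<and> length (W j k) \<le> V"
          using k For.prems(5) that LV by (auto simp: H_def W_def)
      qed
      show "\<forall>k\<in>loop_vars (f ?s). W j k = []"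
      proof
        fix k assume k: "k \<in> loop_vars (f ?s)"
        then have "k \<noteq> t" "k \<noteq> i" using f by auto
        then show "W j k = []" using k For.prems(6) by (auto simp: W_def)
      qed
    qed (simp add: W_def H_def)
    moreover have "W j t = ws t @ emitted j" by (simp add: W_def)
    ultimately have "runs (compile t (f ?s)) (tapes n (W j) (H j)) (time_bound (f ?s) V) (tapes n ?W ?H)"
      by (simp only: emS append_assoc)
    moreover have "time_bound (f ?s) V \<le> b"
    proof -
      have "?s \<in> {1, 2, 3}" using For.prems(4) ne that nth_mem[of j "ws r"]
        unfolding words_ok_def L_def by blast
      then show ?thesis unfolding b_def by (intro member_le_sum) auto
    qed
    ultimately have "runs (compile t (f ?s)) (tapes n (W j) (H j)) b (tapes n ?W ?H)"
      by (rule runs_mono)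
    moreover have "word_cells (W j r) (H j r) = ?s"
      using ne that by (simp add: W_def H_def word_cells_def L_def)
    ultimately have 1: "runs (Case r (\<lambda>s. compile t (f s))) (tapes n (W j) (H j)) (Suc b) (tapes n ?W ?H)"
      using ne by (intro runs_Case) simp_all
    have "words_ok n ?W" by (intro words_ok_upd ok wt)
    then have "runs (append_one i) (tapes n ?W ?H) (4 * length (?W i) + 11) (tapes n (?W(i := ?W i @ [1])) ?H)"
      using ne hs by (intro runs_append_one) (simp_all add: H_def)
    moreover have "?W(i := ?W i @ [1]) = W (Suc j)"
      using ne by (auto simp: W_def fun_eq_iff replicate_append_same)
    ultimately have 2: "runs (append_one i) (tapes n ?W ?H) (4 * length (?W i) + 11) (tapes n (W (Suc j)) ?H)"
      by simp
    have "?H(r := ?H r + shift MoveRight) = H (Suc j)"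
      using ne by (auto simp: H_def fun_eq_iff)
    then have 3: "runs (Act r None MoveRight) (tapes n (W (Suc j)) ?H) 1 (tapes n (W (Suc j)) (H (Suc j)))"
      using runs_move[of r n MoveRight "W (Suc j)" ?H] ne by simp
    have "length (?W i) \<le> V" using ne that LV by (simp add: W_def)
    then show ?thesis by (intro runs_mono[OF runs_Seq[OF 1 runs_Seq[OF 2 3]]]) simp
  qed
  have loop: "runs (While r ?body) (tapes n (W (L - d)) (H (L - d))) (d * (b + 4 * V + 16) + 1) (tapes n (W L) (H L))"
    if "d \<le> L" for d
    using that
  proof (induction d)
    case 0
    have "word_cells (W L r) (H L r) = 0" using ne by (simp add: W_def H_def L_def word_cells_def)
    then show ?case using runs_While_end[of "tapes n (W L) (H L)" r] ne by simp
  next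
    case (Suc d)
    let ?j = "L - Suc d"
    have j: "?j < L" "Suc ?j = L - d" using Suc.prems by auto
    have "word_cells (W ?j r) (H ?j r) \<noteq> 0"
      using ne j by (intro word_cells_nonzero[OF ok]) (auto simp: W_def H_def L_def)
    then have "runs (While r ?body) (tapes n (W ?j) (H ?j)) (Suc (b + 4 * V + 15 + (d * (b + 4 * V + 16) + 1)))
      (tapes n (W L) (H L))"
      using body[OF j(1)] Suc ne unfolding j(2) by (intro runs_While_step) simp_all
    then show ?case by (rule runs_mono) simp
  qed
  have "W 0 = ws" "H 0 = hs"
    using ne hs wsi For.prems(7) by (auto simp: W_def H_def emitted_def fun_eq_iff)
  with loop[of L] have 1: "runs (While r ?body) (tapes n ws hs) (L * (b + 4 * V + 16) + 1) (tapes n (W L) (H L))"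
    by simp
  have "runs (rewind r) (tapes n (W L) (H L)) (2 * length (W L r) + 5) (tapes n (W L) ((H L)(r := 0)))"
    using ne ok by (intro runs_rewind) (auto simp: H_def W_def L_def)
  then have 2: "runs (rewind r) (tapes n (W L) (H L)) (2 * V + 5) (tapes n (W L) ((H L)(r := 0)))"
    using ne LV by (elim runs_mono) (simp add: W_def L_def)
  have "runs (clear i) (tapes n (W L) ((H L)(r := 0))) (4 * length (W L i) + 7)
     (tapes n ((W L)(i := [])) ((H L)(r := 0)))"
    using ne ok hs by (intro runs_clear) (simp_all add: H_def)
  then have 3: "runs (clear i) (tapes n (W L) ((H L)(r := 0))) (4 * V + 7)
     (tapes n ((W L)(i := [])) ((H L)(r := 0)))"
    using ne LV by (elim runs_mono) (simp add: W_def L_def)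
  have o: "out (For i r f) ws = emitted L" by (simp add: emitted_def L_def)
  have "(W L)(i := []) = ws(t := ws t @ out (For i r f) ws)"
    using ne wsi unfolding o by (auto simp: W_def fun_eq_iff)
  moreover have "(H L)(r := 0) = hs(t := int (length (ws t @ out (For i r f) ws)))"
    using ne hs unfolding o by (auto simp: H_def fun_eq_iff)
  ultimately have A: "runs (compile t (For i r f)) (tapes n ws hs)
      (Suc (L * (b + 4 * V + 16) + 1 + Suc (2 * V + 5 + (4 * V + 7))))
      (tapes n (ws(t := ws t @ out (For i r f) ws)) (hs(t := int (length (ws t @ out (For i r f) ws)))))"
    using runs_Seq[OF 1 runs_Seq[OF 2 3]] by simp
  have "Suc (L * (b + 4 * V + 16) + 1 + Suc (2 * V + 5 + (4 * V + 7))) \<le> time_bound (For i r f) V"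
    using mult_le_mono1[OF LV, of "b + 4 * V + 16"] unfolding time_bound.simps b_def[symmetric] by linarith
  from runs_mono[OF A this] show ?case .
qed

section \<open>Polynomial time\<close>

text \<open>The base \<open>Suc n\<close> makes the bound monotone in the exponent, which
  \<open>n ^ d\<close> is not at \<open>n = 0\<close>; bounds with different exponents can then be
  added.\<close>

lemma poly_boundedI:
  assumes "\<And>n. p n \<le> c * Suc n ^ d"
  shows "poly_bounded p"
  unfolding poly_bounded_def
proof (intro exI allI)
  fix n
  have "Suc n ^ d \<le> 2 ^ d * n ^ d + 2 ^ d"
  proof (cases n)
    case (Suc m)
    then have "Suc n ^ d \<le> (2 * n) ^ d" by (intro power_mono) auto
    then show ?thesis by (simp add: power_mult_distrib trans_le_add1)
  qed (simp add: trans_le_add2 Suc_le_eq)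
  then have "c * Suc n ^ d \<le> c * (2 ^ d * n ^ d + 2 ^ d)" by (rule mult_le_mono2)
  then show "p n \<le> c * 2 ^ d * n ^ d + c * 2 ^ d"
    using assms[of n] by (simp add: algebra_simps)
qed

lemma poly_boundedE:
  assumes "poly_bounded p"
  obtains c d where "\<And>n. p n \<le> c * Suc n ^ d"
proof -
  obtain c d where cd: "\<And>n. p n \<le> c * n ^ d + c" using assms unfolding poly_bounded_def by blast
  have "p n \<le> (2 * c) * Suc n ^ d" for n
  proof -
    have "n ^ d \<le> Suc n ^ d" "1 \<le> Suc n ^ d" by (auto intro: power_mono)
    then have "c * n ^ d \<le> c * Suc n ^ d" "c * 1 \<le> c * Suc n ^ d" by (auto intro: mult_le_mono2)
    then show ?thesis using cd[of n] unfolding mult_2 add_mult_distrib by linarith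
  qed
  then show ?thesis using that by blast
qed

lemma poly_bounded_le: "poly_bounded q \<Longrightarrow> (\<And>n. p n \<le> q n) \<Longrightarrow> poly_bounded p"
  unfolding poly_bounded_def by (meson le_trans)

lemma poly_bounded_const [simp, intro]: "poly_bounded (\<lambda>n. a)"
  by (rule poly_boundedI[of _ a 0]) simp

lemma poly_bounded_id [simp, intro]: "poly_bounded (\<lambda>n. n)"
  by (rule poly_boundedI[of _ 1 1]) simp

lemma poly_bounded_add [intro]:
  assumes "poly_bounded p" "poly_bounded q"
  shows "poly_bounded (\<lambda>n. p n + q n)"
proof -
  obtain c d where p: "\<And>n. p n \<le> c * Suc n ^ d" using assms(1) by (rule poly_boundedE) blast
  obtain c' d' where q: "\<And>n. q n \<le> c' * Suc n ^ d'" using assms(2) by (rule poly_boundedE) blast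
  have "p n + q n \<le> (c + c') * Suc n ^ (d + d')" for n
  proof -
    have "c * Suc n ^ d \<le> c * Suc n ^ (d + d')" "c' * Suc n ^ d' \<le> c' * Suc n ^ (d + d')"
      by (intro mult_le_mono2 power_increasing; simp)+
    then show ?thesis using p[of n] q[of n] unfolding add_mult_distrib by linarith
  qed
  then show ?thesis by (rule poly_boundedI)
qed

lemma poly_bounded_mult [intro]:
  assumes "poly_bounded p" "poly_bounded q"
  shows "poly_bounded (\<lambda>n. p n * q n)"
proof -
  obtain c d where p: "\<And>n. p n \<le> c * Suc n ^ d" using assms(1) by (rule poly_boundedE) blast
  obtain c' d' where q: "\<And>n. q n \<le> c' * Suc n ^ d'" using assms(2) by (rule poly_boundedE) blast
  have "p n * q n \<le> (c * c') * Suc n ^ (d + d')" for n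
    using mult_le_mono[OF p[of n] q[of n]] by (simp add: power_add algebra_simps)
  then show ?thesis by (rule poly_boundedI)
qed

lemma poly_bounded_power [intro]: "poly_bounded p \<Longrightarrow> poly_bounded (\<lambda>n. p n ^ d)"
  by (induction d) auto

lemma poly_bounded_sum [intro]:
  "finite A \<Longrightarrow> (\<And>a. a \<in> A \<Longrightarrow> poly_bounded (p a)) \<Longrightarrow> poly_bounded (\<lambda>n. \<Sum>a\<in>A. p a n)"
  by (induction A rule: finite_induct) auto

lemma poly_bounded_compose:
  assumes "poly_bounded p" "poly_bounded q"
  shows "poly_bounded (\<lambda>n. p (q n))"
proof -
  obtain c d where p: "\<And>n. p n \<le> c * Suc n ^ d" using assms(1) by (rule poly_boundedE) blast
  have "poly_bounded (\<lambda>n. c * (q n + 1) ^ d)" using assms(2) by (intro poly_bounded_mult poly_bounded_power poly_bounded_add) auto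
  then show ?thesis by (rule poly_bounded_le) (use p in simp)
qed

lemma poly_bounded_time_bound: "poly_bounded (time_bound p)"
proof (induction p)
  case (Emit w)
  then show ?case by simp
next
  case (Then p q)
  then have "poly_bounded (\<lambda>V. 1 + (time_bound p V + time_bound q V))" by (intro poly_bounded_add) auto
  then show ?case by simp
next
  case (For i r f)
  then have "poly_bounded (\<lambda>V. \<Sum>s<4. time_bound (f s) V)" by (intro poly_bounded_sum) auto
  then show ?case
    unfolding time_bound.simps by (intro poly_bounded_add poly_bounded_mult) auto
qed

text \<open>The time bound also dominates the output length; it is used to pay for rewinding the
  output tape between two stages.\<close>

lemma length_out_le:
  assumes "\<forall>k \<in> used_tapes p. length (ws k) \<le> V" "wf_prog p" "\<forall>k. set (ws k) \<subseteq> {1, 2, 3}"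
  shows "length (out p ws) \<le> time_bound p V"
  using assms
proof (induction p arbitrary: ws)
  case (For i r f)
  let ?b = "\<Sum>s<4. time_bound (f s) V"
  have "length (out (f (ws r ! j)) (ws(i := replicate j 1))) \<le> ?b" if "j < length (ws r)" for j
  proof -
    have "length (out (f (ws r ! j)) (ws(i := replicate j 1))) \<le> time_bound (f (ws r ! j)) V"
    proof (rule For.IH[OF rangeI])
      show "\<forall>k\<in>used_tapes (f (ws r ! j)). length ((ws(i := replicate j 1)) k) \<le> V"
      proof
        fix k assume "k \<in> used_tapes (f (ws r ! j))"
        then have "length (ws k) \<le> V" using For.prems(1) by auto
        moreover have "j \<le> V" using that For.prems(1) by simp
        ultimately show "length ((ws(i := replicate j 1)) k) \<le> V" by simp
      qed
      show "\<forall>k. set ((ws(i := replicate j 1)) k) \<subseteq> {1, 2, 3}"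
        using For.prems(3) by (simp add: set_replicate_conv_if)
    qed (use For.prems(2) in simp)
    also have "ws r ! j \<in> {1, 2, 3}" using that For.prems(3) nth_mem by blast
    then have "time_bound (f (ws r ! j)) V \<le> ?b" by (intro member_le_sum) auto
    finally show ?thesis .
  qed
  then have "length (out (For i r f) ws) \<le> (\<Sum>j\<leftarrow>[0..<length (ws r)]. ?b)"
    unfolding out.simps length_concat map_map by (intro sum_list_mono) auto
  also have "\<dots> = length (ws r) * ?b" by (simp add: sum_list_triv)
  also have "\<dots> \<le> V * ?b" using For.prems(1) by (intro mult_le_mono1) simp
  finally show ?case by (simp add: algebra_simps)
next
  case (Then p q)
  then have "length (out p ws) \<le> time_bound p V" "length (out q ws) \<le> time_bound q V" by simp_all
  then show ?case by simp
qed simp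

text \<open>A stage fills one tape and rewinds it, so that later stages can use the produced word as
  a loop range. This is how polynomially long loops arise from a short input.\<close>

primrec stages_cmd :: "(nat \<times> prog) list \<Rightarrow> cmd" where
  "stages_cmd [] = Act 0 None Stay"
| "stages_cmd (s # ss) = Seq (Seq (compile (fst s) (snd s)) (rewind (fst s))) (stages_cmd ss)"

primrec stages_out :: "(nat \<times> prog) list \<Rightarrow> (nat \<Rightarrow> nat list) \<Rightarrow> nat \<Rightarrow> nat list" where
  "stages_out [] ws = ws"
| "stages_out (s # ss) ws = stages_out ss (ws(fst s := out (snd s) ws))"

primrec stages_ok :: "nat \<Rightarrow> nat \<Rightarrow> (nat \<times> prog) list \<Rightarrow> (nat \<Rightarrow> nat list) \<Rightarrow> bool" where
  "stages_ok n V [] ws \<longleftrightarrow> True"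
| "stages_ok n V (s # ss) ws \<longleftrightarrow>
     (\<forall>k \<in> used_tapes (snd s). length (ws k) \<le> V) \<and> (\<forall>k \<in> loop_vars (snd s). ws k = []) \<and>
     ws (fst s) = [] \<and> stages_ok n V ss (ws(fst s := out (snd s) ws))"

definition wf_stage :: "nat \<Rightarrow> nat \<times> prog \<Rightarrow> bool" where
  "wf_stage n s \<longleftrightarrow> fst s < n \<and> wf_prog (snd s) \<and> used_tapes (snd s) \<subseteq> {..<n} - {fst s}"

lemma stages_append:
  "stages_out (xs @ ys) ws = stages_out ys (stages_out xs ws)"
  "stages_ok n V (xs @ ys) ws \<longleftrightarrow> stages_ok n V xs ws \<and> stages_ok n V ys (stages_out xs ws)"
  by (induction xs arbitrary: ws) auto

primrec stages_time :: "(nat \<times> prog) list \<Rightarrow> nat \<Rightarrow> nat" where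
  "stages_time [] V = 1"
| "stages_time (s # ss) V = 3 * time_bound (snd s) V + 7 + stages_time ss V"

lemma poly_bounded_stages_time: "poly_bounded (stages_time ss)"
proof (induction ss)
  case (Cons s ss)
  then show ?case unfolding stages_time.simps
    by (intro poly_bounded_add poly_bounded_mult poly_bounded_time_bound) auto
qed simp

lemma wf_stages_cmd: "\<forall>s \<in> set ss. wf_stage n s \<Longrightarrow> 0 < n \<Longrightarrow> wf_cmd n (stages_cmd ss)"
proof (induction ss)
  case (Cons s ss)
  then have "wf_cmd n (compile (fst s) (snd s))" "fst s < n"
    by (auto simp: wf_stage_def intro!: wf_compile)
  then show ?case using Cons by (simp add: rewind_def)
qed simp

lemma runs_stages:
  assumes "\<forall>s \<in> set ss. wf_stage n s" "0 < n" "stages_ok n V ss ws" "\<forall>k. set (ws k) \<subseteq> {1, 2, 3}"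
  shows "runs (stages_cmd ss) (tapes n ws (\<lambda>_. 0)) (stages_time ss V) (tapes n (stages_out ss ws) (\<lambda>_. 0))"
  using assms(1,3,4)
proof (induction ss arbitrary: ws)
  case Nil
  then show ?case using runs_move[OF assms(2), of Stay ws "\<lambda>_. 0"] by (simp add: fun_upd_idem)
next
  case (Cons s ss)
  obtain t p where s: "s = (t, p)" by (cases s)
  let ?ws = "ws(t := out p ws)"
  have wf: "t < n" "wf_prog p" "used_tapes p \<subseteq> {..<n} - {t}"
    using Cons.prems(1) by (auto simp: wf_stage_def s)
  have ok: "\<forall>k\<in>used_tapes p. length (ws k) \<le> V" "\<forall>k\<in>loop_vars p. ws k = []" "ws t = []"
    "stages_ok n V ss ?ws" using Cons.prems(2) by (simp_all add: s)
  have words: "words_ok n ws" using Cons.prems(3) by (simp add: words_ok_def)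
  have 1: "runs (compile t p) (tapes n ws (\<lambda>_. 0)) (time_bound p V)
      (tapes n ?ws ((\<lambda>_. 0)(t := int (length (out p ws)))))"
    using runs_compile[OF wf(2,1,3) words, of "\<lambda>_. 0" V] ok by simp
  have len: "length (out p ws) \<le> time_bound p V"
    using ok(1) wf(2) Cons.prems(3) by (rule length_out_le)
  have words': "\<forall>k. set (?ws k) \<subseteq> {1, 2, 3}" using Cons.prems(3) set_out[OF wf(2)] by simp
  have "runs (rewind t) (tapes n ?ws ((\<lambda>_. 0)(t := int (length (out p ws)))))
      (2 * length (?ws t) + 5) (tapes n ?ws (((\<lambda>_. 0)(t := int (length (out p ws))))(t := 0)))"
    using wf(1) words' by (intro runs_rewind) (simp_all add: words_ok_def)
  then have 2: "runs (rewind t) (tapes n ?ws ((\<lambda>_. 0)(t := int (length (out p ws)))))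
      (2 * length (out p ws) + 5) (tapes n ?ws (\<lambda>_. 0))"
    by (simp add: fun_upd_idem)
  have 3: "runs (stages_cmd ss) (tapes n ?ws (\<lambda>_. 0)) (stages_time ss V) (tapes n (stages_out ss ?ws) (\<lambda>_. 0))"
    using Cons.prems(1) by (intro Cons.IH ok words') simp
  have "runs (stages_cmd (s # ss)) (tapes n ws (\<lambda>_. 0))
     (Suc (Suc (time_bound p V + (2 * length (out p ws) + 5)) + stages_time ss V)) (tapes n (stages_out ss ?ws) (\<lambda>_. 0))"
    using runs_Seq[OF runs_Seq[OF 1 2] 3] by (simp add: s)
  from runs_mono[OF this, of "stages_time (s # ss) V"] show ?case using len by (simp add: s)
qed

text \<open>Among \<open>Suc n\<close> tapes, tape \<open>n\<close> is the last one, from which the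
  output of a machine is read; the symbols 1 and 2 coincide with \<open>bit_sym\<close>, and the
  first blank comes right after the word.\<close>

lemma stages_computable:
  assumes wf: "\<forall>s \<in> set ss. wf_stage (Suc n) s"
    and V: "poly_bounded V"
    and ok: "\<And>x. stages_ok (Suc n) (V (length x)) ss ((\<lambda>_. [])(0 := map bit_sym x))"
    and out: "\<And>x. stages_out ss ((\<lambda>_. [])(0 := map bit_sym x)) n = map bit_sym (f x)"
  shows "poly_time_computable f"
proof -
  obtain M where M: "wf_tm M" "ntapes M = Suc n"
    "\<And>x t ts. (cmd_step ^^ t) ([stages_cmd ss], snd (tm_init M x)) = ([], ts) \<Longrightarrow> tm_conf M x t = (accept M, ts)"
    using cmd_to_tm[OF wf_stages_cmd[OF wf]] by auto
  define T where "T m = stages_time ss (V m)" for m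
  have "\<exists>t\<le>T (length x). fst (tm_conf M x t) = accept M \<and> outputs (tm_conf M x t) (f x)" for x
  proof -
    let ?ws = "(\<lambda>_. [])(0 := map bit_sym x)"
    have "\<forall>k. set (?ws k) \<subseteq> {1, 2, 3}" by (auto simp: bit_sym_def)
    then obtain t where t: "t \<le> T (length x)" "(cmd_step ^^ t) ([stages_cmd ss], tapes (Suc n) ?ws (\<lambda>_. 0))
        = ([], tapes (Suc n) (stages_out ss ?ws) (\<lambda>_. 0))"
      using runs_stages[OF wf _ ok[of x]] unfolding runs_def T_def by blast
    have [simp]: "word_cells [] = (\<lambda>_. 0)" "word_cells (map bit_sym x) = word_tape x"
      by (auto simp: word_cells_def word_tape_def fun_eq_iff)
    have "snd (tm_init M x) = tapes (Suc n) ?ws (\<lambda>_. 0)"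
      by (rule nth_equalityI) (auto simp: tm_init_def M(2) nth_Cons')
    then have c: "tm_conf M x t = (accept M, tapes (Suc n) (stages_out ss ?ws) (\<lambda>_. 0))"
      using M(3)[of t x] t(2) by simp
    have "last (tapes (Suc n) (stages_out ss ?ws) (\<lambda>_. 0)) = (word_cells (map bit_sym (f x)), 0)"
      using out[of x] by (simp add: tapes_def)
    then have "outputs (tm_conf M x t) (f x)"
      by (simp add: c outputs_def word_cells_def)
    then show ?thesis using t(1) c by auto
  qed
  moreover have "poly_bounded T"
    unfolding T_def by (rule poly_bounded_compose[OF poly_bounded_stages_time V])
  ultimately show ?thesis
    using M(1) unfolding poly_time_computable_def tm_computes_in_time_def by blast
qed

section \<open>Printing templates\<close>

text \<open>Coefficients of \<open>a + b * R + c * i\<close>, where \<open>R\<close> is the length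
  of the padded input and \<open>i\<close> a loop index. Repeating a text that often takes constant
  text followed by one loop over a tape of length \<open>R\<close> and one over the counter
  tape.\<close>

type_synonym lin = "nat \<times> nat \<times> nat"

fun lin_val :: "nat \<Rightarrow> nat \<Rightarrow> lin \<Rightarrow> nat" where
  "lin_val R i (a, b, c) = a + b * R + c * i"

datatype piece = Lit "bool list" | Rep lin "bool list"

primrec piece_out :: "nat \<Rightarrow> nat \<Rightarrow> piece \<Rightarrow> bool list" where
  "piece_out R i (Lit bs) = bs"
| "piece_out R i (Rep e bs) = concat (replicate (lin_val R i e) bs)"

abbreviation pieces_out :: "nat \<Rightarrow> nat \<Rightarrow> piece list \<Rightarrow> bool list" where
  "pieces_out R i ps \<equiv> concat (map (piece_out R i) ps)"

datatype seg = Pieces "piece list" | Loop "nat \<Rightarrow> piece list"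

primrec seg_out :: "nat list \<Rightarrow> seg \<Rightarrow> bool list" where
  "seg_out w (Pieces ps) = pieces_out (length w) 0 ps"
| "seg_out w (Loop f) = concat (map (\<lambda>i. pieces_out (length w) i (f (w ! i))) [0..<length w])"

text \<open>Symbol 3 is neither blank nor a bit, so one loop runs through the whole padded word and
  still recognises in each iteration whether it is on an input bit.\<close>

definition padded :: "nat \<Rightarrow> nat \<Rightarrow> bool list \<Rightarrow> nat list" where
  "padded c d x = map bit_sym x @ replicate (c * Suc (length x) ^ d) 3"

definition repeat_prog :: "nat \<Rightarrow> nat list \<Rightarrow> prog" where
  "repeat_prog r w = For 4 r (\<lambda>_. Emit w)"

primrec piece_prog :: "piece \<Rightarrow> prog" where
  "piece_prog (Lit bs) = Emit (map bit_sym bs)"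
| "piece_prog (Rep e bs) = (case e of (a, b, c) \<Rightarrow>
     Then (Emit (concat (replicate a (map bit_sym bs))))
       (Then (repeat_prog 2 (concat (replicate b (map bit_sym bs))))
          (repeat_prog 3 (concat (replicate c (map bit_sym bs))))))"

definition pieces_prog :: "piece list \<Rightarrow> prog" where
  "pieces_prog ps = foldr (\<lambda>p. Then (piece_prog p)) ps (Emit [])"

primrec seg_prog :: "seg \<Rightarrow> prog" where
  "seg_prog (Pieces ps) = pieces_prog ps"
| "seg_prog (Loop f) = For 3 1 (\<lambda>s. pieces_prog (f s))"

definition segs_prog :: "seg list \<Rightarrow> prog" where
  "segs_prog ss = foldr (\<lambda>p. Then (seg_prog p)) ss (Emit [])"

lemma out_repeat: "out (repeat_prog r w) ws = concat (replicate (length (ws r)) w)"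
  by (simp add: repeat_prog_def map_replicate_const)

lemma concat_replicate_concat:
  "concat (replicate m (concat (replicate n w))) = concat (replicate (n * m) w)"
  by (induction m) (simp_all add: replicate_add)

lemma map_concat_replicate: "map f (concat (replicate n w)) = concat (replicate n (map f w))"
  by (induction n) auto

lemma out_piece:
  "length (ws 2) = R \<Longrightarrow> length (ws 3) = i \<Longrightarrow> out (piece_prog p) ws = map bit_sym (piece_out R i p)"
  by (cases p) (auto simp: out_repeat concat_replicate_concat map_concat_replicate replicate_add split: prod.splits)

lemma out_pieces:
  "length (ws 2) = R \<Longrightarrow> length (ws 3) = i \<Longrightarrow> out (pieces_prog ps) ws = map bit_sym (pieces_out R i ps)"
  by (induction ps) (simp_all add: pieces_prog_def out_piece)

lemma out_seg:
  assumes "ws 1 = w" "length (ws 2) = length w" "ws 3 = []"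
  shows "out (seg_prog s) ws = map bit_sym (seg_out w s)"
proof (cases s)
  case (Loop f)
  have "out (pieces_prog ps) (ws(3 := replicate j 1)) = map bit_sym (pieces_out (length w) j ps)" for ps j
    using assms by (intro out_pieces) auto
  then show ?thesis using Loop assms by (simp add: map_concat o_def)
qed (use assms in \<open>simp add: out_pieces\<close>)

lemma out_segs:
  assumes "ws 1 = w" "length (ws 2) = length w" "ws 3 = []"
  shows "out (segs_prog ss) ws = map bit_sym (concat (map (seg_out w) ss))"
  by (induction ss) (simp_all add: segs_prog_def out_seg[OF assms])

lemma bit_sym_range: "set (map bit_sym bs) \<subseteq> {1, 2, 3}"
  by (auto simp: bit_sym_def)

lemma wf_repeat: "wf_prog (repeat_prog r w) \<longleftrightarrow> r \<noteq> 4 \<and> set w \<subseteq> {1, 2, 3}"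
  "used_tapes (repeat_prog r w) = {4, r}" "loop_vars (repeat_prog r w) = {4}"
  by (auto simp: repeat_prog_def)

lemma set_concat_replicate: "set (concat (replicate n w)) \<subseteq> set w"
  by (induction n) auto

lemma piece_prog_props:
  "wf_prog (piece_prog p)" "used_tapes (piece_prog p) \<subseteq> {2, 3, 4}" "loop_vars (piece_prog p) \<subseteq> {4}"
proof -
  have "set (concat (replicate n (map bit_sym bs))) \<subseteq> {1, 2, 3}" for n bs
    using set_concat_replicate bit_sym_range by (rule subset_trans)
  note * = this
  show "wf_prog (piece_prog p)"
  proof (cases p)
    case (Rep e bs)
    then show ?thesis
      using *[of _ bs] by (cases e) (simp del: set_concat add: wf_repeat)
  qed (simp only: piece_prog.simps wf_prog.simps bit_sym_range)
qed (cases p; auto simp: wf_repeat split: prod.split)+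

lemma pieces_prog_props:
  "wf_prog (pieces_prog ps)" "used_tapes (pieces_prog ps) \<subseteq> {2, 3, 4}" "loop_vars (pieces_prog ps) \<subseteq> {4}"
  using piece_prog_props by (induction ps) (auto simp: pieces_prog_def)

lemma seg_prog_props:
  "wf_prog (seg_prog s)" "used_tapes (seg_prog s) \<subseteq> {1, 2, 3, 4}" "loop_vars (seg_prog s) \<subseteq> {3, 4}"
proof -
  have "3 \<notin> loop_vars (pieces_prog ps)" "1 \<notin> used_tapes (pieces_prog ps)" for ps
    using pieces_prog_props[of ps] by auto
  then show "wf_prog (seg_prog s)" by (cases s) (simp_all add: pieces_prog_props)
qed (use pieces_prog_props in \<open>cases s; force\<close>)+

lemma segs_prog_props:
  "wf_prog (segs_prog ss)" "used_tapes (segs_prog ss) \<subseteq> {1, 2, 3, 4}" "loop_vars (segs_prog ss) \<subseteq> {3, 4}"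
  using seg_prog_props by (induction ss) (auto simp: segs_prog_def)

text \<open>
  Tape 0 is the input, tape 1 receives the padded input, tape 2 its length in unary, tapes 3 and 4
  are loop variables, tape \<open>5 + j\<close> receives \<open>c * (length x + 1) ^ j\<close> in unary.
\<close>

definition power_prog :: "nat \<Rightarrow> prog" where
  "power_prog j = Then (For 3 (5 + j) (\<lambda>_. repeat_prog 0 [1])) (For 3 (5 + j) (\<lambda>_. Emit [1]))"

definition power_stages :: "nat \<Rightarrow> nat \<Rightarrow> (nat \<times> prog) list" where
  "power_stages c d = (5, Emit (replicate c 1)) # map (\<lambda>j. (6 + j, power_prog j)) [0..<d]"

text \<open>The body must be well formed for every \<open>s\<close>, which \<open>Emit [s]\<close>
  is not; on the bits 1 and 2 the test returns the symbol itself.\<close>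

definition pad_prog :: "nat \<Rightarrow> prog" where
  "pad_prog d = Then (For 3 0 (\<lambda>s. Emit [if s = 2 then 2 else 1])) (For 3 (5 + d) (\<lambda>_. Emit [3]))"

definition print_stages :: "nat \<Rightarrow> nat \<Rightarrow> seg list \<Rightarrow> (nat \<times> prog) list" where
  "print_stages c d ss = power_stages c d @
     [(1, pad_prog d), (2, For 3 1 (\<lambda>_. Emit [1])), (6 + d, segs_prog ss)]"

lemma out_For_const: "out (For i r (\<lambda>_. Emit w)) ws = concat (replicate (length (ws r)) w)"
  by (simp add: map_replicate_const)

lemma power_stages_run:
  assumes ws: "ws = (\<lambda>_. [])(0 := map bit_sym x)" and "\<And>j. j \<le> d \<Longrightarrow> c * Suc (length x) ^ j \<le> V" "length x \<le> V" "5 + d < n"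
  shows "stages_ok n V (power_stages c d) ws \<and>
    stages_out (power_stages c d) ws =
    (\<lambda>k. if k = 0 then map bit_sym x
         else if 5 \<le> k \<and> k \<le> 5 + d then replicate (c * Suc (length x) ^ (k - 5)) 1 else [])"
  using assms(2,4)
proof (induction d)
  case 0
  then show ?case by (auto simp: ws power_stages_def fun_eq_iff)
next
  case (Suc d)
  let ?W = "\<lambda>d k. if k = 0 then map bit_sym x
         else if 5 \<le> k \<and> k \<le> 5 + d then replicate (c * Suc (length x) ^ (k - 5)) 1 else []"
  have st: "power_stages c (Suc d) = power_stages c d @ [(6 + d, power_prog d)]"
    by (simp add: power_stages_def)
  have one: "concat (replicate m [1::nat]) = replicate m 1" for m by (induction m) auto
  have two: "concat (replicate m (replicate l s)) = replicate (m * l) s" for m l and s :: nat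
    by (induction m) (simp_all add: replicate_add)
  \<comment> \<open>Multiplication by \<open>length x + 1\<close> in unary: \<open>length x\<close>
    symbols for each symbol of the previous power, then one more copy of that power.\<close>
  have "out (power_prog d) (?W d) =
     concat (replicate (c * Suc (length x) ^ d) (replicate (length x) 1)) @ replicate (c * Suc (length x) ^ d) 1"
    by (simp add: power_prog_def out_repeat one map_replicate_const)
  also have "\<dots> = replicate (c * Suc (length x) ^ Suc d) 1"
    by (simp add: two replicate_add[symmetric] algebra_simps)
  finally have o: "out (power_prog d) (?W d) = replicate (c * Suc (length x) ^ Suc d) 1" .
  have "(?W d)(6 + d := out (power_prog d) (?W d)) = ?W (Suc d)"
    unfolding o by (auto simp: fun_eq_iff)
  moreover have "used_tapes (power_prog d) = {0, 3, 4, 5 + d}" "loop_vars (power_prog d) = {3, 4}"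
    by (auto simp: power_prog_def wf_repeat)
  ultimately show ?case
    using Suc.IH Suc.prems assms(3) Suc.prems(1)[of d] unfolding st stages_append by simp
qed

lemma segs_poly_time:
  "poly_time_computable (\<lambda>x. concat (map (seg_out (padded c d x)) ss))"
proof (rule stages_computable)
  let ?n = "6 + d"
  show "\<forall>s\<in>set (print_stages c d ss). wf_stage (Suc ?n) s"
  proof -
    have "wf_stage (Suc ?n) (6 + d, segs_prog ss)"
      using segs_prog_props[of ss] by (auto simp: wf_stage_def)
    moreover have "set (replicate c 1) \<subseteq> {1, 2, 3 :: nat}" by auto
    ultimately show ?thesis
      by (auto simp: print_stages_def power_stages_def wf_stage_def power_prog_def pad_prog_def wf_repeat)
  qed
  show "poly_bounded (\<lambda>m. m + c * (m + 1) ^ d)"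
    by (intro poly_bounded_add poly_bounded_mult poly_bounded_power) auto
next
  fix x :: "bool list"
  let ?V = "length x + c * (length x + 1) ^ d" and ?n = "6 + d"
  let ?ws = "(\<lambda>_. [])(0 := map bit_sym x)"
  let ?W = "\<lambda>k. if k = 0 then map bit_sym x
         else if 5 \<le> k \<and> k \<le> 5 + d then replicate (c * Suc (length x) ^ (k - 5)) 1 else []"
  have pw: "c * Suc (length x) ^ j \<le> c * Suc (length x) ^ d" if "j \<le> d" for j
    using that by (intro mult_le_mono2 power_increasing) auto
  have V: "?V = length x + c * Suc (length x) ^ d" by simp
  note pr = power_stages_run[OF refl, of d c x ?V "Suc ?n"]
  have P: "stages_ok (Suc ?n) ?V (power_stages c d) ?ws" "stages_out (power_stages c d) ?ws = ?W"
    using pr pw unfolding V by (simp_all add: trans_le_add2)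
  have "[if s = 2 then 2 else 1] = [s]" if "s \<in> set (map bit_sym x)" for s :: nat
    using that by (auto simp: bit_sym_def split: if_splits)
  then have "concat (map (\<lambda>j. [if map bit_sym x ! j = 2 then 2 else 1]) [0..<length x]) = 
      concat (map (\<lambda>j. [map bit_sym x ! j]) [0..<length x])"
    by (intro arg_cong[of _ _ concat] map_cong) (auto simp: bit_sym_def)
  also have "\<dots> = map bit_sym x"
    by (rule nth_equalityI) (simp_all add: concat_map_singleton)
  finally have copy: "concat (map (\<lambda>j. [if map bit_sym x ! j = 2 then 2 else 1]) [0..<length x]) = map bit_sym x" .
  have rep: "concat (replicate m [s]) = replicate m s" for m and s :: nat by (induction m) auto
  have o1: "out (pad_prog d) ?W = padded c d x"
    using copy by (simp add: pad_prog_def padded_def map_replicate_const rep)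
  let ?W1 = "?W(1 := padded c d x)"
  let ?W2 = "?W1(2 := replicate (length (padded c d x)) 1)"
  have o2: "out (For 3 1 (\<lambda>_. Emit [1])) ?W1 = replicate (length (padded c d x)) 1"
    unfolding out_For_const by (simp add: rep)
  have o3: "out (segs_prog ss) ?W2 = map bit_sym (concat (map (seg_out (padded c d x)) ss))"
    by (rule out_segs) auto
  show "stages_out (print_stages c d ss) ?ws ?n = map bit_sym (concat (map (seg_out (padded c d x)) ss))"
    unfolding print_stages_def stages_append P(2) stages_out.simps fst_conv snd_conv o1 o2 o3 by simp
  have len: "length (padded c d x) \<le> ?V" by (simp add: padded_def)
  have "\<forall>k\<in>used_tapes (segs_prog ss). length (?W2 k) \<le> ?V"
    using segs_prog_props(2)[of ss] len by auto
  moreover have "\<forall>k\<in>loop_vars (segs_prog ss). ?W2 k = []"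
    using segs_prog_props(3)[of ss] by auto
  ultimately show "stages_ok (Suc ?n) ?V (print_stages c d ss) ?ws"
    using len P(1) unfolding print_stages_def stages_append P(2) stages_ok.simps fst_conv snd_conv o1 o2
    by (simp add: pad_prog_def)
qed

section \<open>Turing machines as rule systems\<close>

datatype 'v rule = Fact 'v | Rule 'v "'v list"

text \<open>Stages are exact: stage \<open>j\<close> is meant to describe the configuration after
  precisely \<open>j\<close> steps, and nothing persists to the next stage except through a
  rule.\<close>

primrec derivable :: "'v rule set \<Rightarrow> nat \<Rightarrow> 'v \<Rightarrow> bool" where
  "derivable S 0 v \<longleftrightarrow> Fact v \<in> S"
| "derivable S (Suc j) v \<longleftrightarrow> (\<exists>us. Rule v us \<in> S \<and> (\<forall>u \<in> set us. derivable S j u))"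

text \<open>Halting is turned into an ordinary idle transition, so that the rules need no case
  distinction and an accepting state persists through the stages.\<close>

definition tm_action :: "tm \<Rightarrow> nat \<Rightarrow> nat list \<Rightarrow> nat \<times> (nat \<times> move) list" where
  "tm_action M q ss = (if q = accept M \<or> q = reject M then (q, stay ss) else delta M q ss)"

lemma tm_step_action:
  "tm_step M (q, ts) = (case tm_action M q (scanned ts) of (q', acts) \<Rightarrow> (q', map2 tape_act ts acts))"
proof (cases "q = accept M \<or> q = reject M")
  case True
  then show ?thesis
    by (simp only: tm_step.simps halted.simps tm_action_def if_True case_prod_conv tape_act_stay)
qed (simp add: tm_action_def)

lemma tm_action_wf:
  assumes "wf_tm M" "q < nstates M" "length ss = ntapes M" "set ss \<subseteq> {..<nsyms M}"
  shows "fst (tm_action M q ss) < nstates M" "length (snd (tm_action M q ss)) = ntapes M"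
    "fst ` set (snd (tm_action M q ss)) \<subseteq> {..<nsyms M}"
proof -
  obtain q' acts where d: "delta M q ss = (q', acts)" by fastforce
  then have "q' < nstates M" "length acts = ntapes M" "fst ` set acts \<subseteq> {..<nsyms M}"
    using assms unfolding wf_tm_def by fastforce+
  then show "fst (tm_action M q ss) < nstates M" "length (snd (tm_action M q ss)) = ntapes M"
    "fst ` set (snd (tm_action M q ss)) \<subseteq> {..<nsyms M}"
    using assms d by (simp_all add: tm_action_def image_image)
qed

definition config_ok :: "tm \<Rightarrow> tm_config \<Rightarrow> bool" where
  "config_ok M c \<longleftrightarrow> fst c < nstates M \<and> length (snd c) = ntapes M \<and>
     (\<forall>tp \<in> set (snd c). \<forall>i. fst tp i < nsyms M)"

lemma scanned_ok: "config_ok M (q, ts) \<Longrightarrow> set (scanned ts) \<subseteq> {..<nsyms M}"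
  by (fastforce simp: config_ok_def)

lemma config_ok_step:
  assumes "wf_tm M" "config_ok M c"
  shows "config_ok M (tm_step M c)"
proof -
  obtain q ts where c: "c = (q, ts)" by (cases c)
  obtain q' acts where a: "tm_action M q (scanned ts) = (q', acts)" by fastforce
  have w: "q' < nstates M" "length acts = ntapes M" "fst ` set acts \<subseteq> {..<nsyms M}"
    using tm_action_wf[OF assms(1), of q "scanned ts"] scanned_ok[of M q ts] assms(2) a
    by (auto simp: c config_ok_def)
  have "fst tp i < nsyms M" if "tp \<in> set (map2 tape_act ts acts)" for tp i
  proof -
    from that obtain k where k: "k < length ts" "k < length acts" "tp = tape_act (ts ! k) (acts ! k)"
      by (auto simp: in_set_conv_nth)
    have "fst (acts ! k) < nsyms M" using w(3) k by force
    moreover have "fst (ts ! k) i < nsyms M" using assms(2) k by (simp add: c config_ok_def)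
    ultimately show ?thesis using k(3) by (cases "ts ! k"; cases "acts ! k") auto
  qed
  then show ?thesis using w assms(2) unfolding c tm_step_action a by (simp add: config_ok_def)
qed

lemma config_ok_conf: "wf_tm M \<Longrightarrow> config_ok M (tm_conf M x t)"
proof (induction t)
  case 0
  then show ?case
    by (auto simp: tm_conf_def tm_init_def config_ok_def wf_tm_def word_tape_def bit_sym_def)
next
  case (Suc t)
  then show ?case using config_ok_step by (simp add: tm_conf_def)
qed

text \<open>This is \<open>1 - shift m\<close>: seen from the head, the tape moves in the opposite
  direction, and the offset 1 keeps the value natural.\<close>

fun backshift :: "move \<Rightarrow> nat" where
  "backshift MoveLeft = 2"
| "backshift Stay = 1"
| "backshift MoveRight = 0"

lemma shift_backshift: "shift m + int (backshift m) = 1"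
  by (cases m) auto

text \<open>Mixed radix numbering: first the control states, then one block of
  \<open>ntapes M * nsyms M\<close> variables per position. It is affine in \<open>p\<close>, so a
  position given by a \<open>lin\<close> yields an index given by a \<open>lin\<close>.\<close>

definition cell_var :: "tm \<Rightarrow> nat \<Rightarrow> nat \<Rightarrow> nat \<Rightarrow> nat" where
  "cell_var M k s p = nstates M + ntapes M * nsyms M * p + (k * nsyms M + s)"

definition cell_lin :: "tm \<Rightarrow> nat \<Rightarrow> nat \<Rightarrow> lin \<Rightarrow> lin" where
  "cell_lin M k s e =
     (case e of (a, b, c) \<Rightarrow> (cell_var M k s a, ntapes M * nsyms M * b, ntapes M * nsyms M * c))"

lemma lin_val_cell: "lin_val R i (cell_lin M k s e) = cell_var M k s (lin_val R i e)"
  by (cases e) (simp add: cell_lin_def cell_var_def algebra_simps)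

lemma cell_var_inj:
  assumes "k < ntapes M" "k' < ntapes M" "s < nsyms M" "s' < nsyms M"
  shows "cell_var M k s p = cell_var M k' s' p' \<longleftrightarrow> k = k' \<and> s = s' \<and> p = p'"
proof -
  have digit: "a = a' \<and> b = b'" if "n * a + b = n * a' + b'" "b < n" "b' < n" for n a b a' b' :: nat
  proof -
    have "(n * a + b) div n = a" "(n * a' + b') div n = a'" using that(2,3) by auto
    then have "a = a'" using that(1) by metis
    then show ?thesis using that by simp
  qed
  have lt: "k * nsyms M + s < ntapes M * nsyms M" if "k < ntapes M" "s < nsyms M" for k s
  proof -
    have "k * nsyms M + s < Suc k * nsyms M" using that by simp
    also have "\<dots> \<le> ntapes M * nsyms M" using that by (intro mult_le_mono1) simp
    finally show ?thesis .
  qed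
  show ?thesis
    using digit[of "ntapes M * nsyms M" p "k * nsyms M + s" p' "k' * nsyms M + s'"]
      digit[of "nsyms M" k s k' s'] lt[of k s] lt[of k' s'] assms
    by (auto simp: cell_var_def mult.commute)
qed

lemma cell_var_ge [simp]: "\<not> cell_var M k s p < nstates M"
  by (simp add: cell_var_def)

text \<open>Their number depends on the machine alone, so the rules of all contexts can be written
  out in a fixed template.\<close>

definition contexts :: "tm \<Rightarrow> (nat \<times> nat list) list" where
  "contexts M = List.product [0..<nstates M] (List.n_lists (ntapes M) [0..<nsyms M])"

lemma set_contexts:
  "(q, ss) \<in> set (contexts M) \<longleftrightarrow> q < nstates M \<and> length ss = ntapes M \<and> set ss \<subseteq> {..<nsyms M}"
  by (auto simp: contexts_def set_n_lists)

definition premise_lins :: "tm \<Rightarrow> nat \<Rightarrow> nat list \<Rightarrow> lin list" where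
  "premise_lins M q ss = (q, 0, 0) # map (\<lambda>k. cell_lin M k (ss ! k) (1, 1, 0)) [0..<ntapes M]"

lemma contextsD:
  assumes "(q, ss) \<in> set (contexts M)"
  shows "length ss = ntapes M" "\<And>k. k < ntapes M \<Longrightarrow> ss ! k < nsyms M" "q < nstates M"
proof -
  show l: "length ss = ntapes M" and "q < nstates M" using assms by (simp_all add: set_contexts)
  have "set ss \<subseteq> {..<nsyms M}" using assms by (simp add: set_contexts)
  then show "ss ! k < nsyms M" if "k < ntapes M" for k using that l by (metis lessThan_iff nth_mem subsetD)
qed

text \<open>
  Positions are relative to the head, which is at position \<open>R + 1\<close> of the window \<open>{1..2 * R + 1}\<close>,
  where \<open>R\<close> is the length of the padded input. Hence a move shifts the whole tape, and no variables
  for head positions are needed. Cells far from the head get lost, but the space bound keeps the head away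
  from them.
\<close>

definition fixed_rules :: "tm \<Rightarrow> lin rule list" where
  "fixed_rules M = Fact (start M, 0, 0) # concat (map (\<lambda>(q, ss).
     Rule (fst (tm_action M q ss), 0, 0) (premise_lins M q ss) #
     map (\<lambda>k. Rule (cell_lin M k (fst (snd (tm_action M q ss) ! k))
         (backshift (snd (snd (tm_action M q ss) ! k)), 1, 0)) (premise_lins M q ss)) [0..<ntapes M]) (contexts M))"

text \<open>Iteration \<open>i\<close> serves the cell \<open>R - i\<close> to the left of the head
  (position \<open>1 + i\<close>) and the cell \<open>i + 1\<close> to its right (position
  \<open>R + 2 + i\<close>); a move \<open>m\<close> adds \<open>backshift m - 1\<close> to every
  position. Initially the cells left of the head are blank and position \<open>R + 1 + i\<close>
  carries input symbol \<open>i\<close> on tape 0; the test \<open>s < 3\<close> turns padding into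
  blanks.\<close>

definition loop_rules :: "tm \<Rightarrow> nat \<Rightarrow> lin rule list" where
  "loop_rules M s =
     map (\<lambda>k. Fact (cell_lin M k 0 (1, 0, 1))) [0..<ntapes M] @
     map (\<lambda>k. Fact (cell_lin M k (if k = 0 \<and> s < 3 then s else 0) (1, 1, 1))) [0..<ntapes M] @
     concat (map (\<lambda>((q, ss), k, s').
       [Rule (cell_lin M k s' (backshift (snd (snd (tm_action M q ss) ! k)), 0, 1))
          (cell_lin M k s' (1, 0, 1) # premise_lins M q ss),
        Rule (cell_lin M k s' (1 + backshift (snd (snd (tm_action M q ss) ! k)), 1, 1))
          (cell_lin M k s' (2, 1, 1) # premise_lins M q ss)])
       (List.product (contexts M) (List.product [0..<ntapes M] [0..<nsyms M])))"

definition tm_rules :: "tm \<Rightarrow> nat list \<Rightarrow> nat rule list" where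
  "tm_rules M w = map (map_rule (lin_val (length w) 0)) (fixed_rules M) @
     concat (map (\<lambda>i. map (map_rule (lin_val (length w) i)) (loop_rules M (w ! i))) [0..<length w])"

abbreviation premise_vars :: "tm \<Rightarrow> nat \<Rightarrow> nat \<Rightarrow> nat list \<Rightarrow> nat list" where
  "premise_vars M R q ss \<equiv> q # map (\<lambda>k. cell_var M k (ss ! k) (R + 1)) [0..<ntapes M]"

lemma map_premises: "map (lin_val R i) (premise_lins M q ss) = premise_vars M R q ss"
  by (auto simp: premise_lins_def lin_val_cell)

lemma Fact_tm_rules:
  "Fact v \<in> set (tm_rules M w) \<longleftrightarrow> v = start M \<or> (\<exists>i < length w. \<exists>k < ntapes M.
     v = cell_var M k 0 (i + 1) \<or>
     v = cell_var M k (if k = 0 \<and> w ! i < 3 then w ! i else 0) (length w + 1 + i))"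
  (is "?l \<longleftrightarrow> ?r")
proof
  assume ?l
  then consider r where "r \<in> set (fixed_rules M)" "Fact v = map_rule (lin_val (length w) 0) r"
    | i r where "i < length w" "r \<in> set (loop_rules M (w ! i))" "Fact v = map_rule (lin_val (length w) i) r"
    by (auto simp: tm_rules_def)
  then show ?r
  proof cases
    case (1 r)
    then have "r = Fact (start M, 0, 0)" unfolding fixed_rules_def by auto
    then show ?thesis using 1 by simp
  next
    case (2 i r)
    from 2(2,3) obtain k where "k < ntapes M" "r = Fact (cell_lin M k 0 (1, 0, 1)) \<or>
        r = Fact (cell_lin M k (if k = 0 \<and> w ! i < 3 then w ! i else 0) (1, 1, 1))"
      unfolding loop_rules_def by auto
    then have "v = cell_var M k 0 (i + 1) \<or>
        v = cell_var M k (if k = 0 \<and> w ! i < 3 then w ! i else 0) (length w + 1 + i)"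
      using 2(3) by (auto simp: lin_val_cell)
    then show ?thesis using 2(1) \<open>k < ntapes M\<close> by blast
  qed
next
  assume ?r
  then consider "v = start M" | i k where "i < length w" "k < ntapes M" "v = cell_var M k 0 (i + 1)"
    | i k where "i < length w" "k < ntapes M"
        "v = cell_var M k (if k = 0 \<and> w ! i < 3 then w ! i else 0) (length w + 1 + i)"
    by blast
  then show ?l
  proof cases
    case 1
    then show ?thesis by (simp add: tm_rules_def fixed_rules_def)
  next
    case (2 i k)
    then have "Fact v = map_rule (lin_val (length w) i) (Fact (cell_lin M k 0 (1, 0, 1)))"
      by (simp add: lin_val_cell)
    moreover have "Fact (cell_lin M k 0 (1, 0, 1)) \<in> set (loop_rules M (w ! i))"
      using 2 by (simp add: loop_rules_def)
    ultimately show ?thesis using 2(1) by (force simp: tm_rules_def)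
  next
    case (3 i k)
    let ?s = "if k = 0 \<and> w ! i < 3 then w ! i else 0"
    have "Fact v = map_rule (lin_val (length w) i) (Fact (cell_lin M k ?s (1, 1, 1)))"
      using 3 by (simp add: lin_val_cell add.commute)
    moreover have "Fact (cell_lin M k ?s (1, 1, 1)) \<in> set (loop_rules M (w ! i))"
      using 3 by (simp add: loop_rules_def)
    ultimately show ?thesis using 3(1) by (force simp: tm_rules_def)
  qed
qed

text \<open>The rules with all linear expressions evaluated, sorted by what they determine: the
  control state, the cell just written, a cell left or right of the old head position. The semantic
  arguments only use this form.\<close>

inductive tm_rule :: "tm \<Rightarrow> nat \<Rightarrow> nat \<Rightarrow> nat list \<Rightarrow> bool" for M R where
  ctrl: "(q, ss) \<in> set (contexts M) \<Longrightarrow> v = fst (tm_action M q ss) \<Longrightarrow> us = premise_vars M R q ss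
    \<Longrightarrow> tm_rule M R v us"
| head: "(q, ss) \<in> set (contexts M) \<Longrightarrow> k < ntapes M \<Longrightarrow> snd (tm_action M q ss) ! k = (s, m)
    \<Longrightarrow> v = cell_var M k s (backshift m + R) \<Longrightarrow> us = premise_vars M R q ss \<Longrightarrow> tm_rule M R v us"
| left: "(q, ss) \<in> set (contexts M) \<Longrightarrow> k < ntapes M \<Longrightarrow> snd (tm_action M q ss) ! k = (s', m)
    \<Longrightarrow> i < R \<Longrightarrow> s < nsyms M \<Longrightarrow> v = cell_var M k s (backshift m + i)
    \<Longrightarrow> us = cell_var M k s (1 + i) # premise_vars M R q ss \<Longrightarrow> tm_rule M R v us"
| right: "(q, ss) \<in> set (contexts M) \<Longrightarrow> k < ntapes M \<Longrightarrow> snd (tm_action M q ss) ! k = (s', m)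
    \<Longrightarrow> i < R \<Longrightarrow> s < nsyms M \<Longrightarrow> v = cell_var M k s (1 + backshift m + R + i)
    \<Longrightarrow> us = cell_var M k s (2 + R + i) # premise_vars M R q ss \<Longrightarrow> tm_rule M R v us"

lemma Rule_tm_rulesD:
  assumes "Rule v us \<in> set (tm_rules M w)"
  shows "tm_rule M (length w) v us"
proof -
  let ?R = "length w"
  consider r where "r \<in> set (fixed_rules M)" "Rule v us = map_rule (lin_val ?R 0) r"
    | i r where "i < ?R" "r \<in> set (loop_rules M (w ! i))" "Rule v us = map_rule (lin_val ?R i) r"
    using assms by (auto simp: tm_rules_def)
  then show ?thesis
  proof cases
    case 1
    from 1(1) consider "r = Fact (start M, 0, 0)"
      | q ss where "(q, ss) \<in> set (contexts M)" "r = Rule (fst (tm_action M q ss), 0, 0) (premise_lins M q ss)"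
      | q ss k where "(q, ss) \<in> set (contexts M)" "k < ntapes M"
          "r = Rule (cell_lin M k (fst (snd (tm_action M q ss) ! k))
             (backshift (snd (snd (tm_action M q ss) ! k)), 1, 0)) (premise_lins M q ss)"
      unfolding fixed_rules_def by auto
    then show ?thesis
    proof cases
      case (2 q ss)
      then show ?thesis using 1(2) by (intro tm_rule.ctrl[of q ss]) (auto simp: map_premises)
    next
      case (3 q ss k)
      then show ?thesis using 1(2)
        by (intro tm_rule.head[of q ss M k "fst (snd (tm_action M q ss) ! k)"
            "snd (snd (tm_action M q ss) ! k)"]) (auto simp: map_premises lin_val_cell)
    qed (use 1 in simp)
  next
    case (2 i r)
    from 2(2,3) obtain q ss k s' where c: "(q, ss) \<in> set (contexts M)" "k < ntapes M" "s' < nsyms M"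
      and r: "r = Rule (cell_lin M k s' (backshift (snd (snd (tm_action M q ss) ! k)), 0, 1))
          (cell_lin M k s' (1, 0, 1) # premise_lins M q ss) \<or>
        r = Rule (cell_lin M k s' (1 + backshift (snd (snd (tm_action M q ss) ! k)), 1, 1))
          (cell_lin M k s' (2, 1, 1) # premise_lins M q ss)"
      unfolding loop_rules_def by auto
    from r show ?thesis
    proof
      assume "r = Rule (cell_lin M k s' (backshift (snd (snd (tm_action M q ss) ! k)), 0, 1))
          (cell_lin M k s' (1, 0, 1) # premise_lins M q ss)"
      then show ?thesis using 2 c
        by (intro tm_rule.left[of q ss M k "fst (snd (tm_action M q ss) ! k)"
            "snd (snd (tm_action M q ss) ! k)" i ?R s']) (auto simp: map_premises lin_val_cell)
    next
      assume "r = Rule (cell_lin M k s' (1 + backshift (snd (snd (tm_action M q ss) ! k)), 1, 1))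
          (cell_lin M k s' (2, 1, 1) # premise_lins M q ss)"
      then show ?thesis using 2 c
        by (intro tm_rule.right[of q ss M k "fst (snd (tm_action M q ss) ! k)"
            "snd (snd (tm_action M q ss) ! k)" i ?R s']) (auto simp: map_premises lin_val_cell)
    qed
  qed
qed

lemma fixed_in_tm_rules:
  "r \<in> set (fixed_rules M) \<Longrightarrow> map_rule (lin_val (length w) 0) r \<in> set (tm_rules M w)"
  by (simp add: tm_rules_def)

lemma loop_in_tm_rules:
  "i < length w \<Longrightarrow> r \<in> set (loop_rules M (w ! i)) \<Longrightarrow> map_rule (lin_val (length w) i) r \<in> set (tm_rules M w)"
  by (force simp: tm_rules_def)

lemma in_concat_mapI: "x \<in> set xs \<Longrightarrow> y \<in> set (f x) \<Longrightarrow> y \<in> set (concat (map f xs))"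
  by auto

lemma Rule_tm_rulesI:
  assumes "tm_rule M (length w) v us"
  shows "Rule v us \<in> set (tm_rules M w)"
  using assms
proof cases
  case (ctrl q ss)
  have "Rule (fst (tm_action M q ss), 0, 0) (premise_lins M q ss) \<in> set (fixed_rules M)"
    unfolding fixed_rules_def by (auto intro!: rev_bexI[OF ctrl(1)])
  from fixed_in_tm_rules[OF this, of w] show ?thesis using ctrl by (simp add: map_premises)
next
  case (head q ss k s m)
  have "Rule (cell_lin M k s (backshift m, 1, 0)) (premise_lins M q ss) \<in> set (fixed_rules M)"
    using head(1-3) unfolding fixed_rules_def
    by (auto intro!: rev_bexI[OF head(1)] image_eqI[of _ _ k])
  from fixed_in_tm_rules[OF this, of w] show ?thesis
    using head by (simp add: map_premises lin_val_cell)
next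
  case (left q ss k s' m i s)
  have "Rule (cell_lin M k s (backshift m, 0, 1)) (cell_lin M k s (1, 0, 1) # premise_lins M q ss)
      \<in> set (loop_rules M (w ! i))"
    unfolding loop_rules_def set_append
    by (intro UnI2 in_concat_mapI[of "((q, ss), k, s)"]) (use left(1-5) in auto)
  from loop_in_tm_rules[OF left(4) this] show ?thesis
    using left by (simp add: map_premises lin_val_cell)
next
  case (right q ss k s' m i s)
  have "Rule (cell_lin M k s (1 + backshift m, 1, 1)) (cell_lin M k s (2, 1, 1) # premise_lins M q ss)
      \<in> set (loop_rules M (w ! i))"
    unfolding loop_rules_def set_append
    by (intro UnI2 in_concat_mapI[of "((q, ss), k, s)"]) (use right(1-5) in auto)
  from loop_in_tm_rules[OF right(4) this] show ?thesis
    using right by (simp add: map_premises lin_val_cell)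
qed

section \<open>Derivable variables against actual configurations\<close>

definition var_true :: "tm \<Rightarrow> nat \<Rightarrow> tm_config \<Rightarrow> nat \<Rightarrow> bool" where
  "var_true M R c v \<longleftrightarrow> (v < nstates M \<longrightarrow> v = fst c) \<and>
     (\<forall>k < ntapes M. \<forall>s < nsyms M. \<forall>p. v = cell_var M k s p \<longrightarrow>
        fst (snd c ! k) (snd (snd c ! k) + int p - int R - 1) = s)"

lemma var_true_state: "q < nstates M \<Longrightarrow> var_true M R c q \<longleftrightarrow> q = fst c"
  by (auto simp: var_true_def)

lemma var_true_cell:
  assumes "k < ntapes M" "s < nsyms M"
  shows "var_true M R c (cell_var M k s p) \<longleftrightarrow> fst (snd c ! k) (snd (snd c ! k) + int p - int R - 1) = s"
proof
  assume "var_true M R c (cell_var M k s p)"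
  then show "fst (snd c ! k) (snd (snd c ! k) + int p - int R - 1) = s"
    using assms unfolding var_true_def by blast
next
  assume *: "fst (snd c ! k) (snd (snd c ! k) + int p - int R - 1) = s"
  show "var_true M R c (cell_var M k s p)"
    unfolding var_true_def
  proof (intro conjI allI impI)
    fix k' s' p' assume "k' < ntapes M" "s' < nsyms M" "cell_var M k s p = cell_var M k' s' p'"
    then have "k' = k" "s' = s" "p' = p" using assms cell_var_inj by metis+
    then show "fst (snd c ! k') (snd (snd c ! k') + int p' - int R - 1) = s'" using * by simp
  qed simp
qed

text \<open>The premises fix the control state and every scanned symbol, so only rules for the
  context of the step really taken can have true premises.\<close>

lemma premises_true:
  assumes "(q, ss) \<in> set (contexts M)" "config_ok M (q0, ts)"
    and "\<forall>u \<in> set (premise_vars M R q ss). var_true M R (q0, ts) u"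
  shows "q = q0 \<and> ss = scanned ts"
proof
  note ss = contextsD[OF assms(1)]
  show "q = q0" using assms(3) ss by (simp add: var_true_state)
  have "ss ! k = scanned ts ! k" if "k < ntapes M" for k
  proof -
    have "var_true M R (q0, ts) (cell_var M k (ss ! k) (R + 1))" using assms(3) that by simp
    then have "fst (ts ! k) (snd (ts ! k)) = ss ! k" using ss that by (simp add: var_true_cell)
    then show ?thesis using assms(2) that by (simp add: config_ok_def case_prod_beta)
  qed
  moreover have "length ss = length (scanned ts)" using ss(1) assms(2) by (simp add: config_ok_def)
  ultimately show "ss = scanned ts" using ss(1) by (metis nth_equalityI)
qed

text \<open>Cells that leave the window only make fewer variables derivable, so whatever is derived
  remains true. At each stage \<open>premises_true\<close> identifies the rule with the step of the
  machine.\<close>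

lemma derivable_sound:
  assumes "wf_tm M" "derivable (set (tm_rules M (padded c d x))) j v"
  shows "var_true M (length (padded c d x)) (tm_conf M x j) v"
  using assms(2)
proof (induction j arbitrary: v)
  case 0
  let ?w = "padded c d x"
  have M: "start M < nstates M" "3 \<le> nsyms M" "1 \<le> ntapes M" using assms(1) by (simp_all add: wf_tm_def)
  have w: "?w ! i = (if i < length x then bit_sym (x ! i) else 3)" if "i < length ?w" for i
    using that by (auto simp: padded_def nth_append)
  from 0 consider "v = start M" | i k where "i < length ?w" "k < ntapes M" "v = cell_var M k 0 (i + 1)"
    | i k where "i < length ?w" "k < ntapes M"
        "v = cell_var M k (if k = 0 \<and> ?w ! i < 3 then ?w ! i else 0) (length ?w + 1 + i)"
    unfolding derivable.simps Fact_tm_rules by blast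
  then show ?case
  proof cases
    case 1
    then show ?thesis using M by (simp add: var_true_state tm_conf_def tm_init_def)
  next
    case (2 i k)
    then show ?thesis using M
      by (simp add: var_true_cell tm_conf_def tm_init_def nth_Cons' word_tape_def)
  next
    case (3 i k)
    then show ?thesis using M w[of i]
      by (auto simp: var_true_cell tm_conf_def tm_init_def nth_Cons' word_tape_def bit_sym_def)
  qed
next
  case (Suc j)
  let ?R = "length (padded c d x)"
  obtain q0 ts where c0: "tm_conf M x j = (q0, ts)" by fastforce
  obtain q' acts where act: "tm_action M q0 (scanned ts) = (q', acts)" by fastforce
  have ok: "config_ok M (q0, ts)" using config_ok_conf[OF assms(1), of x j] c0 by simp
  have c1: "tm_conf M x (Suc j) = (q', map2 tape_act ts acts)"
    using c0 tm_step_action[of M q0 ts] act by (simp add: tm_conf_def)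
  have awf: "q' < nstates M" "length acts = ntapes M" "fst ` set acts \<subseteq> {..<nsyms M}" "length ts = ntapes M"
    using tm_action_wf[OF assms(1), of q0 "scanned ts"] scanned_ok[OF ok] ok act
    by (auto simp: config_ok_def)
  from Suc.prems obtain us where us: "Rule v us \<in> set (tm_rules M (padded c d x))"
    "\<forall>u\<in>set us. derivable (set (tm_rules M (padded c d x))) j u" by auto
  then have IH: "\<forall>u\<in>set us. var_true M ?R (q0, ts) u" using Suc.IH c0 by auto
  have tape: "map2 tape_act ts acts ! k = ((fst (ts ! k))(snd (ts ! k) := s), snd (ts ! k) + shift m)"
    if "k < ntapes M" "acts ! k = (s, m)" for k s m
    using that awf by (cases "ts ! k") simp
  have sb: "int (backshift m) = 1 - shift m" for m using shift_backshift[of m] by simp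
  have "tm_rule M ?R v us" using us by (simp add: Rule_tm_rulesD)
  then show ?case
  proof cases
    case (ctrl q ss)
    then have "q = q0 \<and> ss = scanned ts" using IH ok by (intro premises_true[of q ss M q0 ts ?R]) auto
    then show ?thesis using ctrl awf act c1 by (simp add: var_true_state)
  next
    case (head q ss k s m)
    then have "q = q0 \<and> ss = scanned ts" using IH ok by (intro premises_true[of q ss M q0 ts ?R]) auto
    then have a: "acts ! k = (s, m)" using head act by simp
    then have "(s, m) \<in> set acts" using awf(2) head(2) by (metis nth_mem)
    then have "s < nsyms M" using awf(3) by force
    then show ?thesis using head(2,4) tape[OF head(2) a] by (simp add: var_true_cell c1 sb)
  next
    case (left q ss k s' m i s)
    then have "q = q0 \<and> ss = scanned ts" using IH ok by (intro premises_true[of q ss M q0 ts ?R]) auto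
    then have a: "acts ! k = (s', m)" using left act by simp
    have "var_true M ?R (q0, ts) (cell_var M k s (1 + i))" using IH left by simp
    then have "fst (ts ! k) (snd (ts ! k) + int i - int ?R) = s"
      using left(2,5) by (simp add: var_true_cell algebra_simps)
    then show ?thesis using left(2,4,5,6) tape[OF left(2) a]
      by (simp add: var_true_cell c1 sb algebra_simps)
  next
    case (right q ss k s' m i s)
    then have "q = q0 \<and> ss = scanned ts" using IH ok by (intro premises_true[of q ss M q0 ts ?R]) auto
    then have a: "acts ! k = (s', m)" using right act by simp
    have "var_true M ?R (q0, ts) (cell_var M k s (2 + ?R + i))" using IH right by simp
    then have "fst (ts ! k) (snd (ts ! k) + 1 + int i) = s"
      using right(2,5) by (simp add: var_true_cell algebra_simps)
    then show ?thesis using right(2,4,5,6) tape[OF right(2) a]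
      by (simp add: var_true_cell c1 sb algebra_simps)
  qed
qed

text \<open>The invariant speaks of cells by their absolute address \<open>head + p - R - 1\<close>
  and asserts derivability for the addresses between \<open>-s\<close> and \<open>s\<close>. The
  head stays among them, so such a cell is at distance at most \<open>2 * s < R\<close> from the
  head and never leaves the window.\<close>

lemma derivable_complete:
  assumes wf: "wf_tm M"
    and space: "\<And>t tp. tp \<in> set (snd (tm_conf M x t)) \<Longrightarrow> \<bar>snd tp\<bar> \<le> int s"
    and R: "2 * s < length (padded c d x)" (is "_ < ?R")
  shows "derivable (set (tm_rules M (padded c d x))) j (fst (tm_conf M x j)) \<and>
    (\<forall>k < ntapes M. \<forall>p. \<bar>snd (snd (tm_conf M x j) ! k) + int p - int ?R - 1\<bar> \<le> int s \<longrightarrow>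
      derivable (set (tm_rules M (padded c d x))) j (cell_var M k
        (fst (snd (tm_conf M x j) ! k) (snd (snd (tm_conf M x j) ! k) + int p - int ?R - 1)) p))"
proof (induction j)
  case 0
  let ?w = "padded c d x"
  have w: "?w ! i = (if i < length x then bit_sym (x ! i) else 3)" if "i < ?R" for i
    using that by (auto simp: padded_def nth_append)
  have "Fact (cell_var M k (if k = 0 then word_tape x (int p - int ?R - 1) else 0) p) \<in> set (tm_rules M ?w)"
    if k: "k < ntapes M" and p: "\<bar>int p - int ?R - 1\<bar> \<le> int s" for k p
  proof (cases "p \<le> ?R")
    case True
    then have "p = (p - 1) + 1" "p - 1 < ?R" using p R by auto
    then show ?thesis
      unfolding Fact_tm_rules using k True
      by (intro disjI2 exI[of _ "p - 1"] conjI exI[of _ k] disjI1) (auto simp: word_tape_def)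
  next
    case False
    define i where "i = p - ?R - 1"
    have i: "p = ?R + 1 + i" "i < ?R" using False p R by (auto simp: i_def)
    have "word_tape x (int p - int ?R - 1) = (if ?w ! i < 3 then ?w ! i else 0)"
      using w[OF i(2)] i by (auto simp: word_tape_def bit_sym_def)
    then show ?thesis
      unfolding Fact_tm_rules using k i by (intro disjI2 exI[of _ i] conjI exI[of _ k]) auto
  qed
  note cell = this
  have tp: "snd (tm_conf M x 0) ! k = (if k = 0 then word_tape x else (\<lambda>_. 0), 0)" if "k < ntapes M" for k
    using that by (simp add: tm_conf_def tm_init_def nth_Cons')
  show ?case
  proof (intro conjI allI impI)
    show "derivable (set (tm_rules M ?w)) 0 (fst (tm_conf M x 0))"
      by (simp add: tm_conf_def tm_init_def Fact_tm_rules)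
  next
    fix k p assume k: "k < ntapes M" and p: "\<bar>snd (snd (tm_conf M x 0) ! k) + int p - int ?R - 1\<bar> \<le> int s"
    show "derivable (set (tm_rules M ?w)) 0 (cell_var M k
        (fst (snd (tm_conf M x 0) ! k) (snd (snd (tm_conf M x 0) ! k) + int p - int ?R - 1)) p)"
      using cell[OF k, of p] p unfolding tp[OF k] by (cases "k = 0") simp_all
  qed
next
  case (Suc j)
  let ?S = "set (tm_rules M (padded c d x))"
  obtain q ts where c0: "tm_conf M x j = (q, ts)" by fastforce
  obtain q' acts where act: "tm_action M q (scanned ts) = (q', acts)" by fastforce
  have ok: "config_ok M (q, ts)" using config_ok_conf[OF wf, of x j] c0 by simp
  have c1: "tm_conf M x (Suc j) = (q', map2 tape_act ts acts)"
    using c0 tm_step_action[of M q ts] act by (simp add: tm_conf_def)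
  have awf: "length acts = ntapes M" "length ts = ntapes M"
    using tm_action_wf[OF wf, of q "scanned ts"] scanned_ok[OF ok] ok act
    by (auto simp: config_ok_def)
  have ctx: "(q, scanned ts) \<in> set (contexts M)"
    using ok scanned_ok[OF ok] by (auto simp: set_contexts config_ok_def)
  have IHc: "derivable ?S j (cell_var M k (fst (ts ! k) (snd (ts ! k) + int p - int ?R - 1)) p)"
    if "k < ntapes M" "\<bar>snd (ts ! k) + int p - int ?R - 1\<bar> \<le> int s" for k p
    using Suc.IH that by (simp add: c0)
  have hd: "\<bar>snd (ts ! k)\<bar> \<le> int s" if "k < ntapes M" for k
    using space[of "ts ! k" j] that awf by (simp add: c0)
  have prem: "derivable ?S j u" if "u \<in> set (premise_vars M ?R q (scanned ts))" for u
  proof -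
    from that consider "u = q" | k where "k < ntapes M" "u = cell_var M k (scanned ts ! k) (?R + 1)" by auto
    then show ?thesis
    proof cases
      case 1
      then show ?thesis using Suc.IH by (simp add: c0)
    next
      case (2 k)
      then show ?thesis using IHc[of k "?R + 1"] hd[of k] awf by (simp add: case_prod_beta)
    qed
  qed
  have derived: "derivable ?S (Suc j) v"
    if "tm_rule M ?R v us" "\<And>u. u \<in> set us \<Longrightarrow> derivable ?S j u" for v us
    using Rule_tm_rulesI[OF that(1)] that(2) by auto
  have "derivable ?S (Suc j) q'"
    using ctx act prem by (intro derived[OF tm_rule.ctrl[of q "scanned ts"]]) auto
  moreover have "derivable ?S (Suc j) (cell_var M k
        (fst (map2 tape_act ts acts ! k) (snd (map2 tape_act ts acts ! k) + int p - int ?R - 1)) p)"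
    if k: "k < ntapes M" and p: "\<bar>snd (map2 tape_act ts acts ! k) + int p - int ?R - 1\<bar> \<le> int s" for k p
  proof -
    obtain f h where fh: "ts ! k = (f, h)" by fastforce
    obtain b m where bm: "acts ! k = (b, m)" by fastforce
    have tape: "map2 tape_act ts acts ! k = (f(h := b), h + shift m)"
      using k awf fh bm by simp
    have sb: "shift m = 1 - int (backshift m)" using shift_backshift[of m] by simp
    \<comment> \<open>The absolute address of the cell that has position \<open>p\<close> after the
      move. Its place relative to the old head \<open>h\<close> decides between the
      \<open>head\<close>, \<open>left\<close> and \<open>right\<close> rules, and its distance from
      \<open>h\<close> gives the loop index.\<close>
    define a where "a = h + int p - int (backshift m) - int ?R"
    have a: "h + shift m + int p - int ?R - 1 = a" by (simp add: a_def sb)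
    have as: "\<bar>a\<bar> \<le> int s" "\<bar>h\<bar> \<le> int s" using p hd[OF k] by (simp_all add: tape a fh)
    have snd_act: "snd (tm_action M q (scanned ts)) ! k = (b, m)" using act bm by simp
    have sym: "f i < nsyms M" for i
      using ok k fh nth_mem[of k ts] by (force simp: config_ok_def)
    consider "a = h" | "a < h" | "a > h" by linarith
    then have "derivable ?S (Suc j) (cell_var M k ((f(h := b)) a) p)"
    proof cases
      case 1
      then have "p = backshift m + ?R" by (simp add: a_def)
      then show ?thesis using 1 prem by (intro derived[OF tm_rule.head[OF ctx k snd_act]]) auto
    next
      case 2
      define i where "i = nat (a - h + int ?R)"
      have i: "int i = a - h + int ?R" using as R by (simp add: i_def)
      have "i < ?R" "p = backshift m + i" using i 2 by (simp_all add: a_def)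
      moreover have "derivable ?S j (cell_var M k (f a) (1 + i))"
        using IHc[OF k, of "1 + i"] as i by (simp add: fh)
      ultimately show ?thesis using 2 prem sym
        by (intro derived[OF tm_rule.left[OF ctx k snd_act, of i _ "f a"]]) auto
    next
      case 3
      define i where "i = nat (a - h - 1)"
      have i: "int i = a - h - 1" using 3 by (simp add: i_def)
      have "i < ?R" "p = 1 + backshift m + ?R + i" using i as R by (simp_all add: a_def)
      moreover have "derivable ?S j (cell_var M k (f a) (2 + ?R + i))"
        using IHc[OF k, of "2 + ?R + i"] as i by (simp add: fh)
      ultimately show ?thesis using 3 prem sym
        by (intro derived[OF tm_rule.right[OF ctx k snd_act, of i _ "f a"]]) auto
    qed
    then show ?thesis by (simp add: tape a)
  qed
  ultimately show ?case by (simp only: c1 fst_conv snd_conv) blast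
qed

lemma tm_conf_halted:
  assumes "halted M (tm_conf M x t)" "t \<le> t'"
  shows "tm_conf M x t' = tm_conf M x t"
  using assms(2)
proof (induction t' rule: dec_induct)
  case (step t')
  obtain q ts where "tm_conf M x t = (q, ts)" by fastforce
  then show ?case using step assms(1) by (simp add: tm_conf_def)
qed simp

text \<open>The stage is a successor because a run of the counter system used later spends at least
  one step in its initial state; idling after acceptance supplies the extra step. Conversely, an
  accepting and a rejecting configuration would both persist, hence meet at a common later
  time.\<close>

lemma tm_rules_correct:
  assumes "wf_tm M" "tm_decides_in_space M L s" "2 * s (length x) < length (padded c d x)"
  shows "x \<in> L \<Longrightarrow> \<exists>j. derivable (set (tm_rules M (padded c d x))) (Suc j) (accept M)"
    and "derivable (set (tm_rules M (padded c d x))) j (accept M) \<Longrightarrow> x \<in> L"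
proof -
  have M: "accept M < nstates M" "accept M \<noteq> reject M" using assms(1) by (auto simp: wf_tm_def)
  have halted_iff: "halted M c \<longleftrightarrow> fst c = accept M \<or> fst c = reject M" for c by (cases c) simp
  show "\<exists>j. derivable (set (tm_rules M (padded c d x))) (Suc j) (accept M)" if "x \<in> L"
  proof -
    have "\<exists>t. fst (tm_conf M x t) = (if x \<in> L then accept M else reject M)"
      using assms(2) unfolding tm_decides_in_space_def by blast
    then obtain t where t: "fst (tm_conf M x t) = accept M"
      using \<open>x \<in> L\<close> by auto
    then have "tm_conf M x (Suc t) = tm_conf M x t"
      by (intro tm_conf_halted) (simp_all add: halted_iff)
    moreover have "derivable (set (tm_rules M (padded c d x))) (Suc t) (fst (tm_conf M x (Suc t)))"
      by (rule conjunct1, rule derivable_complete[OF assms(1) _ assms(3)])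
        (use assms(2) in \<open>auto simp: tm_decides_in_space_def\<close>)
    ultimately show ?thesis using t by auto
  qed
  show "x \<in> L" if "derivable (set (tm_rules M (padded c d x))) j (accept M)"
  proof (rule ccontr)
    assume "x \<notin> L"
    have "\<exists>t. fst (tm_conf M x t) = (if x \<in> L then accept M else reject M)"
      using assms(2) unfolding tm_decides_in_space_def by blast
    then obtain t where t: "fst (tm_conf M x t) = reject M"
      using \<open>x \<notin> L\<close> by auto
    have a: "fst (tm_conf M x j) = accept M"
      using derivable_sound[OF assms(1) that] M(1) by (simp add: var_true_state)
    have "tm_conf M x (max t j) = tm_conf M x t" "tm_conf M x (max t j) = tm_conf M x j"
      using t a by (auto intro!: tm_conf_halted simp: halted_iff)
    then show False using t a M(2) by simp
  qed
qed

text \<open>Rules conclude at positions at most \<open>2 * R + 2\<close>, reached by a left move at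
  the right end of the window. Counting position 0 there are \<open>2 * R + 3\<close> blocks of cell
  variables after the states.\<close>

definition var_limit :: "tm \<Rightarrow> lin" where
  "var_limit M = (nstates M + 3 * (ntapes M * nsyms M), 2 * (ntapes M * nsyms M), 0)"

lemma cell_var_less:
  assumes "k < ntapes M" "s < nsyms M" "p \<le> 2 * R + 2"
  shows "cell_var M k s p < lin_val R i (var_limit M)"
proof -
  have "k * nsyms M + s < Suc k * nsyms M" using assms by simp
  also have "\<dots> \<le> ntapes M * nsyms M" using assms by (intro mult_le_mono1) simp
  finally have "cell_var M k s p < nstates M + ntapes M * nsyms M * Suc p" by (simp add: cell_var_def)
  also have "ntapes M * nsyms M * Suc p \<le> ntapes M * nsyms M * (2 * R + 3)"
    using assms by (intro mult_le_mono2) simp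
  finally show ?thesis by (simp add: var_limit_def algebra_simps)
qed

lemma tm_rules_vars:
  assumes "wf_tm M" "length w = R"
  shows "Fact v \<in> set (tm_rules M w) \<Longrightarrow> v < lin_val R 0 (var_limit M)"
    and "Rule v us \<in> set (tm_rules M w) \<Longrightarrow> v < lin_val R 0 (var_limit M) \<and>
      us \<noteq> [] \<and> (\<forall>u \<in> set us. u < lin_val R 0 (var_limit M))"
proof -
  have M: "start M < nstates M" "3 \<le> nsyms M" using assms(1) by (simp_all add: wf_tm_def)
  have st: "q < nstates M \<Longrightarrow> q < lin_val R 0 (var_limit M)" for q by (simp add: var_limit_def)
  show "v < lin_val R 0 (var_limit M)" if "Fact v \<in> set (tm_rules M w)"
    using that M st[of "start M"] unfolding Fact_tm_rules assms(2)
    by (elim disjE exE conjE) (auto simp del: lin_val.simps intro!: cell_var_less)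
  show "v < lin_val R 0 (var_limit M) \<and> us \<noteq> [] \<and> (\<forall>u \<in> set us. u < lin_val R 0 (var_limit M))"
    if "Rule v us \<in> set (tm_rules M w)"
  proof -
    have prem: "u < lin_val R 0 (var_limit M)"
      if "(q, ss) \<in> set (contexts M)" "u \<in> set (premise_vars M R q ss)" for q ss u
    proof -
      note ss = contextsD[OF that(1)]
      from that(2) consider "u = q" | k where "k < ntapes M" "u = cell_var M k (ss ! k) (R + 1)"
        by auto
      then show ?thesis using ss st by cases (simp_all only:, intro cell_var_less, auto)
    qed
    have b: "backshift m \<le> 2" for m by (cases m) auto
    have b': "backshift m + i \<le> Suc (Suc (R + R))" "backshift m + R \<le> Suc (Suc (R + R))"
      "Suc (backshift m + R + i) \<le> Suc (Suc (R + R))" if "i < R" for m i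
      using b[of m] that by auto
    have act: "fst (tm_action M q ss) < nstates M"
      "k < ntapes M \<Longrightarrow> snd (tm_action M q ss) ! k = (s, m) \<Longrightarrow> s < nsyms M"
      if "(q, ss) \<in> set (contexts M)" for q ss k s m
    proof -
      note a = tm_action_wf[OF assms(1), of q ss]
      show "fst (tm_action M q ss) < nstates M" using a(1) that by (simp add: set_contexts)
      assume k: "k < ntapes M" "snd (tm_action M q ss) ! k = (s, m)"
      then have "(s, m) \<in> set (snd (tm_action M q ss))"
        using a(2) that nth_mem[of k "snd (tm_action M q ss)"] by (simp add: set_contexts)
      then show "s < nsyms M" using a(3) that by (force simp: set_contexts)
    qed
    from Rule_tm_rulesD[OF that] show ?thesis unfolding assms(2)
    proof cases
      case (ctrl q ss)
      then show ?thesis using prem[OF ctrl(1)] act(1)[OF ctrl(1)] st by auto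
    next
      case (head q ss k s m)
      have "v < lin_val R 0 (var_limit M)"
        unfolding head(4) using act(2)[OF head(1-3)] b[of m] head(2) by (intro cell_var_less) auto
      then show ?thesis using prem[OF head(1)] head(5) by auto
    next
      case (left q ss k s' m i s)
      have "v < lin_val R 0 (var_limit M)" "cell_var M k s (1 + i) < lin_val R 0 (var_limit M)"
        unfolding left(6) using b[of m] left by (intro cell_var_less; simp)+
      then show ?thesis using prem[OF left(1)] left(7) by auto
    next
      case (right q ss k s' m i s)
      have "v < lin_val R 0 (var_limit M)" "cell_var M k s (2 + R + i) < lin_val R 0 (var_limit M)"
        unfolding right(6) using b[of m] right by (intro cell_var_less; simp)+
      then show ?thesis using prem[OF right(1)] right(7) by auto
    qed
  qed
qed

section \<open>Alternating automata\<close>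

abbreviation tbits :: "token list \<Rightarrow> bool list" where
  "tbits ts \<equiv> concat (map token_bits ts)"

definition rules_segs :: "(lin rule \<Rightarrow> piece list) \<Rightarrow> tm \<Rightarrow> seg list" where
  "rules_segs f M = [Pieces (concat (map f (fixed_rules M))), Loop (\<lambda>s. concat (map f (loop_rules M s)))]"

lemma pieces_out_concat_map:
  assumes "\<And>r. pieces_out R i (f r) = g (h r)"
  shows "pieces_out R i (concat (map f rs)) = concat (map g (map h rs))"
  by (induction rs) (simp_all add: assms)

lemma concat_map_concat: "concat (map g (concat xss)) = concat (map (\<lambda>xs. concat (map g xs)) xss)"
  by (induction xss) auto

lemma rules_segs_out:
  assumes "\<And>R i r. pieces_out R i (f r) = g (map_rule (lin_val R i) r)"
  shows "concat (map (seg_out w) (rules_segs f M)) = concat (map g (tm_rules M w))"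
proof -
  have out: "pieces_out R i (concat (map f rs)) = concat (map g (map (map_rule (lin_val R i)) rs))" for R i rs
    by (rule pieces_out_concat_map) (rule assms)
  have "concat (map (seg_out w) (rules_segs f M)) =
    concat (map g (map (map_rule (lin_val (length w) 0)) (fixed_rules M))) @
    concat (map (\<lambda>i. concat (map g (map (map_rule (lin_val (length w) i)) (loop_rules M (w ! i))))) [0..<length w])"
    by (simp only: rules_segs_def list.map concat.simps seg_out.simps out append_Nil2)
  then show ?thesis
    by (simp add: tm_rules_def concat_map_concat o_def)
qed

text \<open>The exponent is \<open>Suc v\<close> rather than \<open>v\<close> so that no name is 0,
  the state that accepts everything.\<close>

definition state_name :: "nat \<Rightarrow> nat" where
  "state_name v = 2 ^ Suc v - 1"

lemma digits_ones: "digits (2 ^ v - 1) = replicate v One"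
proof (induction v)
  case 0
  then show ?case by (simp add: digits.simps)
next
  case (Suc v)
  obtain k :: nat where k: "2 ^ v = Suc k" by (cases "2 ^ v :: nat") auto
  then have "odd (2 ^ Suc v - 1 :: nat)" "(2 ^ Suc v - 1) div 2 = (2 ^ v - 1 :: nat)" "(2 ^ Suc v - 1 :: nat) \<noteq> 0"
    by simp_all
  then show ?case using Suc by (subst digits.simps) simp
qed

lemma tokens_enc_nat: "tokens (enc_nat n) = digits n @ [Stop]"
  by (simp add: enc_nat_def)

lemma tokens_state_name: "tokens (enc_nat (state_name v)) = One # replicate v One @ [Stop]"
  using digits_ones[of "Suc v"] by (simp add: tokens_enc_nat state_name_def)

lemma inj_state_name: "state_name u = state_name v \<longleftrightarrow> u = v"
proof
  assume "state_name u = state_name v"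
  then have "digits (2 ^ Suc u - 1) = digits (2 ^ Suc v - 1)" by (simp add: state_name_def)
  then have "length (replicate (Suc u) One) = length (replicate (Suc v) One)" by (simp only: digits_ones)
  then show "u = v" by simp
qed simp

lemma state_name_pos [simp]: "state_name v \<noteq> 0" "0 < state_name v"
  using one_less_power[of "2 :: nat" "Suc v"] by (simp_all add: state_name_def)

definition name_pieces :: "lin \<Rightarrow> piece list" where
  "name_pieces e = [Lit (tbits [One]), Rep e (tbits [One]), Lit (tbits [Stop])]"

lemma name_pieces_out:
  "pieces_out R i (name_pieces e) = tbits (tokens (enc_nat (state_name (lin_val R i e))))"
  by (simp add: name_pieces_def tokens_state_name)

primrec rule_vars :: "'v rule \<Rightarrow> 'v list" where
  "rule_vars (Fact v) = [v]"
| "rule_vars (Rule v us) = v # us"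

text \<open>
  State 0 accepts every word. A state named after \<open>v\<close> accepts the word \<open>{}\<^sup>j {p}\<^sup>\<omega>\<close> iff \<open>v\<close> is
  derivable at stage \<open>j\<close>: the automaton runs the derivation backwards.
\<close>

abbreviation marker :: "sym bexp" where
  "marker \<equiv> BAtom (Prop 0)"

text \<open>State 0 serves as the unit of conjunction, since positive formulae have no constant for
  true.\<close>

definition conj_states :: "nat list \<Rightarrow> nat pbexp" where
  "conj_states us = foldr (\<lambda>u. PAnd (PAtom (state_name u))) us (PAtom 0)"

primrec rule_edge :: "nat rule \<Rightarrow> nat \<times> sym bexp \<times> nat pbexp" where
  "rule_edge (Fact v) = (state_name v, marker, PAtom 0)"
| "rule_edge (Rule v us) = (state_name v, BNot marker, conj_states us)"

definition rules_aba :: "nat rule list \<Rightarrow> nat \<Rightarrow> aba" where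
  "rules_aba rs v0 = \<lparr>aba_states = 0 # state_name v0 # concat (map (\<lambda>r. map state_name (rule_vars r)) rs),
     aba_edges = (0, marker, PAtom 0) # (0, BNot marker, PAtom 0) # map rule_edge rs,
     aba_init = state_name v0, aba_final = [0]\<rparr>"

abbreviation markers :: "sym list list" where
  "markers \<equiv> [[], [Prop 0]]"

lemma letters_markers: "letters markers = Pow {Prop 0}"
  by (auto simp: letters_def)

lemma peval_conj_states: "peval I (conj_states us) \<longleftrightarrow> (\<forall>u \<in> set us. I (state_name u)) \<and> I 0"
  by (induction us) (auto simp: conj_states_def)

lemma set_conj_states: "set_pbexp (conj_states us) = insert 0 (state_name ` set us)"
  by (induction us) (auto simp: conj_states_def)

lemma wf_rules_aba: "wf_aba (letters markers) (syms [0] []) (rules_aba rs v0)"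
proof -
  have *: "q \<in> set (aba_states (rules_aba rs v0)) \<and> set_bexp \<psi> \<subseteq> {Prop 0} \<and>
      set_pbexp \<psi>' \<subseteq> set (aba_states (rules_aba rs v0))"
    if "r \<in> set rs" "rule_edge r = (q, \<psi>, \<psi>')" for r q \<psi> \<psi>'
  proof -
    have st: "state_name ` set (rule_vars r) \<subseteq> set (aba_states (rules_aba rs v0))" "0 \<in> set (aba_states (rules_aba rs v0))"
      using that(1) by (auto simp: rules_aba_def)
    show ?thesis
    proof (cases r)
      case (Fact v)
      then show ?thesis using that(2) st by auto
    next
      case (Rule v us)
      then show ?thesis using that(2) st by (auto simp: set_conj_states image_subset_iff)
    qed
  qed
  have "q \<in> set (aba_states (rules_aba rs v0)) \<and> set_bexp \<psi> \<subseteq> {Prop 0} \<and>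
      set_pbexp \<psi>' \<subseteq> set (aba_states (rules_aba rs v0))"
    if "(q, \<psi>, \<psi>') \<in> set (aba_edges (rules_aba rs v0))" for q \<psi> \<psi>'
  proof -
    from that consider "q = 0" "\<psi> = marker \<or> \<psi> = BNot marker" "\<psi>' = PAtom 0"
      | r where "r \<in> set rs" "rule_edge r = (q, \<psi>, \<psi>')"
      by (auto simp: rules_aba_def)
    then show ?thesis
    proof cases
      case 1
      then show ?thesis by (auto simp: rules_aba_def)
    qed (rule *)
  qed
  moreover have "aba_init (rules_aba rs v0) \<in> set (aba_states (rules_aba rs v0))"
    "set (aba_final (rules_aba rs v0)) \<subseteq> set (aba_states (rules_aba rs v0))"
    by (simp_all add: rules_aba_def)
  moreover have "syms [0] [] = {Prop 0}" by (simp add: syms_def)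
  ultimately show ?thesis
    unfolding wf_aba_def letters_markers by blast
qed

definition stage_word :: "nat \<Rightarrow> letter word" where
  "stage_word t i = (if i < t then {} else {Prop 0})"

lemma delta_sat_zero: "aba_delta_sat (rules_aba rs v0) 0 a P \<longleftrightarrow> 0 \<in> P"
proof
  assume "aba_delta_sat (rules_aba rs v0) 0 a P"
  then obtain \<psi> \<psi>' where e: "(0, \<psi>, \<psi>') \<in> set (aba_edges (rules_aba rs v0))" "peval (\<lambda>p. p \<in> P) \<psi>'"
    unfolding aba_delta_sat_def by blast
  have "rule_edge r \<noteq> (0, \<psi>, \<psi>')" for r by (cases r) auto
  then have "\<psi>' = PAtom 0" using e(1) by (auto simp: rules_aba_def) metis
  then show "0 \<in> P" using e(2) by simp
next
  assume "0 \<in> P"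
  then show "aba_delta_sat (rules_aba rs v0) 0 a P"
    unfolding aba_delta_sat_def rules_aba_def
    by (intro exI[of _ "if Prop 0 \<in> a then marker else BNot marker"] exI[of _ "PAtom 0"]) auto
qed

lemma delta_sat_name:
  "aba_delta_sat (rules_aba rs v0) (state_name v) a P \<longleftrightarrow> 0 \<in> P \<and>
    (if Prop 0 \<in> a then Fact v \<in> set rs
     else \<exists>us. Rule v us \<in> set rs \<and> state_name ` set us \<subseteq> P)" (is "?l \<longleftrightarrow> ?r")
proof
  assume ?l
  then obtain r \<psi> \<psi>' where e: "r \<in> set rs" "rule_edge r = (state_name v, \<psi>, \<psi>')"
    "beval (\<lambda>x. x \<in> a) \<psi>" "peval (\<lambda>p. p \<in> P) \<psi>'"
    unfolding aba_delta_sat_def rules_aba_def by (auto dest: sym)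
  show ?r
  proof (cases r)
    case (Fact v')
    then show ?thesis using e by (auto simp: inj_state_name)
  next
    case (Rule v' us)
    then show ?thesis using e by (auto simp: inj_state_name peval_conj_states)
  qed
next
  assume r: ?r
  have *: "?l" if "r \<in> set rs" "rule_edge r = (state_name v, \<psi>, \<psi>')"
    "beval (\<lambda>x. x \<in> a) \<psi>" "peval (\<lambda>p. p \<in> P) \<psi>'" for r \<psi> \<psi>'
    using that unfolding aba_delta_sat_def rules_aba_def by force
  show ?l
  proof (cases "Prop 0 \<in> a")
    case True
    then show ?thesis using r by (intro *[of "Fact v"]) auto
  next
    case False
    then obtain us where "Rule v us \<in> set rs" "state_name ` set us \<subseteq> P" using r by auto
    then show ?thesis using r False by (intro *[of "Rule v us"]) (auto simp: peval_conj_states image_subset_iff)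
  qed
qed

lemma derivable_imp_var: "derivable (set rs) j v \<Longrightarrow> \<exists>r \<in> set rs. v \<in> set (rule_vars r)"
  by (cases j) force+

text \<open>Run trees whose nodes are addressed by their sequences of states.\<close>

lemma aba_run_from_successors:
  assumes Succ: "\<And>d q. Good d q \<Longrightarrow> Succ d q \<subseteq> Collect (Good (Suc d))"
    and sat: "\<And>d q. Good d q \<Longrightarrow> aba_delta_sat A q (w d) (Succ d q)"
    and states: "\<And>d q. Good d q \<Longrightarrow> q \<in> set (aba_states A)"
    and init: "Good 0 (aba_init A)"
    and final: "\<And>d q. t \<le> d \<Longrightarrow> Succ d q \<subseteq> set (aba_final A)"
  shows "\<exists>T r. aba_run A w T r \<and> aba_accepting A T r"
proof -
  define r where "r x = last (aba_init A # x)" for x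
  \<comment> \<open>An address lists the states met below the root, each one chosen from
    \<open>Succ\<close> at its depth; so the children of a node carry exactly the states of
    \<open>Succ\<close>.\<close>
  define T where "T = {x. \<forall>i < length x. x ! i \<in> Succ i (r (take i x))}"
  have snoc: "x @ [c] \<in> T \<longleftrightarrow> x \<in> T \<and> c \<in> Succ (length x) (r x)" for x c
    by (auto simp: T_def nth_append less_Suc_eq)
  have good: "Good (length x) (r x)" if "x \<in> T" for x
    using that
  proof (induction x rule: rev_induct)
    case Nil
    then show ?case using init by (simp add: r_def)
  next
    case (snoc c x)
    then have "x \<in> T" "c \<in> Succ (length x) (r x)" using \<open>\<And>x c. x @ [c] \<in> T \<longleftrightarrow> _\<close> by blast+
    then show ?case using Succ[of "length x" "r x"] snoc.IH by (auto simp: r_def)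
  qed
  have "{r (x @ [c]) |c. x @ [c] \<in> T} = Succ (length x) (r x)" if "x \<in> T" for x
    using that by (auto simp: snoc) (auto simp: r_def)
  note children = this
  have "aba_run A w T r"
    unfolding aba_run_def
  proof (intro conjI allI ballI impI)
    show "[] \<in> T" "r [] = aba_init A" by (simp_all add: T_def r_def)
    show "x \<in> T" if "x @ [c] \<in> T" for x c using that snoc by blast
    show "r ` T \<subseteq> set (aba_states A)" using good states by blast
    show "aba_delta_sat A (r x) (w (length x)) {r (x @ [c]) |c. x @ [c] \<in> T}" if "x \<in> T" for x
      using sat[OF good[OF that]] children[OF that] by simp
  qed
  moreover have "aba_accepting A T r"
    unfolding aba_accepting_def
  proof (intro allI impI)
    fix \<pi> :: "nat word" assume \<pi>: "\<forall>n. prefix n \<pi> \<in> T"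
    have "r (prefix (Suc n) \<pi>) \<in> set (aba_final A)" if "t \<le> n" for n
    proof -
      have "prefix (Suc n) \<pi> = prefix n \<pi> @ [\<pi> n]" by simp
      then have "\<pi> n \<in> Succ n (r (prefix n \<pi>))" using \<pi> snoc[of "prefix n \<pi>" "\<pi> n"] by (metis subsequence_length diff_zero)
      then show ?thesis using final[OF that] by (auto simp: r_def)
    qed
    then show "\<exists>\<^sub>\<infinity>n. r (prefix n \<pi>) \<in> set (aba_final A)"
      unfolding INFM_nat by (metis le_SucI less_Suc_eq_le nat_le_linear)
  qed
  ultimately show ?thesis by blast
qed

text \<open>At depth \<open>d\<close> the tree contains state 0 or names of variables derivable at
  stage \<open>t - d\<close>. One rule is chosen for each variable and stage, so the successors
  depend on depth and state only.\<close>

lemma stage_word_accepted: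
  assumes "derivable (set rs) t v0"
  shows "stage_word t \<in> aba_lang (letters markers) (rules_aba rs v0)"
proof -
  let ?A = "rules_aba rs v0"
  define choice where "choice j v = (SOME us. Rule v us \<in> set rs \<and> (\<forall>u \<in> set us. derivable (set rs) j u))" for j v
  have choice: "Rule v (choice j v) \<in> set rs \<and> (\<forall>u \<in> set (choice j v). derivable (set rs) j u)"
    if "derivable (set rs) (Suc j) v" for j v
    using that unfolding choice_def derivable.simps by (rule someI_ex)
  \<comment> \<open>The automaton stores names, so \<open>inv state_name\<close> recovers the
    variable. From depth \<open>t\<close> on the only successor is the accepting state 0, which
    makes every infinite branch accepting.\<close>
  define Succ where "Succ d q = (if q = 0 \<or> t \<le> d then {0}
      else insert 0 (state_name ` set (choice (t - Suc d) (inv state_name q))))" for d q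
  define Good where "Good d q \<longleftrightarrow> q = 0 \<or> (\<exists>v. q = state_name v \<and> d \<le> t \<and> derivable (set rs) (t - d) v)" for d q
  have inv: "inv state_name (state_name v) = v" for v
    by (rule inv_f_f) (simp add: inj_def inj_state_name)
  have good: "Succ d q \<subseteq> Collect (Good (Suc d)) \<and> aba_delta_sat ?A q (stage_word t d) (Succ d q)
       \<and> q \<in> set (aba_states ?A)" if g: "Good d q" for d q
    proof (cases "q = 0")
      case True
      moreover have "0 \<in> set (aba_states ?A)" by (simp add: rules_aba_def)
      ultimately show ?thesis by (simp add: Succ_def Good_def delta_sat_zero)
    next
      case False
      with g obtain v where v: "q = state_name v" "d \<le> t" "derivable (set rs) (t - d) v"
        by (auto simp: Good_def)
      have st: "q \<in> set (aba_states ?A)"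
        using derivable_imp_var[OF v(3)] v(1) by (auto simp: rules_aba_def)
      show ?thesis
      proof (cases "d = t")
        case True
        then show ?thesis using v st
          by (simp add: Succ_def Good_def delta_sat_name stage_word_def)
      next
        case False
        then have t: "t - d = Suc (t - Suc d)" "d < t" using v(2) by auto
        have c: "Rule v (choice (t - Suc d) v) \<in> set rs"
          "\<forall>u \<in> set (choice (t - Suc d) v). derivable (set rs) (t - Suc d) u"
          using choice v(3) unfolding t(1) by blast+
        have succ: "Succ d (state_name v) = insert 0 (state_name ` set (choice (t - Suc d) v))"
          using t(2) by (simp add: Succ_def inv)
        have "Good (Suc d) (state_name u)" if "u \<in> set (choice (t - Suc d) v)" for u
          using c(2) that t(2) unfolding Good_def by (intro disjI2 exI[of _ u]) auto
        then have "Succ d q \<subseteq> Collect (Good (Suc d))"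
          unfolding v(1) succ by (auto simp: Good_def[of _ 0])
        moreover have "aba_delta_sat ?A q (stage_word t d) (Succ d q)"
          unfolding v(1) succ delta_sat_name using c(1) t(2) by (auto simp: stage_word_def)
        ultimately show ?thesis using st by blast
      qed
    qed
  have "\<exists>T r. aba_run ?A (stage_word t) T r \<and> aba_accepting ?A T r"
  proof (rule aba_run_from_successors[of Good Succ])
    show "Good 0 (aba_init ?A)" using assms by (auto simp: Good_def rules_aba_def)
    show "\<And>d q. t \<le> d \<Longrightarrow> Succ d q \<subseteq> set (aba_final ?A)" by (simp add: Succ_def rules_aba_def)
  qed (use good in blast)+
  then show ?thesis by (auto simp: aba_lang_def letters_markers stage_word_def)
qed

text \<open>Above depth \<open>t\<close> the run tree contains a derivation: by induction on the
  number \<open>k\<close> of empty letters still to be read, a node named after \<open>v\<close>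
  shows that \<open>v\<close> is derivable at stage \<open>k\<close>.\<close>

lemma stage_word_rejected:
  assumes "stage_word t \<in> aba_lang \<Sigma> (rules_aba rs v0)"
  shows "derivable (set rs) t v0"
proof -
  let ?A = "rules_aba rs v0"
  obtain T r where run: "aba_run ?A (stage_word t) T r" using assms by (auto simp: aba_lang_def)
  have "derivable (set rs) k v" if "x \<in> T" "length x + k = t" "r x = state_name v" for k x v
    using that
  proof (induction k arbitrary: x v)
    case 0
    then have "aba_delta_sat ?A (state_name v) (stage_word t t) {r (x @ [c]) |c. x @ [c] \<in> T}"
      using run unfolding aba_run_def by force
    then show ?case by (simp add: delta_sat_name stage_word_def)
  next
    case (Suc k)
    then have "aba_delta_sat ?A (state_name v) {} {r (x @ [c]) |c. x @ [c] \<in> T}"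
      using run unfolding aba_run_def by (force simp: stage_word_def)
    then obtain us where us: "Rule v us \<in> set rs" "state_name ` set us \<subseteq> {r (x @ [c]) |c. x @ [c] \<in> T}"
      by (auto simp: delta_sat_name)
    have "derivable (set rs) k u" if "u \<in> set us" for u
    proof -
      from us(2) that obtain c where "x @ [c] \<in> T" "r (x @ [c]) = state_name u" by auto
      then show ?thesis using Suc.prems by (intro Suc.IH) auto
    qed
    then show ?case using us(1) by auto
  qed
  from this[of "[]" t v0] show ?thesis using run by (simp add: aba_run_def rules_aba_def)
qed

text \<open>Without the marker no fact can be used, and every rule has a premise, so each named
  state has a named child. Following such children gives an infinite branch that avoids 0, the only
  accepting state. The counter system can produce this word by never leaving its initial
  state.\<close>

lemma empty_word_rejected:
  assumes "\<And>v us. Rule v us \<in> set rs \<Longrightarrow> us \<noteq> []"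
  shows "(\<lambda>_. {}) \<notin> aba_lang \<Sigma> (rules_aba rs v0)"
proof
  let ?A = "rules_aba rs v0"
  assume "(\<lambda>_. {}) \<in> aba_lang \<Sigma> ?A"
  then obtain T r where run: "aba_run ?A (\<lambda>_. {}) T r" and acc: "aba_accepting ?A T r"
    by (auto simp: aba_lang_def)
  have step: "\<exists>c. x @ [c] \<in> T \<and> r (x @ [c]) \<noteq> 0" if x: "x \<in> T" "r x \<noteq> 0" for x
  proof -
    have "r x \<in> set (aba_states ?A)" using run that unfolding aba_run_def by blast
    then obtain v where v: "r x = state_name v" using x(2) by (auto simp: rules_aba_def)
    then have "aba_delta_sat ?A (state_name v) {} {r (x @ [c]) |c. x @ [c] \<in> T}"
      using run that unfolding aba_run_def by force
    then obtain us where us: "Rule v us \<in> set rs" "state_name ` set us \<subseteq> {r (x @ [c]) |c. x @ [c] \<in> T}"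
      by (auto simp: delta_sat_name)
    with assms obtain u where "u \<in> set us" by (cases us) auto
    with us(2) obtain c where "x @ [c] \<in> T" "r (x @ [c]) = state_name u" by auto
    then show ?thesis by (intro exI[of _ c]) simp
  qed
  define next_child where "next_child x = (SOME c. x @ [c] \<in> T \<and> r (x @ [c]) \<noteq> 0)" for x
  define path where "path = rec_nat [] (\<lambda>_ x. x @ [next_child x])"
  define \<pi> where "\<pi> n = next_child (path n)" for n
  have path: "prefix n \<pi> = path n" for n
    by (induction n) (simp_all add: path_def \<pi>_def)
  have "path n \<in> T \<and> r (path n) \<noteq> 0" for n
  proof (induction n)
    case 0
    then show ?case using run by (simp add: path_def aba_run_def rules_aba_def)
  next
    case (Suc n)
    then show ?case using someI_ex[OF step[of "path n"]] by (simp add: path_def next_child_def)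
  qed
  then have "\<forall>n. prefix n \<pi> \<in> T" "\<forall>n. r (prefix n \<pi>) \<noteq> 0" by (simp_all only: path) auto
  moreover from this have "\<exists>\<^sub>\<infinity>n. r (prefix n \<pi>) \<in> set (aba_final ?A)"
    using acc unfolding aba_accepting_def by blast
  then have "\<exists>n. r (prefix n \<pi>) \<in> set (aba_final ?A)" by (rule INFM_EX)
  then obtain n where "r (prefix n \<pi>) = 0" by (auto simp: rules_aba_def)
  ultimately show False by metis
qed

section \<open>Printing the automaton\<close>

definition atom_pieces :: "lin \<Rightarrow> piece list" where
  "atom_pieces e = Lit (tbits (Open # tokens (Num 0))) # name_pieces e @ [Lit (tbits [Close])]"

definition conj_pieces :: "lin list \<Rightarrow> piece list" where
  "conj_pieces es = foldr (\<lambda>e ps. Lit (tbits (Open # tokens (Num 1))) # atom_pieces e @ ps @ [Lit (tbits [Close])])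
     es [Lit (serialize (enc_pbexp enc_nat (PAtom 0)))]"

lemma conj_pieces_out:
  "pieces_out R i (conj_pieces es) = serialize (enc_pbexp enc_nat (conj_states (map (lin_val R i) es)))"
  by (induction es)
    (simp_all add: conj_pieces_def conj_states_def serialize_def atom_pieces_def name_pieces_out)

primrec edge_pieces :: "lin rule \<Rightarrow> piece list" where
  "edge_pieces (Fact e) = Lit (tbits [Open]) # name_pieces e @
     [Lit (serialize (enc_bexp enc_sym marker) @ serialize (enc_pbexp enc_nat (PAtom 0)) @ tbits [Close])]"
| "edge_pieces (Rule e es) = Lit (tbits [Open]) # name_pieces e @
     Lit (serialize (enc_bexp enc_sym (BNot marker))) # conj_pieces es @ [Lit (tbits [Close])]"

lemma edge_pieces_out:
  "pieces_out R i (edge_pieces r) = serialize (enc_aba_edge (rule_edge (map_rule (lin_val R i) r)))"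
  by (cases r) (simp_all add: name_pieces_out conj_pieces_out, simp_all add: serialize_def)

definition state_pieces :: "lin rule \<Rightarrow> piece list" where
  "state_pieces r = concat (map name_pieces (rule_vars r))"

lemma rule_vars_map: "rule_vars (map_rule f r) = map f (rule_vars r)"
  by (cases r) auto

lemma state_pieces_out:
  "pieces_out R i (state_pieces r) =
     concat (map (\<lambda>v. serialize (enc_nat (state_name v))) (rule_vars (map_rule (lin_val R i) r)))"
proof -
  have "pieces_out R i (concat (map name_pieces es)) =
      concat (map (\<lambda>e. serialize (enc_nat (state_name (lin_val R i e)))) es)" for es
    by (induction es) (simp_all add: name_pieces_out serialize_def)
  then show ?thesis by (simp add: state_pieces_def rule_vars_map o_def)
qed

definition aba_segs :: "sexp list \<Rightarrow> tm \<Rightarrow> seg list" where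
  "aba_segs ts M =
     [Pieces [Lit (tbits (Open # concat (map tokens ts) @ [Open, Open]) @
        serialize (enc_nat 0) @ serialize (enc_nat (state_name (accept M))))]] @
     rules_segs state_pieces M @
     [Pieces [Lit (tbits [Close, Open] @ serialize (enc_aba_edge (0, marker, PAtom 0)) @
        serialize (enc_aba_edge (0, BNot marker, PAtom 0)))]] @
     rules_segs edge_pieces M @
     [Pieces [Lit (tbits [Close] @ serialize (enc_nat (state_name (accept M))) @
        serialize (enc_list enc_nat [0]) @ tbits [Close, Close])]]"

lemma tbits_concat_map: "tbits (concat (map tokens ts)) = concat (map serialize ts)"
  by (induction ts) (simp_all add: serialize_def)

lemma aba_segs_out:
  "concat (map (seg_out w) (aba_segs ts M)) =
   serialize (Node (ts @ [enc_aba (rules_aba (tm_rules M w) (accept M))]))"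
proof -
  have 1: "concat (map (seg_out w) (rules_segs state_pieces M)) =
      tbits (concat (map tokens (map enc_nat
        (concat (map (\<lambda>r. map state_name (rule_vars r)) (tm_rules M w))))))"
    unfolding rules_segs_out[OF state_pieces_out] tbits_concat_map
    by (simp add: concat_map_concat o_def)
  have 2: "concat (map (seg_out w) (rules_segs edge_pieces M)) =
      tbits (concat (map tokens (map enc_aba_edge (map rule_edge (tm_rules M w)))))"
    unfolding rules_segs_out[OF edge_pieces_out] tbits_concat_map by (simp add: o_def)
  show ?thesis
    unfolding aba_segs_def map_append concat_append 1 2
    by (simp add: serialize_def enc_aba_def rules_aba_def enc_list_def)
qed

text \<open>The atomic guard \<open>0 >= 0\<close>, in place of a constant for true.\<close>

definition true_guard :: "nat \<Rightarrow> guard" where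
  "true_guard n = BAtom (AGuard (replicate n 0) Ge 0)"

lemma true_guard: "true_guard n \<in> guards n" "sat_guard v (true_guard n)"
  by (simp_all add: true_guard_def guards_def aguards_def sat_guard_def sat_aguard_def)

definition stage_cps :: cps where
  "stage_cps = \<lparr>segs = [([], [[]])], final_path = [], final_loop = [[Prop 0]], constr = true_guard 1\<rparr>"

lemma wf_stage_cps: "wf_cps (letters markers) stage_cps"
  by (auto simp: wf_cps_def stage_cps_def letters_def true_guard)

lemma stage_cps_lang: "cps_lang stage_cps = range stage_word"
proof -
  have unfold: "unfold_segs [([], [[]])] [n] = replicate n {}" for n
    by (induction n) (simp_all add: unfold_segs_def)
  have w: "replicate n {} \<frown> [{Prop 0}]\<^sup>\<omega> = stage_word n" for n
    by (auto simp: conc_def iter_def stage_word_def fun_eq_iff)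
  have "cps_lang stage_cps = {unfold_segs [([], [[]])] ns \<frown> [{Prop 0}]\<^sup>\<omega> |ns. length ns = 1}"
    by (simp add: cps_lang_def stage_cps_def true_guard)
  also have "\<dots> = {unfold_segs [([], [[]])] [n] \<frown> [{Prop 0}]\<^sup>\<omega> |n. True}"
    by (auto simp: length_Suc_conv)
  also have "\<dots> = range stage_word" unfolding unfold w by auto
  finally show ?thesis .
qed

text \<open>The common frame of the four reductions: for a machine and a padding one template must
  be found that works on all inputs. The template is the same for every language and space bound, so
  only its correctness remains to be shown.\<close>

lemma PSPACE_hardI:
  assumes "\<And>M c d. wf_tm M \<Longrightarrow> \<exists>ss. \<forall>x. (\<forall>L s. tm_decides_in_space M L s \<longrightarrow>
      2 * s (length x) < length (padded c d x) \<longrightarrow>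
      (x \<in> L \<longleftrightarrow> concat (map (seg_out (padded c d x)) ss) \<in> K))"
  shows "PSPACE_hard K"
  unfolding PSPACE_hard_def
proof
  fix L assume "L \<in> PSPACE"
  then obtain M s where M: "wf_tm M" "poly_bounded s" "tm_decides_in_space M L s"
    by (auto simp: PSPACE_def)
  obtain c d where s: "\<And>n. s n \<le> c * Suc n ^ d"
    using M(2) by (rule poly_boundedE) blast
  \<comment> \<open>The factor \<open>2 * c + 1\<close> is chosen so that the padding alone exceeds
    twice the space bound strictly.\<close>
  have len: "2 * s (length x) < length (padded (2 * c + 1) d x)" for x
  proof -
    have "2 * s (length x) \<le> 2 * (c * Suc (length x) ^ d)" using s[of "length x"] by simp
    also have "\<dots> < (2 * c + 1) * Suc (length x) ^ d" by (simp add: algebra_simps)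
    finally show ?thesis by (simp add: padded_def)
  qed
  obtain ss where ss: "\<And>x. x \<in> L \<longleftrightarrow> concat (map (seg_out (padded (2 * c + 1) d x)) ss) \<in> K"
    using assms[OF M(1), of "2 * c + 1" d] M(3) len by metis
  then show "poly_reducible L K"
    unfolding poly_reducible_def using segs_poly_time by blast
qed

text \<open>A problem contains a string if some decoding of it is a positive instance; injectivity
  makes the printed instance the only decoding.\<close>

lemma serialize_Node_inj: "serialize (Node ss) = serialize (Node ts) \<longleftrightarrow> ss = ts"
  using inj_serialize by (auto dest: injD)

lemma INTERSECT_ABA_hard: "PSPACE_hard INTERSECT_ABA"
proof (rule PSPACE_hardI)
  fix M :: tm and c d assume M: "wf_tm M"
  let ?ts = "[enc_nat 0, enc_list enc_nat [0], enc_list enc_aguard [], enc_word markers, enc_cps stage_cps]"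
  have "x \<in> L \<longleftrightarrow> concat (map (seg_out (padded c d x)) (aba_segs ?ts M)) \<in> INTERSECT_ABA"
    if "tm_decides_in_space M L s" "2 * s (length x) < length (padded c d x)" for x L s
  proof -
    let ?A = "rules_aba (tm_rules M (padded c d x)) (accept M)"
    have "x \<in> L \<longleftrightarrow> (\<exists>t. derivable (set (tm_rules M (padded c d x))) t (accept M))"
      using tm_rules_correct[OF M that] by blast
    also have "\<dots> \<longleftrightarrow> cps_lang stage_cps \<inter> aba_lang (letters markers) ?A \<noteq> {}"
      unfolding stage_cps_lang using stage_word_accepted stage_word_rejected by blast
    also have "\<dots> \<longleftrightarrow> serialize (Node (?ts @ [enc_aba ?A])) \<in> INTERSECT_ABA"
      using wf_rules_aba[of "tm_rules M (padded c d x)" "accept M"] wf_stage_cps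
      unfolding INTERSECT_ABA_def serialize_Node_inj mem_Collect_eq
      by (auto simp: wf_calph_def letters_markers syms_def inj_eq[OF inj_enc_cps] inj_eq[OF inj_enc_aba])
    finally show ?thesis unfolding aba_segs_out .
  qed
  then show "\<exists>ss. \<forall>x. (\<forall>L s. tm_decides_in_space M L s \<longrightarrow> 2 * s (length x) < length (padded c d x) \<longrightarrow>
      (x \<in> L \<longleftrightarrow> concat (map (seg_out (padded c d x)) ss) \<in> INTERSECT_ABA))"
    by blast
qed

text \<open>Control states never decrease along a transition, so they are constant around a cycle.
  All its edges are then self-loops at one state, hence equal, and a cycle without repeated edges
  has length 1.\<close>

lemma simple_cycle_self_loop:
  assumes cycle: "simple_cycle S es" and mono: "\<And>e. e \<in> set (transitions S) \<Longrightarrow> src e \<le> tgt e"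
    and loops: "\<And>e e'. e \<in> set (transitions S) \<Longrightarrow> e' \<in> set (transitions S) \<Longrightarrow> src e = tgt e \<Longrightarrow>
      src e' = tgt e' \<Longrightarrow> src e = src e' \<Longrightarrow> e = e'"
  shows "\<exists>e \<in> set (transitions S). es = [e] \<and> src e = tgt e"
proof -
  define L where "L = length es"
  \<comment> \<open>The sources along the cycle, continued periodically: \<open>s\<close> is
    monotone and \<open>s L = s 0\<close>, hence constant up to \<open>L\<close>.\<close>
  define s where "s n = src (es ! (n mod L))" for n
  have L: "0 < L" and es: "set es \<subseteq> set (transitions S)" "distinct es"
    using cycle by (auto simp: simple_cycle_def L_def)
  have tgt: "tgt (es ! (n mod L)) = s (Suc n)" for n
    using cycle L by (simp add: simple_cycle_def s_def L_def mod_Suc_eq)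
  have in_trans: "es ! (n mod L) \<in> set (transitions S)" for n
    using es(1) L nth_mem[of "n mod L" es] by (auto simp: L_def)
  have "s n \<le> s (Suc n)" for n using mono[OF in_trans] tgt by (simp add: s_def)
  then have s_mono: "s m \<le> s n" if "m \<le> n" for m n using that by (rule lift_Suc_mono_le)
  have "s L = s 0" by (simp add: s_def)
  then have const: "s n = s 0" if "n \<le> L" for n
    using s_mono[of 0 n] s_mono[of n L] that by simp
  have same: "es ! n = es ! 0" if "n < L" for n
  proof (rule loops)
    show "es ! n \<in> set (transitions S)" "es ! 0 \<in> set (transitions S)"
      using in_trans[of n] in_trans[of 0] that by simp_all
    show "src (es ! n) = tgt (es ! n)" "src (es ! 0) = tgt (es ! 0)" "src (es ! n) = src (es ! 0)"
      using const[of n] const[of "Suc n"] const[of 1] tgt[of n] tgt[of 0] that L by (simp_all add: s_def)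
  qed
  have "L = 1"
  proof (rule ccontr)
    assume "L \<noteq> 1"
    then have "1 < L" using L by simp
    then have "es ! 1 \<noteq> es ! 0" using nth_eq_iff_index_eq[OF es(2), of 1 0] L by (auto simp: L_def)
    then show False using same[OF \<open>1 < L\<close>] by simp
  qed
  then obtain e where e: "es = [e]" unfolding L_def by (metis One_nat_def length_0_conv length_Suc_conv)
  then show ?thesis using cycle by (auto simp: simple_cycle_def)
qed

lemma flat_if_monotone:
  assumes "\<And>e. e \<in> set (transitions S) \<Longrightarrow> src e \<le> tgt e"
    and loops: "\<And>e e'. e \<in> set (transitions S) \<Longrightarrow> e' \<in> set (transitions S) \<Longrightarrow> src e = tgt e \<Longrightarrow>
      src e' = tgt e' \<Longrightarrow> src e = src e' \<Longrightarrow> e = e'"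
  shows "flat S"
  unfolding flat_def
proof (intro ballI allI impI, elim conjE)
  fix q es es' assume c: "simple_cycle S es" "q \<in> src ` set es" "simple_cycle S es'" "q \<in> src ` set es'"
  obtain e e' where "e \<in> set (transitions S)" "es = [e]" "src e = tgt e"
    "e' \<in> set (transitions S)" "es' = [e']" "src e' = tgt e'"
    using simple_cycle_self_loop[OF c(1) assms] simple_cycle_self_loop[OF c(3) assms] by blast
  then have "es' = rotate 0 es" using loops[of e e'] c(2,4) by simp
  then show "\<exists>n. es' = rotate n es" ..
qed

text \<open>Its runs from state 0 yield the words \<open>stage_word t\<close> with
  \<open>t > 0\<close>, and in addition the word of empty letters if state 0 is never left.\<close>

definition stage_system :: counter_system where
  "stage_system = \<lparr>dim = 0, ctrl = [(0, []), (1, [0])],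
     transitions = [(0, true_guard 0, [], 0), (0, true_guard 0, [], 1), (1, true_guard 0, [], 1)]\<rparr>"

lemma wf_stage_system: "wf_cs stage_system" "flat stage_system" "(0, []) \<in> configs stage_system"
proof -
  show "wf_cs stage_system" "(0, []) \<in> configs stage_system"
    by (auto simp: stage_system_def wf_cs_def configs_def states_def true_guard)
  show "flat stage_system"
    by (rule flat_if_monotone) (auto simp: stage_system_def src_def tgt_def)
qed

lemma label_stage_system: "label stage_system 0 = {}" "label stage_system 1 = {0}"
  by (auto simp: stage_system_def label_def)

lemma step_stage_system:
  "cs_step stage_system c c' \<longleftrightarrow> snd c = [] \<and> snd c' = [] \<and> fst c \<le> fst c' \<and> fst c' \<le> 1"
  by (cases c; cases c')
    (auto simp: cs_step_def stage_system_def configs_def states_def true_guard)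

lemma stage_system_run:
  "0 < t \<Longrightarrow> is_run stage_system (0, []) (\<lambda>i. (if i < t then 0 else 1, []))"
  by (simp add: is_run_def step_stage_system)

lemma run_sat_stage_system:
  "run_sat stage_system [0] [] (\<lambda>i. (if i < t then 0 else 1, [])) (stage_word t)"
  using label_stage_system by (auto simp: run_sat_def stage_word_def)

lemma stage_system_words:
  assumes run: "is_run stage_system (0, []) \<rho>" and sat: "run_sat stage_system [0] [] \<rho> w"
    and w: "range w \<subseteq> Pow {Prop 0}"
  shows "w = (\<lambda>_. {}) \<or> (\<exists>t. w = stage_word t)"
proof -
  have step: "fst (\<rho> i) \<le> fst (\<rho> (Suc i))" "fst (\<rho> i) \<le> 1" for i
    using run unfolding is_run_def step_stage_system by (meson le_trans)+
  have mono: "fst (\<rho> i) \<le> fst (\<rho> j)" if "i \<le> j" for i j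
    using step(1) that by (rule lift_Suc_mono_le)
  have letter: "w i = (if fst (\<rho> i) = 0 then {} else {Prop 0})" for i
  proof -
    have "w i \<subseteq> {Prop 0}" using w by auto
    moreover have "Prop 0 \<in> w i \<longleftrightarrow> 0 \<in> label stage_system (fst (\<rho> i))"
      using sat by (simp add: run_sat_def)
    moreover have "fst (\<rho> i) = 0 \<or> fst (\<rho> i) = 1" using step(2)[of i] by linarith
    ultimately show ?thesis using label_stage_system by auto
  qed
  show ?thesis
  proof (cases "\<exists>i. fst (\<rho> i) \<noteq> 0")
    case True
    define t where "t = (LEAST i. fst (\<rho> i) \<noteq> 0)"
    have t: "fst (\<rho> t) \<noteq> 0" using True unfolding t_def by (rule LeastI_ex)
    have "fst (\<rho> i) = 0 \<longleftrightarrow> i < t" for i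
      using not_less_Least[of i "\<lambda>i. fst (\<rho> i) \<noteq> 0"] t mono[of t i] unfolding t_def[symmetric]
      by (metis le_zero_eq not_le)
    then have "w = stage_word t" by (auto simp: letter stage_word_def fun_eq_iff)
    then show ?thesis by blast
  next
    case False
    then show ?thesis by (auto simp: letter fun_eq_iff)
  qed
qed

lemma MC_ABA_hard: "PSPACE_hard MC_ABA_CFS"
proof (rule PSPACE_hardI)
  fix M :: tm and c d assume M: "wf_tm M"
  let ?ts = "[enc_cs stage_system, enc_config (0, []), enc_list enc_nat [0], enc_list enc_aguard [],
    enc_word markers]"
  have "x \<in> L \<longleftrightarrow> concat (map (seg_out (padded c d x)) (aba_segs ?ts M)) \<in> MC_ABA_CFS"
    if L: "tm_decides_in_space M L s" "2 * s (length x) < length (padded c d x)" for x L s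
  proof -
    let ?A = "rules_aba (tm_rules M (padded c d x)) (accept M)"
    have "x \<in> L \<longleftrightarrow> mc_holds stage_system (0, []) [0] [] (aba_lang (letters markers) ?A)"
    proof
      assume "x \<in> L"
      then obtain j where "derivable (set (tm_rules M (padded c d x))) (Suc j) (accept M)"
        using tm_rules_correct(1)[OF M L] by blast
      then show "mc_holds stage_system (0, []) [0] [] (aba_lang (letters markers) ?A)"
        using stage_system_run[of "Suc j"] run_sat_stage_system[of "Suc j"] stage_word_accepted
        unfolding mc_holds_def by blast
    next
      assume "mc_holds stage_system (0, []) [0] [] (aba_lang (letters markers) ?A)"
      then obtain \<rho> w where w: "is_run stage_system (0, []) \<rho>" "run_sat stage_system [0] [] \<rho> w"
        "w \<in> aba_lang (letters markers) ?A" by (auto simp: mc_holds_def)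
      have "(\<lambda>_. {}) \<notin> aba_lang (letters markers) ?A"
        by (rule empty_word_rejected) (use tm_rules_vars(2)[OF M refl] in blast)
      moreover have "range w \<subseteq> Pow {Prop 0}" using w(3) by (auto simp: aba_lang_def letters_markers)
      ultimately obtain t where "w = stage_word t" using stage_system_words[OF w(1,2)] w(3) by blast
      then show "x \<in> L" using stage_word_rejected w(3) tm_rules_correct(2)[OF M L] by blast
    qed
    also have "\<dots> \<longleftrightarrow> serialize (Node (?ts @ [enc_aba ?A])) \<in> MC_ABA_CFS"
      using wf_rules_aba[of "tm_rules M (padded c d x)" "accept M"] wf_stage_system
      unfolding MC_ABA_CFS_def serialize_Node_inj mem_Collect_eq
      by (auto simp del: enc_config.simps simp: wf_calph_def letters_markers syms_def
        inj_eq[OF inj_enc_cs] inj_eq[OF inj_enc_config] inj_eq[OF inj_enc_aba])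
    finally show ?thesis unfolding aba_segs_out .
  qed
  then show "\<exists>ss. \<forall>x. (\<forall>L s. tm_decides_in_space M L s \<longrightarrow> 2 * s (length x) < length (padded c d x) \<longrightarrow>
      (x \<in> L \<longleftrightarrow> concat (map (seg_out (padded c d x)) ss) \<in> MC_ABA_CFS))"
    by blast
qed

section \<open>Linear mu-calculus\<close>

text \<open>The least fixed point of the identity. The instances use no symbols at all, so truth
  values must come from the fixed points themselves.\<close>

definition mfalse :: mu where "mfalse = MLfp 3 (MVar 3)"

definition mor :: "mu \<Rightarrow> mu \<Rightarrow> mu" where "mor a b = MNot (MAnd (MNot a) (MNot b))"

definition mfirst :: mu where "mfirst = MNot (MPrev (MNot mfalse))"

abbreviation mprevs :: "nat \<Rightarrow> mu \<Rightarrow> mu" where "mprevs n \<equiv> MPrev ^^ n"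

abbreviation mnexts :: "nat \<Rightarrow> mu \<Rightarrow> mu" where "mnexts n \<equiv> MNext ^^ n"

text \<open>
  Positions are divided into blocks of length \<open>N\<close>. The least fixed point \<open>mderivable\<close> contains the
  position \<open>j * N + v\<close> iff \<open>v\<close> is derivable at stage \<open>j\<close>. A rule is evaluated at the start of a
  block: variable \<open>u\<close> of the previous block is reached by \<open>N\<close> steps back and \<open>u\<close> steps forward.
\<close>

definition mblock :: "nat \<Rightarrow> mu" where
  "mblock N = MLfp 1 (mor mfirst (mprevs N (MVar 1)))"

text \<open>The \<open>N\<close> steps back are innermost, so they form one shared subformula and
  each premise adds only about \<open>u\<close> nodes. The conjunction of a formula with itself,
  here and in \<open>mrule\<close>, is a copy operation: a node \<open>NAnd k k\<close> puts the
  formula named \<open>k\<close> under a new name, where it can be extended without losing the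
  original.\<close>

definition mpremise :: "nat \<Rightarrow> mu \<Rightarrow> nat \<Rightarrow> mu" where
  "mpremise N \<phi> u = MAnd \<phi> (mnexts u (MAnd (mprevs N (MVar 0)) (mprevs N (MVar 0))))"

primrec mrule :: "nat \<Rightarrow> nat rule \<Rightarrow> mu" where
  "mrule N (Fact v) = mprevs v (MAnd mfirst mfirst)"
| "mrule N (Rule v us) = mprevs v (foldl (mpremise N) (MAnd (mblock N) (mblock N)) us)"

definition mderivable :: "nat \<Rightarrow> nat rule list \<Rightarrow> mu" where
  "mderivable N rs = MLfp 0 (foldl (\<lambda>\<phi> r. mor \<phi> (mrule N r)) mfalse rs)"

text \<open>The fixed point over variable 2 says "eventually"; \<open>mblock N\<close> restricts the
  search to block starts, from which \<open>v0\<close> steps lead to the position of variable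
  \<open>v0\<close>.\<close>

definition mgoal :: "nat \<Rightarrow> nat rule list \<Rightarrow> nat \<Rightarrow> mu" where
  "mgoal N rs v0 = MLfp 2 (mor (MAnd (mblock N) (mnexts v0 (mderivable N rs))) (MNext (MVar 2)))"

text \<open>Asks more than well-formedness does: no free variable at all occurs negatively. This is
  preserved by all constructors used here, where negations only come from \<open>mor\<close> and
  \<open>mfirst\<close>; the absence of symbols permits an empty alphabet.\<close>

definition positive_in :: "nat set \<Rightarrow> mu \<Rightarrow> bool" where
  "positive_in F \<phi> \<longleftrightarrow> mu_free \<phi> \<subseteq> F \<and> (\<forall>s. MSym s \<notin> mu_subs \<phi>) \<and>
     (\<forall>z \<psi>. MLfp z \<psi> \<in> mu_subs \<phi> \<longrightarrow> \<not> mu_occ False z \<psi>) \<and> (\<forall>z. \<not> mu_occ False z \<phi>)"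

lemma positive_in_intros:
  "z \<in> F \<Longrightarrow> positive_in F (MVar z)"
  "positive_in F a \<Longrightarrow> positive_in F b \<Longrightarrow> positive_in F (MAnd a b)"
  "positive_in F a \<Longrightarrow> positive_in F b \<Longrightarrow> positive_in F (mor a b)"
  "positive_in F a \<Longrightarrow> positive_in F (MNext a)"
  "positive_in F a \<Longrightarrow> positive_in F (MPrev a)"
  "positive_in (insert z F) a \<Longrightarrow> positive_in F (MLfp z a)"
  "positive_in F mfalse" "positive_in F mfirst"
  by (auto simp: positive_in_def mor_def mfalse_def mfirst_def)

lemma positive_in_iterate:
  "positive_in F a \<Longrightarrow> positive_in F (mnexts n a)" "positive_in F a \<Longrightarrow> positive_in F (mprevs n a)"
  by (induction n) (auto intro: positive_in_intros)

lemma positive_in_mblock: "positive_in F (mblock N)"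
  unfolding mblock_def by (intro positive_in_intros positive_in_iterate) simp

lemma positive_in_mrule: "positive_in {0} (mrule N r)"
proof (cases r)
  case (Rule v us)
  have "positive_in {0} (foldl (mpremise N) \<phi> us)" if "positive_in {0} \<phi>" for \<phi>
    using that
  proof (induction us arbitrary: \<phi>)
    case (Cons u us)
    have "positive_in {0} (mpremise N \<phi> u)"
      unfolding mpremise_def by (intro positive_in_intros positive_in_iterate Cons.prems) simp_all
    then show ?case using Cons.IH by simp
  qed simp
  note fold = this
  show ?thesis
    unfolding Rule mrule.simps by (intro positive_in_iterate fold positive_in_intros positive_in_mblock)
next
  case (Fact v)
  show ?thesis unfolding Fact mrule.simps by (intro positive_in_iterate positive_in_intros)
qed

lemma wf_mgoal: "wf_mu X (mgoal N rs v0)"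
proof -
  have "positive_in {0} (foldl (\<lambda>\<phi> r. mor \<phi> (mrule N r)) \<phi> rs)" if "positive_in {0} \<phi>" for \<phi>
    using that
  proof (induction rs arbitrary: \<phi>)
    case (Cons r rs)
    have "positive_in {0} (mor \<phi> (mrule N r))"
      by (intro positive_in_intros positive_in_mrule Cons.prems)
    then show ?case using Cons.IH by simp
  qed simp
  then have "positive_in {0} (foldl (\<lambda>\<phi> r. mor \<phi> (mrule N r)) mfalse rs)"
    by (blast intro: positive_in_intros)
  moreover have "positive_in F \<phi> \<Longrightarrow> F \<subseteq> F' \<Longrightarrow> positive_in F' \<phi>" for F F' \<phi>
    unfolding positive_in_def by blast
  ultimately have "positive_in {} (mgoal N rs v0)"
    unfolding mgoal_def mderivable_def
    by (intro positive_in_intros positive_in_iterate positive_in_mblock) auto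
  then show ?thesis by (auto simp: wf_mu_def positive_in_def)
qed

lemma sem_mfalse [simp]: "mu_sem w V mfalse = {}"
proof -
  have "lfp (\<lambda>U. U) \<subseteq> ({} :: nat set)" by (rule lfp_lowerbound) simp
  then show ?thesis by (simp add: mfalse_def)
qed

lemma sem_mor [simp]: "mu_sem w V (mor a b) = mu_sem w V a \<union> mu_sem w V b"
  by (auto simp: mor_def)

lemma sem_mfirst [simp]: "mu_sem w V mfirst = {0}"
proof -
  have "i \<in> {0}" if "\<forall>j. i \<noteq> Suc j" for i using that by (cases i) auto
  then show ?thesis by (auto simp: mfirst_def)
qed

lemma sem_mprevs [simp]: "mu_sem w V (mprevs n a) = {p. n \<le> p \<and> p - n \<in> mu_sem w V a}"
proof (induction n)
  case (Suc n)
  have "p \<in> mu_sem w V (mprevs (Suc n) a) \<longleftrightarrow> Suc n \<le> p \<and> p - Suc n \<in> mu_sem w V a" for p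
    using Suc by (cases p) auto
  then show ?case by blast
qed simp

lemma sem_mnexts [simp]: "mu_sem w V (mnexts n a) = {p. p + n \<in> mu_sem w V a}"
  by (induction n) auto

lemma sem_mblock [simp]:
  assumes "0 < N"
  shows "mu_sem w V (mblock N) = {p. N dvd p}"
proof -
  let ?F = "\<lambda>U. {0} \<union> {p. N \<le> p \<and> p - N \<in> U}"
  have mono: "mono ?F" by (auto simp: mono_def)
  have "lfp ?F \<subseteq> {p. N dvd p}"
    by (rule lfp_lowerbound) (auto simp: dvd_diff_nat dest: dvd_diffD)
  moreover have "N * j \<in> lfp ?F" for j
  proof (induction j)
    case 0
    then show ?case by (subst lfp_unfold[OF mono]) simp
  next
    case (Suc j)
    then show ?case by (subst lfp_unfold[OF mono]) simp
  qed
  then have "{p. N dvd p} \<subseteq> lfp ?F" by (auto elim: dvdE)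
  ultimately show ?thesis by (simp add: mblock_def)
qed

lemma sem_mrule_Fact: "p \<in> mu_sem w V (mrule N (Fact v)) \<longleftrightarrow> p = v"
  by auto

lemma sem_mrule_Rule:
  assumes "0 < N"
  shows "p \<in> mu_sem w V (mrule N (Rule v us)) \<longleftrightarrow>
    v \<le> p \<and> N dvd p - v \<and> (\<forall>u \<in> set us. N \<le> p - v + u \<and> p - v + u - N \<in> V 0)"
proof -
  have "mu_sem w V (foldl (mpremise N) \<phi> us) =
    {p \<in> mu_sem w V \<phi>. \<forall>u \<in> set us. N \<le> p + u \<and> p + u - N \<in> V 0}" for \<phi>
    by (induction us arbitrary: \<phi>) (auto simp: mpremise_def)
  then show ?thesis using assms by simp
qed

lemma sem_mor_fold:
  "mu_sem w V (foldl (\<lambda>\<phi> r. mor \<phi> (mrule N r)) \<phi> rs) = mu_sem w V \<phi> \<union> (\<Union>r \<in> set rs. mu_sem w V (mrule N r))"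
  by (induction rs arbitrary: \<phi>) auto

text \<open>Since all variables are below \<open>N\<close>, a position determines block and variable
  by division. Facts hold only in block 0, and rules conclude only in later blocks, so a block is
  the same as a stage.\<close>

lemma sem_mderivable:
  assumes fact: "\<And>v. Fact v \<in> set rs \<Longrightarrow> v < N"
    and rule: "\<And>v us. Rule v us \<in> set rs \<Longrightarrow> v < N \<and> us \<noteq> [] \<and> (\<forall>u \<in> set us. u < N)"
    and N: "0 < N"
  shows "mu_sem w V (mderivable N rs) = {j * N + v |j v. v < N \<and> derivable (set rs) j v}"
proof -
  define F where "F U = (\<Union>r \<in> set rs. mu_sem w (V(0 := U)) (mrule N r))" for U
  have F: "p \<in> F U \<longleftrightarrow> Fact p \<in> set rs \<or> (\<exists>v us. Rule v us \<in> set rs \<and> v \<le> p \<and> N dvd p - v \<and>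
      (\<forall>u \<in> set us. N \<le> p - v + u \<and> p - v + u - N \<in> U))" (is "_ \<longleftrightarrow> ?r") for p U
  proof
    assume "p \<in> F U"
    then obtain r where r: "r \<in> set rs" "p \<in> mu_sem w (V(0 := U)) (mrule N r)" by (auto simp: F_def)
    show ?r
    proof (cases r)
      case (Fact v)
      then show ?thesis using r by (simp only: sem_mrule_Fact) simp
    next
      case (Rule v us)
      then show ?thesis
        using r sem_mrule_Rule[OF N, of p w "V(0 := U)" v us] unfolding fun_upd_same by blast
    qed
  next
    assume ?r
    then obtain r where "r \<in> set rs" "p \<in> mu_sem w (V(0 := U)) (mrule N r)"
      using sem_mrule_Fact sem_mrule_Rule[OF N] by (metis fun_upd_same)
    then show "p \<in> F U" unfolding F_def by blast
  qed
  have mono: "mono F"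
  proof (rule monoI)
    fix U U' :: "nat set" assume "U \<subseteq> U'"
    then show "F U \<subseteq> F U'" unfolding subset_iff F by blast
  qed
  let ?D = "{j * N + v |j v. v < N \<and> derivable (set rs) j v}"
  have "lfp F \<subseteq> ?D"
  proof (rule lfp_lowerbound, rule subsetI)
    fix p assume "p \<in> F ?D"
    then consider "Fact p \<in> set rs"
      | v us where "Rule v us \<in> set rs" "v \<le> p" "N dvd p - v"
          "\<forall>u \<in> set us. N \<le> p - v + u \<and> p - v + u - N \<in> ?D"
      unfolding F by blast
    then show "p \<in> ?D"
    proof cases
      case 1
      then have "p = 0 * N + p" "p < N" "derivable (set rs) 0 p" using fact by simp_all
      then show ?thesis by blast
    next
      case (2 v us)
      obtain j where "p - v = N * j" using 2(3) by (elim dvdE)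
      then have j: "p - v = j * N" by (simp add: mult.commute)
      \<comment> \<open>A premise exists and lies below \<open>N\<close>, so
        \<open>N \<le> j * N + u0\<close> is impossible in block 0; hence there is a previous
        block.\<close>
      obtain u0 where "u0 \<in> set us" using rule[OF 2(1)] by (cases us) auto
      then have "N \<le> j * N + u0" "u0 < N" using 2(4) rule[OF 2(1)] j by auto
      then obtain i where i: "j = Suc i" by (cases j) auto
      have "derivable (set rs) i u" if u: "u \<in> set us" for u
      proof -
        have "u < N" using rule[OF 2(1)] u by blast
        have "j * N + u - N = i * N + u" by (simp add: i)
        then obtain i' u' where "i * N + u = i' * N + u'" "u' < N" "derivable (set rs) i' u'"
          using 2(4) u j by fastforce
        moreover have "(i * N + u) div N = i" "(i' * N + u') div N = i'"
          using \<open>u < N\<close> \<open>u' < N\<close> by auto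
        ultimately have "i = i'" by metis
        then show ?thesis using \<open>i * N + u = i' * N + u'\<close> \<open>derivable (set rs) i' u'\<close> by simp
      qed
      then have "derivable (set rs) j v" using 2(1) i by auto
      moreover have "p = j * N + v" "v < N" using j 2(2) rule[OF 2(1)] by auto
      ultimately show ?thesis by blast
    qed
  qed
  moreover have "j * N + v \<in> lfp F" if "derivable (set rs) j v" for j v
    using that
  proof (induction j arbitrary: v)
    case 0
    then show ?case by (subst lfp_unfold[OF mono]) (simp add: F)
  next
    case (Suc j)
    then obtain us where us: "Rule v us \<in> set rs" "\<forall>u \<in> set us. j * N + u \<in> lfp F" by auto
    have "Suc j * N + v \<in> F (lfp F)"
      unfolding F using us by (intro disjI2 exI[of _ v] exI[of _ us]) auto
    then show ?case using lfp_unfold[OF mono] by simp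
  qed
  then have "?D \<subseteq> lfp F" by blast
  ultimately show ?thesis by (simp add: mderivable_def sem_mor_fold F_def[abs_def])
qed

lemma sem_mgoal:
  assumes rs: "\<And>v. Fact v \<in> set rs \<Longrightarrow> v < N"
      "\<And>v us. Rule v us \<in> set rs \<Longrightarrow> v < N \<and> us \<noteq> [] \<and> (\<forall>u \<in> set us. u < N)"
    and v0: "v0 < N"
  shows "0 \<in> mu_sem w V (mgoal N rs v0) \<longleftrightarrow> (\<exists>j. derivable (set rs) j v0)"
proof -
  have N: "0 < N" using v0 by simp
  define A where "A = {p. N dvd p \<and> (\<exists>j v. p + v0 = j * N + v \<and> v < N \<and> derivable (set rs) j v)}"
  let ?F = "\<lambda>U. A \<union> {p. Suc p \<in> U}"
  have mono: "mono ?F" by (auto simp: mono_def)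
  have A: "(\<exists>p. p \<in> A) \<longleftrightarrow> (\<exists>j. derivable (set rs) j v0)"
  proof
    assume "\<exists>p. p \<in> A"
    then obtain p j v where p: "N dvd p" "p + v0 = j * N + v" "v < N" "derivable (set rs) j v"
      by (auto simp: A_def)
    obtain k where k: "p = N * k" using p(1) by (elim dvdE)
    have "(N * k + v0) mod N = v0" "(j * N + v) mod N = v" using v0 p(3) by simp_all
    then have "v = v0" using p(2) k by metis
    then show "\<exists>j. derivable (set rs) j v0" using p(4) by blast
  next
    assume "\<exists>j. derivable (set rs) j v0"
    then obtain j where "derivable (set rs) j v0" ..
    then have "j * N \<in> A" using v0 unfolding A_def by auto
    then show "\<exists>p. p \<in> A" ..
  qed
  have "lfp ?F \<subseteq> {i. \<exists>p. p \<in> A}" by (rule lfp_lowerbound) auto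
  \<comment> \<open>Downward induction from \<open>p\<close> to 0; truncated subtraction makes the
    steps below 0 trivial, and \<open>i = p\<close> gives position 0.\<close>
  moreover have "p - i \<in> lfp ?F" if "p \<in> A" for p i
  proof (induction i)
    case 0
    then show ?case using that by (subst lfp_unfold[OF mono]) simp
  next
    case (Suc i)
    show ?case
    proof (cases "i < p")
      case True
      then have "Suc (p - Suc i) = p - i" by simp
      then show ?thesis using Suc by (subst lfp_unfold[OF mono]) simp
    next
      case False
      then show ?thesis using Suc by simp
    qed
  qed
  then have "0 \<in> lfp ?F" if "p \<in> A" for p using that diff_self_eq_0 by metis
  ultimately have "0 \<in> lfp ?F \<longleftrightarrow> (\<exists>p. p \<in> A)" by blast
  moreover have "mu_sem w V (mgoal N rs v0) = lfp ?F"
    unfolding mgoal_def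
    by (simp add: sem_mderivable[OF rs N] N A_def Collect_conj_eq[symmetric] del: Collect_conj_eq)
  ultimately show ?thesis using A by simp
qed

text \<open>A variant of \<open>dag_resolve\<close> that returns the whole environment instead of
  the last formula, so that node lists can be processed in chunks.\<close>

fun build :: "(nat \<rightharpoonup> mu) \<Rightarrow> (nat \<times> mu_node) list \<Rightarrow> (nat \<rightharpoonup> mu) option" where
  "build m [] = Some m"
| "build m ((k, n) # ns) = (case node_formula m n of None \<Rightarrow> None | Some \<phi> \<Rightarrow> build (m(k \<mapsto> \<phi>)) ns)"

lemma build_append: "build m (xs @ ys) = Option.bind (build m xs) (\<lambda>m. build m ys)"
proof (induction xs arbitrary: m)
  case (Cons x xs)
  then show ?case by (cases x) (simp del: fun_upd_apply split: option.split)
qed simp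

lemma dag_resolve_build:
  "build m (ns @ [(k, n)]) = Some m' \<Longrightarrow> dag_resolve m (ns @ [(k, n)]) = m' k"
proof (induction ns arbitrary: m)
  case Nil
  then show ?case by (auto split: option.splits)
next
  case (Cons x ns)
  obtain k' n' where x: "x = (k', n')" by fastforce
  with Cons.prems obtain \<phi> where \<phi>: "node_formula m n' = Some \<phi>"
    "build (m(k' \<mapsto> \<phi>)) (ns @ [(k, n)]) = Some m'" by (auto split: option.splits)
  obtain y ys where "ns @ [(k, n)] = y # ys" by (cases ns) auto
  then show ?case using Cons.IH[OF \<phi>(2)] \<phi>(1) x by (simp del: fun_upd_apply)
qed

text \<open>Rebinding \<open>k\<close> in terms of itself makes all nodes of an iteration the same
  text, which is just what \<open>Rep\<close> can print.\<close>

lemma build_iterate: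
  assumes "\<And>m \<phi>. m k = Some \<phi> \<Longrightarrow> node_formula m n = Some (f \<phi>)" "m k = Some \<phi>"
  shows "build m (replicate i (k, n)) = Some (m(k \<mapsto> (f ^^ i) \<phi>))"
  using assms(2)
proof (induction i arbitrary: m \<phi>)
  case 0
  then show ?case by (simp add: fun_upd_idem)
next
  case (Suc i)
  then have "build (m(k \<mapsto> f \<phi>)) (replicate i (k, n)) = Some (m(k \<mapsto> (f ^^ i) (f \<phi>)))"
    using Suc.IH[of "m(k \<mapsto> f \<phi>)" "f \<phi>"] by (simp del: fun_upd_apply add: fun_upd_same)
  then show ?case using Suc.prems assms(1)[of m \<phi>] by (simp del: fun_upd_apply add: funpow_swap1)
qed

lemma build_prevs: "m k = Some \<phi> \<Longrightarrow> build m (replicate i (k, NPrev k)) = Some (m(k \<mapsto> mprevs i \<phi>))"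
  and build_nexts: "m k = Some \<phi> \<Longrightarrow> build m (replicate i (k, NNext k)) = Some (m(k \<mapsto> mnexts i \<phi>))"
  by (rule build_iterate; simp)+

text \<open>
  Names are rebound all the time: 1 stands for \<open>mfirst\<close>, 2 for \<open>mblock N\<close>, 3 for \<open>mprevs N (MVar 0)\<close>,
  4 accumulates the disjunction of the rules, and the other names are temporary.
\<close>

definition or_nodes :: "(nat \<times> mu_node) list" where
  "or_nodes = [(4, NNot 4), (5, NNot 5), (4, NAnd 4 5), (4, NNot 4)]"

definition first_nodes :: "(nat \<times> mu_node) list" where
  "first_nodes = [(0, NVar 3), (0, NLfp 3 0), (1, NNot 0), (1, NPrev 1), (1, NNot 1), (2, NVar 1)]"

definition block_nodes :: "(nat \<times> mu_node) list" where
  "block_nodes = [(3, NNot 1), (2, NNot 2), (2, NAnd 3 2), (2, NNot 2), (2, NLfp 1 2), (3, NVar 0)]"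

definition false_nodes :: "(nat \<times> mu_node) list" where
  "false_nodes = [(4, NVar 3), (4, NLfp 3 4)]"

definition premise_nodes :: "nat \<Rightarrow> (nat \<times> mu_node) list" where
  "premise_nodes u = (6, NAnd 3 3) # replicate u (6, NNext 6) @ [(5, NAnd 5 6)]"

primrec rule_nodes :: "nat rule \<Rightarrow> (nat \<times> mu_node) list" where
  "rule_nodes (Fact v) = (5, NAnd 1 1) # replicate v (5, NPrev 5) @ or_nodes"
| "rule_nodes (Rule v us) = (5, NAnd 2 2) # concat (map premise_nodes us) @ replicate v (5, NPrev 5) @ or_nodes"

definition final_nodes :: "nat \<Rightarrow> (nat \<times> mu_node) list" where
  "final_nodes v0 = (4, NLfp 0 4) # replicate v0 (4, NNext 4) @
     [(4, NAnd 2 4), (5, NVar 2), (5, NNext 5)] @ or_nodes"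

definition goal_nodes :: "nat \<Rightarrow> nat rule list \<Rightarrow> nat \<Rightarrow> (nat \<times> mu_node) list" where
  "goal_nodes N rs v0 = first_nodes @ replicate N (2, NPrev 2) @ block_nodes @ replicate N (3, NPrev 3) @
     false_nodes @ concat (map rule_nodes rs) @ final_nodes v0 @ [(4, NLfp 2 4)]"

text \<open>The invariant between chunks of nodes: the shared formulae keep their names, and the
  names it does not mention may be overwritten.\<close>

definition names_ok :: "nat \<Rightarrow> mu \<Rightarrow> (nat \<rightharpoonup> mu) \<Rightarrow> bool" where
  "names_ok N \<phi> m \<longleftrightarrow> m 1 = Some mfirst \<and> m 2 = Some (mblock N) \<and> m 3 = Some (mprevs N (MVar 0)) \<and> m 4 = Some \<phi>"

lemma build_or:
  assumes "m 4 = Some \<phi>" "m 5 = Some \<psi>"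
  shows "\<exists>m'. build m or_nodes = Some m' \<and> m' 4 = Some (mor \<phi> \<psi>) \<and> (\<forall>k. k \<noteq> 4 \<and> k \<noteq> 5 \<longrightarrow> m' k = m k)"
  using assms by (simp add: or_nodes_def mor_def)

lemma build_premises:
  assumes "names_ok N \<phi> m" "m 5 = Some \<psi>"
  shows "\<exists>m'. build m (concat (map premise_nodes us)) = Some m' \<and> names_ok N \<phi> m' \<and>
    m' 5 = Some (foldl (mpremise N) \<psi> us)"
  using assms
proof (induction us arbitrary: m \<psi>)
  case (Cons u us)
  let ?Y = "MAnd (mprevs N (MVar 0)) (mprevs N (MVar 0))"
  let ?m = "m(6 \<mapsto> mnexts u ?Y, 5 \<mapsto> mpremise N \<psi> u)"
  have "build m (premise_nodes u) = Some ?m"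
    using Cons.prems build_nexts[of "m(6 \<mapsto> ?Y)" 6 ?Y u]
    by (simp add: premise_nodes_def build_append names_ok_def mpremise_def)
  moreover have "names_ok N \<phi> ?m" "?m 5 = Some (mpremise N \<psi> u)"
    using Cons.prems by (simp_all add: names_ok_def)
  moreover from this obtain m' where "build ?m (concat (map premise_nodes us)) = Some m'" "names_ok N \<phi> m'"
    "m' 5 = Some (foldl (mpremise N) (mpremise N \<psi> u) us)" using Cons.IH by blast
  ultimately show ?case by (intro exI[of _ m']) (simp add: build_append)
qed auto

lemma build_prevs_or:
  assumes "names_ok N \<phi> m" "m 5 = Some \<psi>"
  shows "\<exists>m'. build m (replicate v (5, NPrev 5) @ or_nodes) = Some m' \<and> names_ok N (mor \<phi> (mprevs v \<psi>)) m'"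
proof -
  let ?m = "m(5 \<mapsto> mprevs v \<psi>)"
  have m: "build m (replicate v (5, NPrev 5)) = Some ?m" using assms(2) by (rule build_prevs)
  have "?m 4 = Some \<phi>" "?m 5 = Some (mprevs v \<psi>)" using assms by (simp_all add: names_ok_def)
  from build_or[OF this] obtain m' where m': "build ?m or_nodes = Some m'" "m' 4 = Some (mor \<phi> (mprevs v \<psi>))"
    "\<forall>k. k \<noteq> 4 \<and> k \<noteq> 5 \<longrightarrow> m' k = ?m k" by blast
  have "names_ok N (mor \<phi> (mprevs v \<psi>)) m'" using m' assms(1) by (simp add: names_ok_def)
  then show ?thesis using m m'(1) by (simp add: build_append)
qed

lemma build_rule:
  assumes "names_ok N \<phi> m"
  shows "\<exists>m'. build m (rule_nodes r) = Some m' \<and> names_ok N (mor \<phi> (mrule N r)) m'"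
proof (cases r)
  case (Fact v)
  let ?m = "m(5 \<mapsto> MAnd mfirst mfirst)"
  have "names_ok N \<phi> ?m" "?m 5 = Some (MAnd mfirst mfirst)" using assms by (simp_all add: names_ok_def)
  moreover have "build m (rule_nodes r) = build ?m (replicate v (5, NPrev 5) @ or_nodes)"
    using assms Fact by (simp add: names_ok_def del: fun_upd_apply)
  ultimately show ?thesis using build_prevs_or[of N \<phi> ?m "MAnd mfirst mfirst" v] Fact by simp
next
  case (Rule v us)
  let ?b = "MAnd (mblock N) (mblock N)" and ?m = "m(5 \<mapsto> MAnd (mblock N) (mblock N))"
  have "names_ok N \<phi> ?m" "?m 5 = Some ?b" using assms by (simp_all add: names_ok_def)
  from build_premises[OF this, of us] obtain m' where m': "build ?m (concat (map premise_nodes us)) = Some m'"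
    "names_ok N \<phi> m'" "m' 5 = Some (foldl (mpremise N) ?b us)" by blast
  have "node_formula m (NAnd 2 2) = Some ?b" using assms by (simp add: names_ok_def)
  then have "build m (rule_nodes r) = build m' (replicate v (5, NPrev 5) @ or_nodes)"
    using m'(1) Rule by (simp add: build_append del: node_formula.simps)
  then show ?thesis using build_prevs_or[OF m'(2,3), of v] Rule by simp
qed

lemma build_rules:
  assumes "names_ok N \<phi> m"
  shows "\<exists>m'. build m (concat (map rule_nodes rs)) = Some m' \<and> names_ok N (foldl (\<lambda>\<phi> r. mor \<phi> (mrule N r)) \<phi> rs) m'"
  using assms
proof (induction rs arbitrary: m \<phi>)
  case (Cons r rs)
  obtain m' where m': "build m (rule_nodes r) = Some m'" "names_ok N (mor \<phi> (mrule N r)) m'"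
    using build_rule[OF Cons.prems] by blast
  then show ?case using Cons.IH[OF m'(2)] by (simp add: build_append)
qed auto

lemma build_names:
  "\<exists>m. build Map.empty (first_nodes @ replicate N (2, NPrev 2) @ block_nodes @ replicate N (3, NPrev 3) @ false_nodes)
     = Some m \<and> names_ok N mfalse m"
proof -
  define m1 where "m1 = Map.empty(0 :: nat \<mapsto> mfalse, 1 \<mapsto> mfirst, 2 \<mapsto> MVar 1)"
  have 1: "build Map.empty first_nodes = Some m1"
    by (simp add: first_nodes_def m1_def mfalse_def mfirst_def)
  define m2 where "m2 = m1(2 \<mapsto> mprevs N (MVar 1))"
  have 2: "build m1 (replicate N (2, NPrev 2)) = Some m2"
    unfolding m2_def by (rule build_prevs) (simp add: m1_def)
  define m3 where "m3 = m2(2 \<mapsto> mblock N, 3 \<mapsto> MVar 0)"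
  have 3: "build m2 block_nodes = Some m3"
    by (simp add: block_nodes_def m3_def m2_def m1_def mblock_def mor_def fun_upd_twist)
  define m4 where "m4 = m3(3 \<mapsto> mprevs N (MVar 0))"
  have 4: "build m3 (replicate N (3, NPrev 3)) = Some m4"
    unfolding m4_def by (rule build_prevs) (simp add: m3_def)
  have 5: "build m4 false_nodes = Some (m4(4 \<mapsto> mfalse))"
    by (simp add: false_nodes_def mfalse_def)
  have "names_ok N mfalse (m4(4 \<mapsto> mfalse))"
    by (simp add: names_ok_def m4_def m3_def m2_def m1_def)
  then show ?thesis using 1 2 3 4 5 by (simp add: build_append)
qed

lemma dag_goal: "dag_formula (goal_nodes N rs v0) = Some (mgoal N rs v0)"
proof -
  obtain m where m: "build Map.empty (first_nodes @ replicate N (2, NPrev 2) @ block_nodes @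
      replicate N (3, NPrev 3) @ false_nodes) = Some m" "names_ok N mfalse m"
    using build_names by blast
  let ?body = "foldl (\<lambda>\<phi> r. mor \<phi> (mrule N r)) mfalse rs"
  obtain m' where m': "build m (concat (map rule_nodes rs)) = Some m'" "names_ok N ?body m'"
    using build_rules[OF m(2)] by blast
  let ?goal = "MAnd (mblock N) (mnexts v0 (mderivable N rs))"
  let ?m1 = "m'(4 \<mapsto> ?goal, 5 \<mapsto> MNext (MVar 2))"
  have "build (m'(4 \<mapsto> mderivable N rs)) (replicate v0 (4, NNext 4)) =
      Some (m'(4 \<mapsto> mnexts v0 (mderivable N rs)))"
    using build_nexts[of "m'(4 \<mapsto> mderivable N rs)" 4 "mderivable N rs" v0] by simp
  then have 1: "build m' (final_nodes v0) = build ?m1 or_nodes"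
    using m'(2) by (simp add: final_nodes_def build_append names_ok_def mderivable_def)
  obtain m'' where m'': "build ?m1 or_nodes = Some m''" "m'' 4 = Some (mor ?goal (MNext (MVar 2)))"
    using build_or[of ?m1 ?goal "MNext (MVar 2)"] by auto
  define ns0 where "ns0 = first_nodes @ replicate N (2, NPrev 2) @ block_nodes @
      replicate N (3, NPrev 3) @ false_nodes"
  define ns where "ns = ns0 @ concat (map rule_nodes rs) @ final_nodes v0"
  have "build Map.empty ns = Some m''"
    using m(1)[folded ns0_def] m'(1) 1 m''(1) by (simp add: ns_def build_append)
  then have "build Map.empty (ns @ [(4, NLfp 2 4)]) = Some (m''(4 \<mapsto> mgoal N rs v0))"
    using m''(2) by (simp add: build_append mgoal_def)
  from dag_resolve_build[OF this] show ?thesis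
    by (simp add: dag_formula_def goal_nodes_def ns_def ns0_def)
qed

section \<open>Printing the formula and the reductions for the mu-calculus\<close>

definition print_nodes :: "(nat \<times> mu_node) list \<Rightarrow> bool list" where
  "print_nodes ns = concat (map (\<lambda>n. serialize (enc_mu_node n)) ns)"

lemma print_nodes_simps:
  "print_nodes [] = []"
  "print_nodes (x # xs) = serialize (enc_mu_node x) @ print_nodes xs"
  "print_nodes (xs @ ys) = print_nodes xs @ print_nodes ys"
  "print_nodes (replicate n x) = concat (replicate n (serialize (enc_mu_node x)))"
  "print_nodes (concat (map f us)) = concat (map (\<lambda>u. print_nodes (f u)) us)"
  by (simp_all add: print_nodes_def concat_map_concat o_def)

definition premise_pieces :: "lin \<Rightarrow> piece list" where
  "premise_pieces e = [Lit (print_nodes [(6, NAnd 3 3)]), Rep e (print_nodes [(6, NNext 6)]),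
     Lit (print_nodes [(5, NAnd 5 6)])]"

primrec rule_node_pieces :: "lin rule \<Rightarrow> piece list" where
  "rule_node_pieces (Fact e) = [Lit (print_nodes [(5, NAnd 1 1)]), Rep e (print_nodes [(5, NPrev 5)]),
     Lit (print_nodes or_nodes)]"
| "rule_node_pieces (Rule e es) = Lit (print_nodes [(5, NAnd 2 2)]) # concat (map premise_pieces es) @
     [Rep e (print_nodes [(5, NPrev 5)]), Lit (print_nodes or_nodes)]"

lemma rule_node_pieces_out:
  "pieces_out R i (rule_node_pieces r) = print_nodes (rule_nodes (map_rule (lin_val R i) r))"
proof -
  have "pieces_out R i (premise_pieces e) = print_nodes (premise_nodes (lin_val R i e))" for e
    by (simp add: premise_pieces_def premise_nodes_def print_nodes_simps)
  then have "pieces_out R i (concat (map premise_pieces es)) =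
      print_nodes (concat (map premise_nodes (map (lin_val R i) es)))" for es
    by (induction es) (simp_all add: print_nodes_simps)
  then show ?thesis by (cases r) (simp_all add: print_nodes_simps)
qed

definition mu_segs :: "sexp list \<Rightarrow> tm \<Rightarrow> seg list" where
  "mu_segs ts M =
     [Pieces [Lit (tbits (Open # concat (map tokens ts) @ [Open]) @ print_nodes first_nodes),
        Rep (var_limit M) (print_nodes [(2, NPrev 2)]), Lit (print_nodes block_nodes),
        Rep (var_limit M) (print_nodes [(3, NPrev 3)]), Lit (print_nodes false_nodes)]] @
     rules_segs rule_node_pieces M @
     [Pieces [Lit (print_nodes (final_nodes (accept M) @ [(4, NLfp 2 4)]) @ tbits [Close, Close])]]"

lemma mu_segs_out:
  "concat (map (seg_out w) (mu_segs ts M)) = serialize (Node (ts @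
     [enc_list enc_mu_node (goal_nodes (lin_val (length w) 0 (var_limit M)) (tm_rules M w) (accept M))]))"
proof -
  have "serialize (Node (ts @ [enc_list enc_mu_node ns])) =
      tbits (Open # concat (map tokens ts) @ [Open]) @ print_nodes ns @ tbits [Close, Close]" for ns
    using tbits_concat_map[of "map enc_mu_node ns"]
    by (simp add: serialize_def enc_list_def print_nodes_def o_def)
  then show ?thesis
    unfolding mu_segs_def map_append concat_append rules_segs_out[OF rule_node_pieces_out]
    by (simp add: goal_nodes_def print_nodes_simps)
qed

text \<open>Over the empty set of symbols there is just one letter and one word, so both problems
  come down to the truth of the formula at position 0.\<close>

lemma mu_lang_empty: "mu_lang {} \<phi> = {w. w = (\<lambda>_. {}) \<and> 0 \<in> mu_sem w (\<lambda>_. {}) \<phi>}"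
  by (auto simp: mu_lang_def fun_eq_iff)

lemma mgoal_lang:
  assumes M: "wf_tm M" and s: "tm_decides_in_space M L s" "2 * s (length x) < length (padded c d x)"
  shows "x \<in> L \<longleftrightarrow> mu_lang {} (mgoal (lin_val (length (padded c d x)) 0 (var_limit M))
    (tm_rules M (padded c d x)) (accept M)) = {\<lambda>_. {}}"
    and "mu_lang {} (mgoal (lin_val (length (padded c d x)) 0 (var_limit M))
    (tm_rules M (padded c d x)) (accept M)) \<subseteq> {\<lambda>_. {}}"
proof -
  let ?rs = "tm_rules M (padded c d x)"
  let ?N = "lin_val (length (padded c d x)) 0 (var_limit M)"
  have "accept M < ?N" using M by (simp add: wf_tm_def var_limit_def)
  then have "0 \<in> mu_sem w V (mgoal ?N ?rs (accept M)) \<longleftrightarrow> (\<exists>j. derivable (set ?rs) j (accept M))" for w V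
    using tm_rules_vars[OF M refl] by (intro sem_mgoal) blast+
  moreover have "x \<in> L \<longleftrightarrow> (\<exists>j. derivable (set ?rs) j (accept M))"
    using tm_rules_correct[OF M s] by blast
  ultimately show "x \<in> L \<longleftrightarrow> mu_lang {} (mgoal ?N ?rs (accept M)) = {\<lambda>_. {}}"
    unfolding mu_lang_empty by auto
qed (auto simp: mu_lang_empty)

definition empty_cps :: cps where
  "empty_cps = \<lparr>segs = [], final_path = [], final_loop = [[]], constr = true_guard 0\<rparr>"

lemma wf_empty_cps: "wf_cps (Pow (syms [] [])) empty_cps"
  by (simp add: wf_cps_def empty_cps_def true_guard letters_def)

lemma empty_cps_lang: "cps_lang empty_cps = {\<lambda>_. {}}"
  by (auto simp: cps_lang_def empty_cps_def true_guard unfold_segs_def iter_def fun_eq_iff)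

lemma INTERSECT_MUTL_hard: "PSPACE_hard INTERSECT_MUTL"
proof (rule PSPACE_hardI)
  fix M :: tm and c d assume M: "wf_tm M"
  let ?ts = "[enc_nat 0, enc_list enc_nat [], enc_list enc_aguard [], enc_cps empty_cps]"
  have "x \<in> L \<longleftrightarrow> concat (map (seg_out (padded c d x)) (mu_segs ?ts M)) \<in> INTERSECT_MUTL"
    if L: "tm_decides_in_space M L s" "2 * s (length x) < length (padded c d x)" for x L s
  proof -
    let ?N = "lin_val (length (padded c d x)) 0 (var_limit M)" and ?rs = "tm_rules M (padded c d x)"
    let ?\<phi> = "mgoal ?N ?rs (accept M)" and ?ns = "goal_nodes ?N ?rs (accept M)"
    have "x \<in> L \<longleftrightarrow> cps_lang empty_cps \<inter> mu_lang {} ?\<phi> \<noteq> {}"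
      using mgoal_lang[OF M L] unfolding empty_cps_lang by auto
    also have "\<dots> \<longleftrightarrow> serialize (Node (?ts @ [enc_list enc_mu_node ?ns])) \<in> INTERSECT_MUTL"
      using wf_empty_cps wf_mgoal dag_goal[of ?N ?rs "accept M"]
      unfolding INTERSECT_MUTL_def serialize_Node_inj mem_Collect_eq
      by (auto simp: wf_calph_def syms_def inj_enc_mu_node inj_eq[OF inj_enc_cps])
    finally show ?thesis unfolding mu_segs_out .
  qed
  then show "\<exists>ss. \<forall>x. (\<forall>L s. tm_decides_in_space M L s \<longrightarrow> 2 * s (length x) < length (padded c d x) \<longrightarrow>
      (x \<in> L \<longleftrightarrow> concat (map (seg_out (padded c d x)) ss) \<in> INTERSECT_MUTL))"
    by blast
qed

text \<open>A single infinite run is enough: the formula carries the whole computation, and the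
  system only has to supply positions.\<close>

definition loop_system :: counter_system where
  "loop_system = \<lparr>dim = 0, ctrl = [(0, [])], transitions = [(0, true_guard 0, [], 0)]\<rparr>"

lemma wf_loop_system: "wf_cs loop_system" "flat loop_system" "(0, []) \<in> configs loop_system"
proof -
  show "wf_cs loop_system" "(0, []) \<in> configs loop_system"
    by (auto simp: loop_system_def wf_cs_def configs_def states_def true_guard)
  show "flat loop_system"
    by (rule flat_if_monotone) (auto simp: loop_system_def src_def tgt_def)
qed

lemma loop_system_run: "is_run loop_system (0, []) (\<lambda>_. (0, []))"
  by (simp add: is_run_def cs_step_def loop_system_def configs_def states_def true_guard)

lemma MC_MUTL_hard: "PSPACE_hard MC_MUTL_CFS"
proof (rule PSPACE_hardI)
  fix M :: tm and c d assume M: "wf_tm M"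
  let ?ts = "[enc_cs loop_system, enc_config (0, []), enc_list enc_nat [], enc_list enc_aguard []]"
  have "x \<in> L \<longleftrightarrow> concat (map (seg_out (padded c d x)) (mu_segs ?ts M)) \<in> MC_MUTL_CFS"
    if L: "tm_decides_in_space M L s" "2 * s (length x) < length (padded c d x)" for x L s
  proof -
    let ?N = "lin_val (length (padded c d x)) 0 (var_limit M)" and ?rs = "tm_rules M (padded c d x)"
    let ?\<phi> = "mgoal ?N ?rs (accept M)" and ?ns = "goal_nodes ?N ?rs (accept M)"
    have "run_sat S [] [] \<rho> w" for S \<rho> w by (simp add: run_sat_def)
    then have "x \<in> L \<longleftrightarrow> mc_holds loop_system (0, []) [] [] (mu_lang {} ?\<phi>)"
      using mgoal_lang[OF M L] loop_system_run unfolding mc_holds_def by blast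
    also have "\<dots> \<longleftrightarrow> serialize (Node (?ts @ [enc_list enc_mu_node ?ns])) \<in> MC_MUTL_CFS"
      using wf_loop_system wf_mgoal dag_goal[of ?N ?rs "accept M"]
      unfolding MC_MUTL_CFS_def serialize_Node_inj mem_Collect_eq
      by (auto simp del: enc_config.simps simp: wf_calph_def syms_def inj_enc_mu_node
        inj_eq[OF inj_enc_cs] inj_eq[OF inj_enc_config])
    finally show ?thesis unfolding mu_segs_out .
  qed
  then show "\<exists>ss. \<forall>x. (\<forall>L s. tm_decides_in_space M L s \<longrightarrow> 2 * s (length x) < length (padded c d x) \<longrightarrow>
      (x \<in> L \<longleftrightarrow> concat (map (seg_out (padded c d x)) ss) \<in> MC_MUTL_CFS))"
    by blast
qed

theorem theorem15:
  shows "(PSPACE_hard INTERSECT_ABA \<and> PSPACE_hard INTERSECT_MUTL) \<and>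
         (PSPACE_hard MC_ABA_CFS \<and> PSPACE_hard MC_MUTL_CFS)"
  by (intro conjI INTERSECT_ABA_hard INTERSECT_MUTL_hard MC_ABA_hard MC_MUTL_hard)

end
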